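(* Let $\beta$ be a periodic direction (equivalently, a vertex of one of the ideal pentagons of the tiling described in the context). Let $\gamma_1,\gamma_2,\dots$ and $\gamma_{-1},\gamma_{-2},\dots$ be the two monotonic sequences, approaching $\beta$ along the circle at infinity from its two sides, which together consist of all the points connected with $\beta$ by arcs (sides of ideal pentagons of the tiling). Here $\gamma_{-1}$ and $\gamma_{1}$ are the two neighbours of $\beta$ in the pentagon of the smallest generation having $\beta$ as a vertex, and the further $\gamma_{-2},\gamma_{-3},\dots$ (respectively $\gamma_2,\gamma_3,\dots$) are the consecutive points connected with $\beta$ that are met when going from $\gamma_{-1}$ (respectively from $\gamma_1$) to $\beta$ along the arc of the circle at infinity that contains no other vertex of that pentagon. Then there exist linear words $u,v,x,y,z,w$ in the alphabet $\{1,2,3,4,5\}$ (in exceptional cases some of them empty) such that, setting $a=uv$, $A=xy$, $\overline A=zw$, the word $a$ closes up to the short cyclic symbolic orbit of $\beta$, both words $A$ and $\overline A$ close up to the long cyclic symbolic orbit of $\beta$ (so $\overline A$ is a cyclic permutation of $A$), and for every $n\ge 0$: - the short and long symbolic orbits of $\gamma_{-1-n}$ are the cyclic words obtained by closing up $A^n x$ and $\overline A^{\,n} z v a^n$, respectively; - the short and long symbolic orbits of $\gamma_{1+n}$ are the cyclic words obtained by closing up $yA^n$ and $a^n u w \overline A^{\,n}$, respectively.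
   Context: Double pentagon. Let $P$ be a regular pentagon in the plane with a horizontal bottom side, and let $-P$ be a centrally symmetric copy of it. Each side of $P$ is glued by a parallel translation to the side of $-P$ parallel to it. The result is a closed translation surface of genus $2$ with one conical singularity. The five pairs of glued sides are labeled by $1,2,3,4,5$: going counterclockwise around $P$ from the bottom side, the labels are $3,5,2,4,1$; equivalently, the side labeled $k$ has direction making angle $(k-3)\pi/5 \pmod \pi$ with the horizontal. Directions. Opposite directions are identified, so the set of directions is $\mathbb{RP}^1$. It is identified with the circle at infinity of the Poincaré disc by sending the direction at angle $\theta$ to $e^{2i\theta}$. A direction is called periodic if linear trajectories (straight geodesics) in this direction on the double pentagon are closed; if one is closed, then all non-singular ones in that direction are, and they form two strips (maximal families of parallel closed trajectories), which cover the surface. One strip consists of longer and the other of shorter (in geometric length) trajectories. Symbolic orbits. The symbolic orbit of a strip is the cyclic word in the symbols $1,\dots,5$ consisting of the labels of the sides consecutively crossed during one full traversal of a closed trajectory of the strip. The short (long) symbolic orbit of a periodic direction is the symbolic orbit of its shorter (longer) strip. For example, for the direction parallel to side $1$ the short orbit is $25$ and the long orbit is $43$; for the direction parallel to side $5$ the short orbit is $41$ and the long orbit is $23$. Tiling. The directions of the five sides of $P$ are five points on the circle at infinity; they are the vertices of a regular ideal pentagon, called the pentagon of generation $0$. Successive reflections in sides tile the hyperbolic plane by ideal pentagons: the pentagons of generation $k+1$ are the reflections of pentagons of generation $k$ in those of their sides that are not shared with a pentagon of generation $k-1$. The vertices of this tiling are exactly the periodic directions. Each vertex is joined by sides of pentagons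 of the tiling to infinitely many other vertices, which accumulate to it from both sides along the circle. Words: $W^n$ denotes the $n$-fold repetition of the linear word $W$ ($W^0$ is empty), juxtaposition is concatenation, and closing up a linear word means considering it up to cyclic rotation.
   Formalization: The formal theorem excludes the five vertices β of the generation-0 pentagon, where the claim fails: for β parallel to side 1, A closes up to 43, but its neighbour, parallel to side 5, has short orbit 41, which would have to be x or y. *)

theory Defs
  imports "HOL-Analysis.Analysis"
begin

section \<open>The double pentagon\<close>

text \<open>The plane is \<open>complex\<close>. The pentagon is centred at the origin and inscribed in the unit
  circle; its vertices are numbered counterclockwise, and \<open>corner 0\<close>, \<open>corner 1\<close> are the endpoints
  of the horizontal bottom side. Indices are meaningful modulo 5.\<close>

definition corner :: "nat \<Rightarrow> complex" where
  "corner j = cis (2 * pi * real j / 5 + 13 * pi / 10)"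

datatype sheet = Pos | Neg

fun sheet_sign :: "sheet \<Rightarrow> complex" where
  "sheet_sign Pos = 1"
| "sheet_sign Neg = -1"

fun other_sheet :: "sheet \<Rightarrow> sheet" where
  "other_sheet Pos = Neg"
| "other_sheet Neg = Pos"

text \<open>The two polygons are kept apart by the tag \<open>sheet\<close>, although as subsets of the plane they
  overlap.\<close>

definition polygon :: "sheet \<Rightarrow> complex set" where
  "polygon s = convex hull ((\<lambda>j. sheet_sign s * corner j) ` {..<5})"

definition open_side :: "sheet \<Rightarrow> nat \<Rightarrow> complex set" where
  "open_side s j = open_segment (sheet_sign s * corner j) (sheet_sign s * corner (Suc j))"

definition side_label :: "nat \<Rightarrow> nat" where
  "side_label j = [3, 5, 2, 4, 1] ! j"

text \<open>The parallel translation that carries side \<open>j\<close> of one polygon onto side \<open>j\<close> of the other;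
  the two sides are symmetric about the origin, so the translation vector is minus twice the
  midpoint.\<close>

definition glue :: "sheet \<Rightarrow> nat \<Rightarrow> complex \<Rightarrow> complex" where
  "glue s j p = p - sheet_sign s * (corner j + corner (Suc j))"

section \<open>Linear trajectories and strips\<close>

text \<open>A non-singular linear trajectory is recorded as the bi-infinite sequence of chords that it
  cuts out in the two polygons. The side index of a chord is that of the side through which the
  trajectory leaves the polygon.\<close>

datatype chord = Chord (chord_sheet: sheet) (enter: complex) (leave: complex) (exit_side: nat)

definition is_chord :: "complex \<Rightarrow> chord \<Rightarrow> bool" where
  "is_chord d c \<longleftrightarrow>
     exit_side c < 5 \<and>
     leave c \<in> open_side (chord_sheet c) (exit_side c) \<and>
     (\<exists>t>0. leave c = enter c + complex_of_real t * d) \<and>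
     open_segment (enter c) (leave c) \<subseteq> interior (polygon (chord_sheet c))"

definition follows :: "chord \<Rightarrow> chord \<Rightarrow> bool" where
  "follows c c' \<longleftrightarrow>
     chord_sheet c' = other_sheet (chord_sheet c) \<and>
     enter c' = glue (chord_sheet c) (exit_side c) (leave c)"

definition trajectory :: "complex \<Rightarrow> (int \<Rightarrow> chord) \<Rightarrow> bool" where
  "trajectory d c \<longleftrightarrow> (\<forall>i. is_chord d (c i) \<and> follows (c i) (c (i + 1)))"

definition closed_trajectory :: "complex \<Rightarrow> (int \<Rightarrow> chord) \<Rightarrow> bool" where
  "closed_trajectory d c \<longleftrightarrow> trajectory d c \<and> (\<exists>n::nat. n > 0 \<and> (\<forall>i. c (i + int n) = c i))"

definition period :: "(int \<Rightarrow> chord) \<Rightarrow> nat" where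
  "period c = (LEAST n. n > 0 \<and> (\<forall>i. c (i + int n) = c i))"

definition trajectory_length :: "(int \<Rightarrow> chord) \<Rightarrow> real" where
  "trajectory_length c = (\<Sum>i<period c. dist (enter (c (int i))) (leave (c (int i))))"

definition crossing_word :: "(int \<Rightarrow> chord) \<Rightarrow> nat list" where
  "crossing_word c = map (\<lambda>i. side_label (exit_side (c (int i)))) [0..<period c]"

text \<open>A cyclic word is the set of all rotations of a linear word; \<open>cyclic w\<close> is \<open>w\<close> closed up.\<close>

definition cyclic :: "'a list \<Rightarrow> 'a list set" where
  "cyclic w = range (\<lambda>k. rotate k w)"

text \<open>Two closed trajectories lie in one strip if the first can be moved to the second through
  closed trajectories of the same direction. The shift \<open>m\<close> accounts for the arbitrary choice of
  the chord numbered 0.\<close>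

definition same_strip :: "complex \<Rightarrow> (int \<Rightarrow> chord) \<Rightarrow> (int \<Rightarrow> chord) \<Rightarrow> bool" where
  "same_strip d c c' \<longleftrightarrow>
     (\<exists>(F :: real \<Rightarrow> int \<Rightarrow> chord) (m :: int).
        F 0 = c \<and> F 1 = (\<lambda>i. c' (i + m)) \<and>
        (\<forall>t\<in>{0..1}. closed_trajectory d (F t)) \<and>
        (\<forall>i. (\<forall>t\<in>{0..1}. chord_sheet (F t i) = chord_sheet (c i)) \<and>
             continuous_on {0..1} (\<lambda>t. enter (F t i))))"

definition strips :: "complex \<Rightarrow> (int \<Rightarrow> chord) set set" where
  "strips d = {{c'. same_strip d c c'} |c. closed_trajectory d c}"

definition shorter_longer_strips ::
  "complex \<Rightarrow> (int \<Rightarrow> chord) set \<Rightarrow> (int \<Rightarrow> chord) set \<Rightarrow> bool" where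
  "shorter_longer_strips d S L \<longleftrightarrow>
     strips d = {S, L} \<and> (\<forall>c\<in>S. \<forall>c'\<in>L. trajectory_length c < trajectory_length c')"

section \<open>Directions\<close>

text \<open>A direction at angle \<open>\<theta>\<close> is the point \<open>\<beta> = cis (2 * \<theta>)\<close>; the unit vectors \<open>d\<close> with
  \<open>d\<^sup>2 = \<beta>\<close> are its two orientations, and everything below is required for both of them.\<close>

definition periodic_direction :: "complex \<Rightarrow> bool" where
  "periodic_direction \<beta> \<longleftrightarrow>
     cmod \<beta> = 1 \<and> (\<forall>d. d\<^sup>2 = \<beta> \<longrightarrow> (\<forall>c. trajectory d c \<longrightarrow> closed_trajectory d c))"

definition short_orbit :: "complex \<Rightarrow> nat list set \<Rightarrow> bool" where
  "short_orbit \<beta> W \<longleftrightarrow>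
     (\<forall>d. d\<^sup>2 = \<beta> \<longrightarrow>
        (\<exists>S L. shorter_longer_strips d S L \<and> (\<forall>c\<in>S. cyclic (crossing_word c) = W)))"

definition long_orbit :: "complex \<Rightarrow> nat list set \<Rightarrow> bool" where
  "long_orbit \<beta> W \<longleftrightarrow>
     (\<forall>d. d\<^sup>2 = \<beta> \<longrightarrow>
        (\<exists>S L. shorter_longer_strips d S L \<and> (\<forall>c\<in>L. cyclic (crossing_word c) = W)))"

section \<open>The tiling by ideal pentagons\<close>

text \<open>A geodesic of the disc is given by the set of its two ideal endpoints, and an ideal polygon
  by the set of its sides. \<open>hyp_reflection p q\<close> is the inversion in the circle orthogonal to the
  unit circle at \<open>p\<close> and \<open>q\<close>, whose centre is \<open>2 * p * q / (p + q)\<close>; in this form it also covers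
  the case of a diameter (\<open>p + q = 0\<close>).\<close>

definition hyp_reflection :: "complex \<Rightarrow> complex \<Rightarrow> complex \<Rightarrow> complex" where
  "hyp_reflection p q z = (2 * p * q * cnj z - (p + q)) / ((p + q) * cnj z - 2)"

definition reflect_polygon :: "complex \<Rightarrow> complex \<Rightarrow> complex set set \<Rightarrow> complex set set" where
  "reflect_polygon p q Q = (\<lambda>s. hyp_reflection p q ` s) ` Q"

text \<open>The side of the pentagon labelled \<open>k\<close> is at angle \<open>(k - 3) * pi / 5\<close>. The five vertices of
  \<open>base_pentagon\<close> are exceptional for the relation \<open>A = x @ y\<close>: a vertex has long orbit of length
  2, such as \<open>43\<close> for the direction of side 1, while its two neighbours in \<open>base_pentagon\<close> have
  short orbits of length 2 each, such as \<open>41\<close> for side 5, so these cannot be \<open>x\<close> and \<open>y\<close>.\<close>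

definition side_direction :: "nat \<Rightarrow> complex" where
  "side_direction k = cis (2 * ((real k - 3) * pi / 5))"

definition base_pentagon :: "complex set set" where
  "base_pentagon = {{side_direction k, side_direction (Suc k)} |k. k \<in> {1..5}}"

fun generation :: "nat \<Rightarrow> complex set set set" where
  "generation 0 = {base_pentagon}"
| "generation (Suc 0) = {reflect_polygon p q base_pentagon |p q. {p, q} \<in> base_pentagon}"
| "generation (Suc (Suc k)) =
     {reflect_polygon p q Q |p q Q.
        Q \<in> generation (Suc k) \<and> {p, q} \<in> Q \<and> {p, q} \<notin> \<Union> (generation k)}"

definition joined :: "complex \<Rightarrow> complex \<Rightarrow> bool" where
  "joined p q \<longleftrightarrow> (\<exists>k. {p, q} \<in> \<Union> (generation k))"

definition first_pentagon :: "complex \<Rightarrow> complex set set \<Rightarrow> bool" where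
  "first_pentagon \<beta> Q \<longleftrightarrow>
     (\<exists>k. Q \<in> generation k \<and> \<beta> \<in> \<Union> Q \<and> (\<forall>j<k. \<forall>R\<in>generation j. \<beta> \<notin> \<Union> R))"

definition ccw_angle :: "complex \<Rightarrow> complex \<Rightarrow> real" where
  "ccw_angle \<beta> p = Arg2pi (p / \<beta>)"

definition cw_angle :: "complex \<Rightarrow> complex \<Rightarrow> real" where
  "cw_angle \<beta> p = Arg2pi (\<beta> / p)"

text \<open>The sequence \<open>g\<close> approaches \<open>\<beta>\<close> from the side on which positions are measured by the
  angle \<open>\<Theta>\<close> from \<open>\<beta>\<close>: it starts at the neighbour of \<open>\<beta>\<close> in \<open>Q\<close> on that side and runs, in order,
  through all the points joined with \<open>\<beta>\<close> on the arc from that neighbour to \<open>\<beta>\<close> that contains no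
  other vertex of \<open>Q\<close>.\<close>

definition one_sided_fan ::
  "(complex \<Rightarrow> real) \<Rightarrow> complex \<Rightarrow> complex set set \<Rightarrow> (nat \<Rightarrow> complex) \<Rightarrow> bool" where
  "one_sided_fan \<Theta> \<beta> Q g \<longleftrightarrow>
     {\<beta>, g 0} \<in> Q \<and>
     (\<forall>v \<in> \<Union> Q. \<not> (0 < \<Theta> v \<and> \<Theta> v < \<Theta> (g 0))) \<and>
     range g = {p. joined \<beta> p \<and> \<Theta> p \<le> \<Theta> (g 0)} \<and>
     (\<forall>n. \<Theta> (g (Suc n)) < \<Theta> (g n)) \<and>
     g \<longlonglongrightarrow> \<beta>"

text \<open>\<open>\<gamma> 0\<close> is irrelevant. Which of the two sides of \<open>\<beta>\<close> gets the positive indices is left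
  open.\<close>

definition fan :: "complex \<Rightarrow> (int \<Rightarrow> complex) \<Rightarrow> bool" where
  "fan \<beta> \<gamma> \<longleftrightarrow>
     (\<exists>Q. first_pentagon \<beta> Q \<and>
        (let pos = (\<lambda>n::nat. \<gamma> (1 + int n)); neg = (\<lambda>n::nat. \<gamma> (- 1 - int n)) in
           one_sided_fan (ccw_angle \<beta>) \<beta> Q neg \<and> one_sided_fan (cw_angle \<beta>) \<beta> Q pos \<or>
           one_sided_fan (cw_angle \<beta>) \<beta> Q neg \<and> one_sided_fan (ccw_angle \<beta>) \<beta> Q pos))"

section \<open>Powers of words\<close>

definition word_power :: "'a list \<Rightarrow> nat \<Rightarrow> 'a list" where
  "word_power W n = concat (replicate n W)"

end

theory Submission
  imports Defs
begin

text \<open>Here \<open>gold\<close> is the inverse golden ratio; put \<phi> = 1 +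
  \<open>gold\<close>. Cut and pasted, the double pentagon is an affine image of the golden L, which
  consists of a unit square \<open>Corner\<close>, a rectangle \<open>Arm\<close> to its right and a
  rectangle \<open>Top\<close> above it. For vectors P, Q along the two ends of a side of the
  tiling, suitably normalised, the surface is this L with P and Q as its horizontal and vertical
  unit vectors, and every trajectory in a direction sP + tQ with s, t \<ge> 0 that never meets a
  vertex eventually runs from cell to cell. The locale \<open>coding\<close> records this: leaving
  cell i through its right edge always spells one and the same word \<open>E i\<close> of pentagon
  sides, leaving it through its top edge always spells \<open>F i\<close>. Hence the strips of
  direction P are the two rows of the L and those of direction Q its two columns: short and long
  orbits are \<open>E Top\<close> and \<open>E Corner @ E Arm\<close> for P, \<open>F Arm\<close>
  and \<open>F Corner @ F Top\<close> for Q (\<open>coding_orbits_P\<close>,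
  \<open>coding_orbits_Q\<close>).

  Affine automorphisms of the L carry a coding of (P, Q) to codings of other pairs and rewrite E and
  F by a substitution (\<open>coding_substitution\<close>). The horizontal twist gives the pair (P,
  \<phi>P + Q) (\<open>coding_shear\<close>), a hyperbolic map gives (\<phi>P + Q, \<phi>P +
  \<phi>Q) (\<open>coding_turn\<close>), and the reflection of the L in its diagonal exchanges the
  two vectors (\<open>coding_swap\<close>). Together with their mirror images these pairs are
  exactly the four new sides of the pentagon obtained by reflection in the side (P, Q), as
  \<open>generation_Suc\<close> shows. Starting from the five sides of the base pentagon
  (\<open>base_coding\<close>, \<open>coding_base\<close>), every side of the tiling therefore has a
  coding (\<open>coding_edges\<close>).

  A vertex outside the base pentagon first appears as one of the three new vertices B of such a
  pentagon. Let X and Y be its neighbours there. The points joined to B on the side of Y are the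
  directions of Y + n\<phi>B (\<open>fan_points\<close>, \<open>one_sided_fan_points\<close>). Their
  codings arise from that of (B, Y) by n twists, which prefix to each \<open>F i\<close> the n-th
  power of the word of the row through cell i (\<open>coding_fan\<close>); this is where the powers
  in the theorem come from. The codings E, F of (B, Y) and E', F' of (B, X) can be taken from one
  coding of (P, Q), and then they match (\<open>matched_r1\<close>, \<open>matched_r2\<close>): in
  accordance with X + Y = \<phi>B, the row words factor as
  \<open>E Arm @ E Corner = F Arm @ F' Arm\<close>, \<open>E Top = F Top @ F' Top\<close> and so on.
  The six words of the theorem are the labels of \<open>F i\<close> and \<open>F' i\<close> for the
  three cells i (\<open>matched_conclusion\<close>).

  To pass from words to orbits, closed trajectories with the same itinerary are shown to form one
  strip (\<open>two_strips\<close>), and the words are shown to be primitive: holonomies of even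
  words lie in a lattice over Z[\<open>gold\<close>], in which neither P nor \<phi>P is a proper
  integer multiple (\<open>primitive\<close>).\<close>

section \<open>The golden ratio and the corners of the pentagon\<close>

definition gold :: real where "gold = (sqrt 5 - 1) / 2"

lemma gold_sq: "gold * gold = 1 - gold"
  by (simp add: gold_def field_simps)

lemma gold_sq_mult: "gold * (gold * a) = a - gold * a"
  using gold_sq by (metis mult.assoc left_diff_distrib mult_1)

lemma gold_bounds: "3/5 < gold" "gold < 31/50"
proof -
  have "11 / 5 < sqrt 5" by (rule real_less_rsqrt) (simp add: power2_eq_square)
  moreover have "sqrt 5 < 56 / 25" by (rule real_less_lsqrt) (simp_all add: power2_eq_square)
  ultimately show "3/5 < gold" "gold < 31/50" by (auto simp: gold_def)
qed

lemma gold_pos: "0 < gold" and gold_less_1: "gold < 1"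
  using gold_bounds by auto

text \<open>The double and the triple of 72 degrees add up to a full turn and so have equal cosines.
  The difference of the two multiple-angle polynomials has the root 1; without it, a quadratic with
  one positive root remains.\<close>

lemma two_cos_72: "2 * cos (2 * pi / 5) = gold"
proof -
  define c where "c = cos (2 * pi / 5)"
  have "0 < c" unfolding c_def by (rule cos_gt_zero) (auto)
  have "c \<noteq> 1"
  proof
    assume "c = 1"
    moreover have "cos (2 * pi / 5) < cos 0"
      by (rule cos_monotone_0_pi) auto
    ultimately show False by (simp add: c_def)
  qed
  have "cos (3 * (2 * pi / 5)) = cos (2 * (2 * pi / 5))"
    using cos_2pi_minus[of "2 * (2 * pi / 5)"] by (simp add: field_simps)
  then have "4 * c ^ 3 - 3 * c = 2 * c\<^sup>2 - 1"
    unfolding c_def cos_double_cos cos_treble_cos by simp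
  then have "(c - 1) * (4 * c\<^sup>2 + 2 * c - 1) = 0"
    by (simp add: algebra_simps power2_eq_square power3_eq_cube)
  with \<open>c \<noteq> 1\<close> have "4 * c\<^sup>2 + 2 * c - 1 = 0" by simp
  then have "(4 * c + 1)\<^sup>2 = 5" by (simp add: power2_eq_square algebra_simps)
  with \<open>0 < c\<close> have "4 * c + 1 = sqrt 5" by (simp add: real_sqrt_unique)
  then show ?thesis by (simp add: gold_def c_def)
qed

text \<open>The determinant of two plane vectors. For fixed d, \<open>cross d\<close> is constant
  along lines of direction d and serves as the transversal coordinate of trajectories.\<close>

definition cross :: "complex \<Rightarrow> complex \<Rightarrow> real" where "cross a b = Im (cnj a * b)"

lemma cross_simps:
  "cross (a + b) c = cross a c + cross b c" "cross a (b + c) = cross a b + cross a c"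
  "cross (a - b) c = cross a c - cross b c" "cross a (b - c) = cross a b - cross a c"
  "cross (- a) b = - cross a b" "cross a (- b) = - cross a b"
  "cross (of_real r * a) b = r * cross a b"
  "cross a (of_real r * b) = r * cross a b"
  "cross (a * of_real r) b = r * cross a b"
  "cross a (b * of_real r) = r * cross a b"
  "cross a a = 0" "cross 0 a = 0" "cross a 0 = 0"
  by (simp_all add: cross_def algebra_simps)

lemma cross_swap: "cross a b = - cross b a"
  by (simp add: cross_def algebra_simps)

lemma cross_mult_left: "cmod z = 1 \<Longrightarrow> cross (z * a) (z * b) = cross a b"
proof -
  assume "cmod z = 1"
  then have "cnj z * z = 1" by (metis complex_norm_square mult.commute of_real_1 one_power2)
  moreover have "cnj (z * a) * (z * b) = (cnj z * z) * (cnj a * b)" by simp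
  ultimately show ?thesis by (simp only: cross_def mult_1)
qed

lemma cross_cis: "cross (cis a) (cis b) = sin (b - a)"
  by (simp add: cross_def sin_diff)

lemma sin_144: "sin (4 * pi / 5) = gold * sin (2 * pi / 5)"
  using sin_double[of "2 * pi / 5"] two_cos_72 by (simp add: field_simps)

lemma sin_216: "sin (6 * pi / 5) = - gold * sin (2 * pi / 5)"
  using sin_2pi_minus[of "4 * pi / 5"] sin_144 by (simp add: field_simps)

lemma sin_288: "sin (8 * pi / 5) = - sin (2 * pi / 5)"
  using sin_2pi_minus[of "2 * pi / 5"] by (simp add: field_simps)

lemma sin_72_pos: "0 < sin (2 * pi / 5)"
  by (rule sin_gt_zero) auto

lemma cross_corner: "cross (corner i) (corner j) = sin (2 * pi * (real j - real i) / 5)"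
  by (simp add: corner_def cross_cis algebra_simps diff_divide_distrib)

lemma corner_5: "corner (j + 5) = corner j"
proof -
  have "2 * pi * real (j + 5) / 5 + 13 * pi / 10 = (2 * pi * real j / 5 + 13 * pi / 10) + 2 * pi"
    by (simp add: field_simps)
  then show ?thesis unfolding corner_def by (simp only: cis_mult[symmetric] cis_2pi mult_1_right)
qed

lemma corner_rec: "corner (j + 2) = gold * corner (Suc j) - corner j"
proof -
  define a where "a = 2 * pi * real (Suc j) / 5 + 13 * pi / 10"
  have "cis (a + 2 * pi / 5) + cis (a - 2 * pi / 5) = (2 * cos (2 * pi / 5)) * cis a"
    by (simp add: complex_eq_iff cos_add sin_add cos_diff sin_diff)
  moreover have "corner (j + 2) = cis (a + 2 * pi / 5)" "corner j = cis (a - 2 * pi / 5)"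
    by (simp_all add: corner_def a_def algebra_simps add_divide_distrib)
  moreover have "corner (Suc j) = cis a" by (simp add: corner_def a_def)
  ultimately show ?thesis unfolding two_cos_72 by (metis add_diff_cancel_right')
qed

section \<open>Side sequences in terms of the transversal coordinate\<close>

text \<open>The line of direction d with transversal coordinate x leaves the polygon through side j.
  As the corners run counterclockwise, increasing coordinates from \<open>corner j\<close> to
  \<open>corner (Suc j)\<close> mean that d points outwards across this side.\<close>

definition exits :: "complex \<Rightarrow> sheet \<Rightarrow> real \<Rightarrow> nat \<Rightarrow> bool" where
  "exits d s x j \<longleftrightarrow> j < 5 \<and>
     cross d (sheet_sign s * corner j) < x \<and> x < cross d (sheet_sign s * corner (Suc j))"

text \<open>Adjacent sides contradict each other at their common corner. For sides two apart, the
  recurrence \<open>corner_rec\<close>, used at two consecutive places, forces both 2x <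
  \<open>gold\<close> x and \<open>gold\<close> x < 2x.\<close>

lemma exits_unique:
  assumes "exits d s x i" "exits d s x j"
  shows "i = j"
proof -
  define f where "f k = cross d (sheet_sign s * corner k)" for k
  have per: "f (k + 5) = f k" for k by (simp add: f_def corner_5)
  have rec: "f (k + 2) = gold * f (k + 1) - f k" for k
    by (cases s) (simp_all only: f_def corner_rec Suc_eq_plus1 sheet_sign.simps mult_1 cross_simps
        mult_minus1 mult_1_left)
  have g: "gold * f k < gold * x \<longleftrightarrow> f k < x" "gold * x < gold * f k \<longleftrightarrow> x < f k" for k
    using gold_pos by auto
  have no: False if k: "k = i + 1 \<or> k = i + 2" and "f i < x" "x < f (i + 1)" "f k < x" "x < f (k + 1)" for i k
    using k
  proof
    assume "k = i + 1"
    then show False using that by simp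
  next
    assume k2: "k = i + 2"
    have "f (i + 3) = gold * f (i + 2) - f (i + 1)" using rec[of "i+1"] by (simp add: numeral_eq_Suc)
    then have "2 * x < gold * x"
      using that k2 g[of "i+2"] by (auto simp: numeral_eq_Suc)
    moreover have "gold * x < 2 * x"
      using rec[of i] that k2 g[of "i+1"] by (auto simp: numeral_eq_Suc)
    ultimately show False by simp
  qed
  have ij: "i < 5" "j < 5" "f i < x" "x < f (i + 1)" "f j < x" "x < f (j + 1)"
    using assms by (auto simp: exits_def f_def)
  show ?thesis
  proof (rule ccontr)
    assume "i \<noteq> j"
    with ij consider "j = i + 1 \<or> j = i + 2" | "i = j + 1 \<or> i = j + 2"
      | "j + 5 = i + 1 \<or> j + 5 = i + 2" | "i + 5 = j + 1 \<or> i + 5 = j + 2"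
      by linarith
    then show False
    proof cases
      case 1 then show ?thesis using no ij by blast
    next
      case 2 then show ?thesis using no ij by blast
    next
      case 3
      then show ?thesis using no[of "j+5" i] ij per[of j] per[of "j+1"] by (simp add: add.commute add.left_commute)
    next
      case 4
      then show ?thesis using no[of "i+5" j] ij per[of i] per[of "i+1"] by (simp add: add.commute add.left_commute)
    qed
  qed
qed

text \<open>The holonomy of a word: the displacement in the plane when the polygons are developed
  along a path that starts in sheet s and crosses the sides w.\<close>

fun hol :: "sheet \<Rightarrow> nat list \<Rightarrow> complex" where
  "hol s [] = 0"
| "hol s (j # w) = sheet_sign s * (corner j + corner (Suc j)) + hol (other_sheet s) w"

fun end_sheet :: "sheet \<Rightarrow> nat list \<Rightarrow> sheet" where
  "end_sheet s [] = s"
| "end_sheet s (j # w) = end_sheet (other_sheet s) w"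

fun run :: "complex \<Rightarrow> sheet \<Rightarrow> real \<Rightarrow> nat list \<Rightarrow> bool" where
  "run d s x [] \<longleftrightarrow> True"
| "run d s x (j # w) \<longleftrightarrow> exits d s x j \<and>
     run d (other_sheet s) (x - cross d (sheet_sign s * (corner j + corner (Suc j)))) w"

text \<open>A line that runs into a vertex has no exit there, so this singles out the lines with an
  unlimited future.\<close>

definition alive :: "complex \<Rightarrow> sheet \<Rightarrow> real \<Rightarrow> bool" where
  "alive d s x \<longleftrightarrow> (\<forall>n. \<exists>w. length w = n \<and> run d s x w)"

lemma hol_append: "hol s (v @ w) = hol s v + hol (end_sheet s v) w"
  by (induction v arbitrary: s) auto

lemma end_sheet_append: "end_sheet s (v @ w) = end_sheet (end_sheet s v) w"
  by (induction v arbitrary: s) auto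

lemma run_append:
  "run d s x (v @ w) \<longleftrightarrow> run d s x v \<and> run d (end_sheet s v) (x - cross d (hol s v)) w"
  by (induction v arbitrary: s x) (auto simp: cross_simps diff_diff_add)

lemma run_sides: "run d s x w \<Longrightarrow> set w \<subseteq> {..<5}"
  by (induction w arbitrary: s x) (auto simp: exits_def)

lemma run_deterministic:
  "run d s x v \<Longrightarrow> run d s x w \<Longrightarrow> length v \<le> length w \<Longrightarrow> \<exists>u. w = v @ u"
proof (induction v arbitrary: s x w)
  case (Cons j v)
  then obtain i u where w: "w = i # u" by (cases w) auto
  with Cons.prems have "i = j" using exits_unique by auto
  with Cons w show ?case by auto
qed auto

lemma alive_run:
  assumes "alive d s x" "run d s x v"
  shows "alive d (end_sheet s v) (x - cross d (hol s v))"
  unfolding alive_def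
proof
  fix n
  obtain w where "length w = length v + n" "run d s x w"
    using assms(1) by (auto simp: alive_def)
  moreover from this obtain u where "w = v @ u"
    using run_deterministic[OF assms(2)] by (metis le_add1)
  ultimately show "\<exists>w. length w = n \<and> run d (end_sheet s v) (x - cross d (hol s v)) w"
    by (auto simp: run_append)
qed

lemma alive_exits:
  assumes "alive d s x"
  obtains j where "exits d s x j"
    "alive d (other_sheet s) (x - cross d (sheet_sign s * (corner j + corner (Suc j))))"
proof -
  obtain w where w: "length w = 1" "run d s x w" using assms by (auto simp: alive_def)
  then obtain j where "w = [j]" by (auto simp: length_Suc_conv)
  with w alive_run[OF assms w(2)] show thesis using that[of j] by auto
qed

section \<open>The golden L\<close>

text \<open>The L has the rows \<open>Corner\<close>, \<open>Arm\<close> and \<open>Top\<close>, and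
  the columns \<open>Corner\<close>, \<open>Top\<close> and \<open>Arm\<close>; each row and each
  column closes up. \<open>mirror\<close> is the reflection in the diagonal of the L.\<close>

datatype cell = Corner | Arm | Top

fun wd :: "cell \<Rightarrow> real" where "wd Corner = 1" | "wd Arm = gold" | "wd Top = 1"
fun ht :: "cell \<Rightarrow> real" where "ht Corner = 1" | "ht Arm = 1" | "ht Top = gold"
fun rt :: "cell \<Rightarrow> cell" where "rt Corner = Arm" | "rt Arm = Corner" | "rt Top = Top"
fun up :: "cell \<Rightarrow> cell" where "up Corner = Top" | "up Arm = Arm" | "up Top = Corner"
fun mirror :: "cell \<Rightarrow> cell" where "mirror Corner = Corner" | "mirror Arm = Top" | "mirror Top = Arm"

lemma mirror_simps:
  "wd (mirror i) = ht i" "ht (mirror i) = wd i" "rt (mirror i) = mirror (up i)"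
  "up (mirror i) = mirror (rt i)" "mirror (mirror i) = i"
  by (cases i; simp)+

lemma wd_pos: "0 < wd i" and ht_pos: "0 < ht i"
  using gold_pos by (cases i; simp)+

text \<open>With the lower left corner of the cell as origin, the line of direction (s, t) through
  (x, y) is recorded by \<omega> = tx - sy. Negative values enter through the left edge, positive
  ones through the bottom. The upper right corner has the value \<open>t * wd i - s * ht i\<close>:
  larger values leave through the right edge, smaller ones through the top.\<close>

definition in_cell :: "real \<Rightarrow> real \<Rightarrow> cell \<Rightarrow> real \<Rightarrow> bool" where
  "in_cell s t i \<omega> \<longleftrightarrow> - (s * ht i) < \<omega> \<and> \<omega> < t * wd i"

datatype move = Rt | Up

fun end_cell :: "cell \<Rightarrow> move list \<Rightarrow> cell" where
  "end_cell i [] = i"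
| "end_cell i (Rt # p) = end_cell (rt i) p"
| "end_cell i (Up # p) = end_cell (up i) p"

fun run_x :: "cell \<Rightarrow> move list \<Rightarrow> real" where
  "run_x i [] = 0"
| "run_x i (Rt # p) = wd i + run_x (rt i) p"
| "run_x i (Up # p) = run_x (up i) p"

fun run_y :: "cell \<Rightarrow> move list \<Rightarrow> real" where
  "run_y i [] = 0"
| "run_y i (Rt # p) = run_y (rt i) p"
| "run_y i (Up # p) = ht i + run_y (up i) p"

fun cell_run :: "real \<Rightarrow> real \<Rightarrow> cell \<Rightarrow> real \<Rightarrow> move list \<Rightarrow> bool" where
  "cell_run s t i \<omega> [] \<longleftrightarrow> True"
| "cell_run s t i \<omega> (Rt # p) \<longleftrightarrow> t * wd i - s * ht i < \<omega> \<and> cell_run s t (rt i) (\<omega> - t * wd i) p"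
| "cell_run s t i \<omega> (Up # p) \<longleftrightarrow> \<omega> < t * wd i - s * ht i \<and> cell_run s t (up i) (\<omega> + s * ht i) p"

definition cell_alive :: "real \<Rightarrow> real \<Rightarrow> cell \<Rightarrow> real \<Rightarrow> bool" where
  "cell_alive s t i \<omega> \<longleftrightarrow> (\<forall>n. \<exists>p. length p = n \<and> cell_run s t i \<omega> p)"

lemma cell_alive_cases:
  assumes "cell_alive s t i \<omega>"
  obtains (Rt) "t * wd i - s * ht i < \<omega>" "cell_alive s t (rt i) (\<omega> - t * wd i)"
  | (Up) "\<omega> < t * wd i - s * ht i" "cell_alive s t (up i) (\<omega> + s * ht i)"
proof -
  have ex: "\<exists>p. length p = Suc n \<and> cell_run s t i \<omega> p" for n
    using assms by (auto simp: cell_alive_def)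
  consider "t * wd i - s * ht i < \<omega>" | "\<omega> < t * wd i - s * ht i" | "\<omega> = t * wd i - s * ht i"
    by linarith
  then show thesis
  proof cases
    case 1
    have "\<exists>p. length p = n \<and> cell_run s t (rt i) (\<omega> - t * wd i) p" for n
    proof -
      obtain m p where "length (m # p) = Suc n" "cell_run s t i \<omega> (m # p)"
        using ex[of n] by (metis length_Suc_conv)
      with 1 show ?thesis by (cases m) auto
    qed
    with 1 Rt show ?thesis by (auto simp: cell_alive_def)
  next
    case 2
    have "\<exists>p. length p = n \<and> cell_run s t (up i) (\<omega> + s * ht i) p" for n
    proof -
      obtain m p where "length (m # p) = Suc n" "cell_run s t i \<omega> (m # p)"
        using ex[of n] by (metis length_Suc_conv)
      with 2 show ?thesis by (cases m) auto
    qed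
    with 2 Up show ?thesis by (auto simp: cell_alive_def)
  next
    case 3
    obtain m p where "cell_run s t i \<omega> (m # p)"
      using ex[of 0] by (metis length_Suc_conv)
    with 3 show ?thesis by (cases m) auto
  qed
qed

fun path_word :: "(cell \<Rightarrow> nat list) \<Rightarrow> (cell \<Rightarrow> nat list) \<Rightarrow> cell \<Rightarrow> move list \<Rightarrow> nat list" where
  "path_word E F i [] = []"
| "path_word E F i (Rt # p) = E i @ path_word E F (rt i) p"
| "path_word E F i (Up # p) = F i @ path_word E F (up i) p"

section \<open>The ring Z[gold] and its lattices\<close>

definition zgold :: "real set" where
  "zgold = {of_int a + of_int b * gold | a b. True}"

lemma zgold_int: "of_int a \<in> zgold" "0 \<in> zgold" "1 \<in> zgold" "gold \<in> zgold"
proof -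
  show "of_int a \<in> zgold" for a by (force simp: zgold_def intro: exI[of _ 0])
  from this[of 0] this[of 1] show "0 \<in> zgold" "1 \<in> zgold" by simp_all
  show "gold \<in> zgold" unfolding zgold_def by (intro CollectI exI[of _ 0] exI[of _ 1]) simp
qed

lemma zgold_add: "a \<in> zgold \<Longrightarrow> b \<in> zgold \<Longrightarrow> a + b \<in> zgold"
  unfolding zgold_def
  apply clarsimp
  subgoal for a c b d by (rule exI[of _ "a + c"], rule exI[of _ "b + d"]) (simp add: algebra_simps)
  done

lemma zgold_minus: "a \<in> zgold \<Longrightarrow> - a \<in> zgold"
  unfolding zgold_def
  apply clarsimp
  subgoal for a b by (rule exI[of _ "- a"], rule exI[of _ "- b"]) (simp add: algebra_simps)
  done

lemma zgold_mult: "a \<in> zgold \<Longrightarrow> b \<in> zgold \<Longrightarrow> a * b \<in> zgold"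
  unfolding zgold_def
  apply clarsimp
  subgoal for a c b d
    by (rule exI[of _ "a * c + b * d"], rule exI[of _ "a * d + b * c - b * d"])
       (simp add: algebra_simps gold_sq gold_sq_mult)
  done

definition lattice :: "complex \<Rightarrow> complex \<Rightarrow> complex set" where
  "lattice P Q = {of_real a * P + of_real b * Q | a b. a \<in> zgold \<and> b \<in> zgold}"

lemma latticeI: "a \<in> zgold \<Longrightarrow> b \<in> zgold \<Longrightarrow> z = of_real a * P + of_real b * Q \<Longrightarrow> z \<in> lattice P Q"
  by (auto simp: lattice_def)

lemma lattice_add: "y \<in> lattice P Q \<Longrightarrow> z \<in> lattice P Q \<Longrightarrow> y + z \<in> lattice P Q"
  unfolding lattice_def
  apply clarsimp
  subgoal for a c b d
    by (rule exI[of _ "a + c"], rule exI[of _ "b + d"]) (simp add: algebra_simps zgold_add)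
  done

lemma lattice_scale: "r \<in> zgold \<Longrightarrow> z \<in> lattice P Q \<Longrightarrow> of_real r * z \<in> lattice P Q"
  unfolding lattice_def
  apply clarsimp
  subgoal for a b
    by (rule exI[of _ "r * a"], rule exI[of _ "r * b"]) (simp add: algebra_simps zgold_mult)
  done

lemma lattice_minus: "z \<in> lattice P Q \<Longrightarrow> - z \<in> lattice P Q"
  using lattice_scale[of "-1" z] zgold_minus[OF zgold_int(3)] by simp

lemma lattice_swap: "lattice Q P = lattice P Q"
  by (auto simp: lattice_def) (metis add.commute)+

lemma lattice_subset:
  assumes "P \<in> lattice P' Q'" "Q \<in> lattice P' Q'"
  shows "lattice P Q \<subseteq> lattice P' Q'"
  using assms by (auto simp: lattice_def[of P Q] intro!: lattice_add lattice_scale)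

section \<open>Codings and their behaviour under affine maps\<close>

text \<open>The double pentagon seen as the L with unit vectors P and Q. The lower left corner of
  cell i is the point \<open>k i\<close>, seen from sheet \<open>\<sigma> i\<close>; the line
  \<omega> of that cell has transversal coordinate
  \<open>cross d (k i) - cross P Q * \<omega>\<close> on the pentagon. Allowing s or t to vanish
  includes the directions P and Q themselves. \<open>singular\<close> says that the upper right
  corner of a cell leads to a vertex, \<open>entry\<close> that every surviving line gets into some
  cell, and \<open>hol_lattice\<close> will make the words of the strips primitive.\<close>

locale coding =
  fixes P Q :: complex and \<sigma> :: "cell \<Rightarrow> sheet" and k :: "cell \<Rightarrow> complex"
    and E F :: "cell \<Rightarrow> nat list"
  assumes independent: "cross P Q \<noteq> 0"
    and hol_lattice: "\<And>s w. set w \<subseteq> {..<5} \<Longrightarrow> even (length w) \<Longrightarrow> hol s w \<in> lattice P Q"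
    and sheet_E: "\<And>i. end_sheet (\<sigma> i) (E i) = \<sigma> (rt i)"
    and sheet_F: "\<And>i. end_sheet (\<sigma> i) (F i) = \<sigma> (up i)"
    and hol_E: "\<And>i. hol (\<sigma> i) (E i) = of_real (wd i) * P + k i - k (rt i)"
    and hol_F: "\<And>i. hol (\<sigma> i) (F i) = of_real (ht i) * Q + k i - k (up i)"
    and run_E: "\<And>s t i \<omega> d. 0 \<le> s \<Longrightarrow> 0 \<le> t \<Longrightarrow> d = of_real s * P + of_real t * Q \<Longrightarrow>
      in_cell s t i \<omega> \<Longrightarrow> t * wd i - s * ht i < \<omega> \<Longrightarrow>
      run d (\<sigma> i) (cross d (k i) - cross P Q * \<omega>) (E i)"
    and run_F: "\<And>s t i \<omega> d. 0 \<le> s \<Longrightarrow> 0 \<le> t \<Longrightarrow> d = of_real s * P + of_real t * Q \<Longrightarrow>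
      in_cell s t i \<omega> \<Longrightarrow> \<omega> < t * wd i - s * ht i \<Longrightarrow>
      run d (\<sigma> i) (cross d (k i) - cross P Q * \<omega>) (F i)"
    and singular: "\<And>s t i \<omega> d. 0 \<le> s \<Longrightarrow> 0 \<le> t \<Longrightarrow> d = of_real s * P + of_real t * Q \<Longrightarrow>
      in_cell s t i \<omega> \<Longrightarrow> \<omega> = t * wd i - s * ht i \<Longrightarrow>
      \<not> alive d (\<sigma> i) (cross d (k i) - cross P Q * \<omega>)"
    and entry: "\<And>s t d sh y. 0 \<le> s \<Longrightarrow> 0 \<le> t \<Longrightarrow> d = of_real s * P + of_real t * Q \<Longrightarrow>
      alive d sh y \<Longrightarrow>
      \<exists>w i \<omega>. in_cell s t i \<omega> \<and> run d sh y w \<and> end_sheet sh w = \<sigma> i \<and>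
        y - cross d (hol sh w) = cross d (k i) - cross P Q * \<omega>"
begin

lemma path_sheet: "end_sheet (\<sigma> i) (path_word E F i p) = \<sigma> (end_cell i p)"
  by (induction i p rule: end_cell.induct) (auto simp: end_sheet_append sheet_E sheet_F)

lemma path_hol: "hol (\<sigma> i) (path_word E F i p) =
    of_real (run_x i p) * P + of_real (run_y i p) * Q + k i - k (end_cell i p)"
  by (induction i p rule: end_cell.induct)
     (auto simp: hol_append sheet_E sheet_F hol_E hol_F algebra_simps)

lemma path_offset:
  assumes "d = of_real s * P + of_real t * Q"
  shows "cross d (k i) - cross P Q * \<omega> - cross d (hol (\<sigma> i) (path_word E F i p)) =
    cross d (k (end_cell i p)) - cross P Q * (\<omega> + s * run_y i p - t * run_x i p)"
  unfolding path_hol assms using cross_swap[of Q P] by (simp add: cross_simps algebra_simps)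

lemma path_step_E:
  assumes "d = of_real s * P + of_real t * Q"
  shows "cross d (k i) - cross P Q * \<omega> - cross d (hol (\<sigma> i) (E i)) =
    cross d (k (rt i)) - cross P Q * (\<omega> - t * wd i)"
  using path_offset[OF assms, of i \<omega> "[Rt]"] by simp

lemma path_step_F:
  assumes "d = of_real s * P + of_real t * Q"
  shows "cross d (k i) - cross P Q * \<omega> - cross d (hol (\<sigma> i) (F i)) =
    cross d (k (up i)) - cross P Q * (\<omega> + s * ht i)"
  using path_offset[OF assms, of i \<omega> "[Up]"] by simp

lemma in_cell_rt:
  assumes "0 \<le> t" "in_cell s t i \<omega>" "t * wd i - s * ht i < \<omega>"
  shows "in_cell s t (rt i) (\<omega> - t * wd i)"
proof -
  have "ht (rt i) = ht i" by (cases i) auto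
  moreover have "0 \<le> t * wd (rt i)" using assms(1) wd_pos[of "rt i"] by simp
  ultimately show ?thesis using assms by (auto simp: in_cell_def)
qed

lemma in_cell_up:
  assumes "0 \<le> s" "in_cell s t i \<omega>" "\<omega> < t * wd i - s * ht i"
  shows "in_cell s t (up i) (\<omega> + s * ht i)"
proof -
  have "wd (up i) = wd i" by (cases i) auto
  moreover have "0 \<le> s * ht (up i)" using assms(1) ht_pos[of "up i"] by simp
  ultimately show ?thesis using assms by (auto simp: in_cell_def)
qed

lemma run_path:
  assumes "0 \<le> s" "0 \<le> t" "d = of_real s * P + of_real t * Q"
  shows "in_cell s t i \<omega> \<Longrightarrow> cell_run s t i \<omega> p \<Longrightarrow>
    run d (\<sigma> i) (cross d (k i) - cross P Q * \<omega>) (path_word E F i p)"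
proof (induction i p arbitrary: \<omega> rule: end_cell.induct)
  case (2 i p)
  then show ?case using in_cell_rt[OF assms(2)] run_E[OF assms]
    by (simp add: run_append sheet_E path_step_E[OF assms(3)])
next
  case (3 i p)
  then show ?case using in_cell_up[OF assms(1)] run_F[OF assms]
    by (simp add: run_append sheet_F path_step_F[OF assms(3)])
qed simp

text \<open>Each move is dictated by the comparison with the upper right corner, and
  \<open>singular\<close> rules out equality.\<close>

lemma alive_imp_cell_alive:
  assumes st: "0 \<le> s" "0 \<le> t" "d = of_real s * P + of_real t * Q"
    and "in_cell s t i \<omega>" "alive d (\<sigma> i) (cross d (k i) - cross P Q * \<omega>)"
  shows "cell_alive s t i \<omega>"
  unfolding cell_alive_def
proof
  fix n
  show "\<exists>p. length p = n \<and> cell_run s t i \<omega> p"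
    using assms(4,5)
  proof (induction n arbitrary: i \<omega>)
    case (Suc n)
    consider "t * wd i - s * ht i < \<omega>" | "\<omega> < t * wd i - s * ht i"
      using singular[OF st Suc.prems(1)] Suc.prems(2) by fastforce
    then show ?case
    proof cases
      case 1
      have "alive d (\<sigma> (rt i)) (cross d (k (rt i)) - cross P Q * (\<omega> - t * wd i))"
        using alive_run[OF Suc.prems(2) run_E[OF st Suc.prems(1) 1]]
        by (simp add: sheet_E path_step_E[OF st(3)])
      from Suc.IH[OF in_cell_rt[OF st(2) Suc.prems(1) 1] this] obtain p
        where "length p = n" "cell_run s t (rt i) (\<omega> - t * wd i) p" by blast
      with 1 show ?thesis by (intro exI[of _ "Rt # p"]) simp
    next
      case 2
      have "alive d (\<sigma> (up i)) (cross d (k (up i)) - cross P Q * (\<omega> + s * ht i))"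
        using alive_run[OF Suc.prems(2) run_F[OF st Suc.prems(1) 2]]
        by (simp add: sheet_F path_step_F[OF st(3)])
      from Suc.IH[OF in_cell_up[OF st(1) Suc.prems(1) 2] this] obtain p
        where "length p = n" "cell_run s t (up i) (\<omega> + s * ht i) p" by blast
      with 2 show ?thesis by (intro exI[of _ "Up # p"]) simp
    qed
  qed simp
qed

text \<open>An affine automorphism of the L with matrix of determinant 1 over
  Z[\<open>gold\<close>]. Cell i of the new L is placed at the cell \<open>\<rho> i\<close> of the
  old one, and leaving it to the right or upwards corresponds to the path \<open>U i\<close> or
  \<open>V i\<close> of old cells; the new words are concatenations of old ones along these paths.
  All geometric assumptions concern the L alone: (s, t) are the coordinates of the direction in the
  new basis, (S, T) those in the old one.\<close>

lemma coding_substitution: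
  fixes a b c e :: real and \<rho> :: "cell \<Rightarrow> cell" and U V :: "cell \<Rightarrow> move list"
  defines "S \<equiv> \<lambda>s t. s * a + t * c" and "T \<equiv> \<lambda>s t. s * b + t * e"
  assumes nonneg: "0 \<le> a" "0 \<le> b" "0 \<le> c" "0 \<le> e"
    and zgold: "a \<in> zgold" "b \<in> zgold" "c \<in> zgold" "e \<in> zgold"
    and det: "a * e - b * c = 1"
    and U: "\<And>i. end_cell (\<rho> i) (U i) = \<rho> (rt i)" "\<And>i. run_x (\<rho> i) (U i) = wd i * a"
      "\<And>i. run_y (\<rho> i) (U i) = wd i * b"
    and V: "\<And>i. end_cell (\<rho> i) (V i) = \<rho> (up i)" "\<And>i. run_x (\<rho> i) (V i) = ht i * c"
      "\<And>i. run_y (\<rho> i) (V i) = ht i * e"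
    and cell: "\<And>s t i \<omega>. 0 \<le> s \<Longrightarrow> 0 \<le> t \<Longrightarrow> in_cell s t i \<omega> \<Longrightarrow> in_cell (S s t) (T s t) (\<rho> i) \<omega>"
    and cell_U: "\<And>s t i \<omega>. 0 \<le> s \<Longrightarrow> 0 \<le> t \<Longrightarrow> in_cell s t i \<omega> \<Longrightarrow> t * wd i - s * ht i < \<omega> \<Longrightarrow>
      cell_run (S s t) (T s t) (\<rho> i) \<omega> (U i)"
    and cell_V: "\<And>s t i \<omega>. 0 \<le> s \<Longrightarrow> 0 \<le> t \<Longrightarrow> in_cell s t i \<omega> \<Longrightarrow> \<omega> < t * wd i - s * ht i \<Longrightarrow>
      cell_run (S s t) (T s t) (\<rho> i) \<omega> (V i)"
    and cell_singular: "\<And>s t i \<omega>. 0 \<le> s \<Longrightarrow> 0 \<le> t \<Longrightarrow> in_cell s t i \<omega> \<Longrightarrow>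
      \<omega> = t * wd i - s * ht i \<Longrightarrow> \<not> cell_alive (S s t) (T s t) (\<rho> i) \<omega>"
    and cell_entry: "\<And>s t i \<omega>. 0 \<le> s \<Longrightarrow> 0 \<le> t \<Longrightarrow> in_cell (S s t) (T s t) i \<omega> \<Longrightarrow>
      cell_alive (S s t) (T s t) i \<omega> \<Longrightarrow>
      \<exists>p j. cell_run (S s t) (T s t) i \<omega> p \<and> end_cell i p = \<rho> j \<and>
        in_cell s t j (\<omega> + S s t * run_y i p - T s t * run_x i p)"
  shows "coding (of_real a * P + of_real b * Q)
    (of_real c * P + of_real e * Q) (\<lambda>i. \<sigma> (\<rho> i)) (\<lambda>i. k (\<rho> i))
    (\<lambda>i. path_word E F (\<rho> i) (U i)) (\<lambda>i. path_word E F (\<rho> i) (V i))"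
    (is "coding ?P ?Q _ _ _ _")
proof -
  have cross: "cross ?P ?Q = cross P Q"
  proof -
    have "cross ?P ?Q = (a * e - b * c) * cross P Q"
      using cross_swap[of Q P] by (simp add: cross_simps algebra_simps)
    then show ?thesis by (simp add: det)
  qed
  have d: "of_real s * ?P + of_real t * ?Q =
      of_real (S s t) * P + of_real (T s t) * Q" for s t
    by (simp add: S_def T_def algebra_simps)
  have ST: "0 \<le> S s t" "0 \<le> T s t" if "0 \<le> s" "0 \<le> t" for s t
    using that nonneg by (simp_all add: S_def T_def)
  have det': "complex_of_real a * e - complex_of_real b * c = 1"
    by (metis det of_real_1 of_real_diff of_real_mult)
  \<comment> \<open>As the determinant is 1, the inverse matrix has entries in the same ring, and
    the new lattice contains the old one.\<close>
  have "P = of_real e * ?P + of_real (- b) * ?Q"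
  proof -
    have "of_real e * ?P + of_real (- b) * ?Q =
      (of_real a * e - of_real b * c) * P" by (simp add: algebra_simps)
    then show ?thesis by (simp add: det')
  qed
  then have P: "P \<in> lattice ?P ?Q" using latticeI zgold zgold_minus by blast
  have "Q = of_real (- c) * ?P + of_real a * ?Q"
  proof -
    have "of_real (- c) * ?P + of_real a * ?Q =
      (of_real a * e - of_real b * c) * Q" by (simp add: algebra_simps)
    then show ?thesis by (simp add: det')
  qed
  then have Q: "Q \<in> lattice ?P ?Q" using latticeI zgold zgold_minus by blast
  show ?thesis
  proof (unfold_locales, goal_cases)
    case 1
    then show ?case using cross independent by simp
  next
    case (2 s w)
    then show ?case using hol_lattice lattice_subset[OF P Q] by blast
  next
    case (3 i)
    then show ?case by (simp add: path_sheet U)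
  next
    case (4 i)
    then show ?case by (simp add: path_sheet V)
  next
    case (5 i)
    then show ?case by (simp add: path_hol U algebra_simps)
  next
    case (6 i)
    then show ?case by (simp add: path_hol V algebra_simps)
  next
    case (7 s t i \<omega> d)
    then show ?case unfolding cross using run_path[OF ST] d cell cell_U by simp
  next
    case (8 s t i \<omega> d)
    then show ?case unfolding cross using run_path[OF ST] d cell cell_V by simp
  next
    case (9 s t i \<omega> d)
    then show ?case unfolding cross using alive_imp_cell_alive[OF ST] d cell cell_singular by metis
  next
    case (10 s t de sh y)
    note st = ST[OF 10(1,2)]
    have de: "de = of_real (S s t) * P + of_real (T s t) * Q" using 10(3) d by simp
    obtain w i \<omega> where w: "in_cell (S s t) (T s t) i \<omega>" "run de sh y w" "end_sheet sh w = \<sigma> i"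
      "y - cross de (hol sh w) = cross de (k i) - cross P Q * \<omega>"
      using entry[OF st de 10(4)] by blast
    have "cell_alive (S s t) (T s t) i \<omega>"
      using alive_imp_cell_alive[OF st de w(1)] alive_run[OF 10(4) w(2)] w(3,4) by simp
    from cell_entry[OF 10(1,2) w(1) this] obtain p j
      where p: "cell_run (S s t) (T s t) i \<omega> p" "end_cell i p = \<rho> j"
        "in_cell s t j (\<omega> + S s t * run_y i p - T s t * run_x i p)" by blast
    let ?v = "path_word E F i p"
    have "run de sh y (w @ ?v)"
      using w run_path[OF st de w(1) p(1)] by (simp add: run_append)
    moreover have "end_sheet sh (w @ ?v) = \<sigma> (\<rho> j)"
      using w(3) p(2) by (simp add: end_sheet_append path_sheet)
    moreover have "y - cross de (hol sh (w @ ?v)) =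
      cross de (k (\<rho> j)) - cross P Q * (\<omega> + S s t * run_y i p - T s t * run_x i p)"
      using path_offset[OF de, of i \<omega> p] w(3,4) p(2)
      by (simp add: hol_append cross_simps algebra_simps)
    ultimately show ?case unfolding cross using p(3) by blast
  qed
qed

text \<open>The reflection in the diagonal exchanges rows and columns. Both \<omega> and
  \<open>cross P Q\<close> change sign, so the coordinate on the pentagon stays the same.\<close>

lemma coding_swap:
  "coding Q P (\<lambda>i. \<sigma> (mirror i)) (\<lambda>i. k (mirror i)) (\<lambda>i. F (mirror i)) (\<lambda>i. E (mirror i))"
proof (unfold_locales, goal_cases)
  case 1
  then show ?case using independent cross_swap[of P Q] by simp
next
  case (2 s w)
  then show ?case using hol_lattice lattice_swap by blast
next
  case (7 s t i \<omega> d)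
  have "run d (\<sigma> (mirror i)) (cross d (k (mirror i)) - cross P Q * (- \<omega>)) (F (mirror i))"
    by (rule run_F[of t s]) (use 7 in \<open>auto simp: in_cell_def mirror_simps\<close>)
  then show ?case using cross_swap[of P Q] by simp
next
  case (8 s t i \<omega> d)
  have "run d (\<sigma> (mirror i)) (cross d (k (mirror i)) - cross P Q * (- \<omega>)) (E (mirror i))"
    by (rule run_E[of t s]) (use 8 in \<open>auto simp: in_cell_def mirror_simps\<close>)
  then show ?case using cross_swap[of P Q] by simp
next
  case (9 s t i \<omega> d)
  have "\<not> alive d (\<sigma> (mirror i)) (cross d (k (mirror i)) - cross P Q * (- \<omega>))"
    by (rule singular[of t s]) (use 9 in \<open>auto simp: in_cell_def mirror_simps\<close>)
  then show ?case using cross_swap[of P Q] by simp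
next
  case (10 s t d sh y)
  then obtain w i \<omega> where w: "in_cell t s i \<omega>" "run d sh y w" "end_sheet sh w = \<sigma> i"
    "y - cross d (hol sh w) = cross d (k i) - cross P Q * \<omega>"
    using entry[of t s d sh y] by (auto simp: add.commute)
  then show ?case
    by (intro exI[of _ w] exI[of _ "mirror i"] exI[of _ "- \<omega>"])
       (use cross_swap[of P Q] in \<open>auto simp: in_cell_def mirror_simps\<close>)
qed (auto simp: sheet_E sheet_F hol_E hol_F mirror_simps)

end

text \<open>A rotation z that carries side j of each polygon to side \<open>r j\<close> of the other
  is an automorphism of the surface. It transports the coding: vectors are rotated, sheets
  exchanged, sides renamed.\<close>

lemma coding_symmetry:
  assumes "coding P Q \<sigma> k E F" and z: "cmod z = 1" and r: "bij_betw r {..<5} {..<5}"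
    and zr: "\<And>j. j < 5 \<Longrightarrow> z * corner j = - corner (r j) \<and> z * corner (Suc j) = - corner (Suc (r j))"
  shows "coding (z * P) (z * Q) (\<lambda>i. other_sheet (\<sigma> i)) (\<lambda>i. z * k i)
    (\<lambda>i. map r (E i)) (\<lambda>i. map r (F i))"
proof -
  interpret coding P Q \<sigma> k E F by fact
  note cz = cross_mult_left[OF z]
  define r' where "r' = inv_into {..<5} r"
  have r': "j < 5 \<Longrightarrow> r' j < 5 \<and> r (r' j) = j" for j
    unfolding r'_def using r by (metis bij_betw_def f_inv_into_f inv_into_into lessThan_iff)
  have rl: "j < 5 \<Longrightarrow> r j < 5" for j using r by (auto simp: bij_betw_def)
  have ss: "sheet_sign (other_sheet s) = - sheet_sign s" "other_sheet (other_sheet s) = s" for s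
    by (cases s; simp)+
  have c: "sheet_sign (other_sheet s) * corner (r j) = z * (sheet_sign s * corner j)"
    "sheet_sign (other_sheet s) * corner (Suc (r j)) = z * (sheet_sign s * corner (Suc j))"
    if "j < 5" for s j
    using zr[OF that] by (cases s; simp add: ss(1))+
  have exits: "exits (z * d) (other_sheet s) x (r j) \<longleftrightarrow> exits d s x j" if "j < 5" for d s x j
    unfolding exits_def c[OF that] cz using that rl by simp
  have es: "end_sheet (other_sheet s) (map r w) = other_sheet (end_sheet s w)" for s w
    by (induction w arbitrary: s) auto
  have hol: "hol (other_sheet s) (map r w) = z * hol s w" if "set w \<subseteq> {..<5}" for s w
    using that
  proof (induction w arbitrary: s)
    case (Cons j w)
    then show ?case using c[of j s] by (auto simp: distrib_left)
  qed simp
  have run: "run (z * d) (other_sheet s) x (map r w) \<longleftrightarrow> run d s x w" if "set w \<subseteq> {..<5}" for d s x w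
    using that
  proof (induction w arbitrary: s x)
    case (Cons j w)
    then have j: "j < 5" by auto
    show ?case using Cons c[OF j, of s] exits[OF j] cz by (auto simp: distrib_left cross_simps)
  qed simp
  have unmap: "\<exists>v. w = map r v \<and> set v \<subseteq> {..<5}" if "set w \<subseteq> {..<5}" for w
    by (rule exI[of _ "map r' w"]) (use that r' in \<open>auto intro!: map_idI[symmetric] simp: subset_iff\<close>)
  have alive: "alive d s x" if zd: "alive (z * d) (other_sheet s) x" for d s x
    unfolding alive_def
  proof
    fix n
    obtain w where w: "length w = n" "run (z * d) (other_sheet s) x w"
      using zd unfolding alive_def by blast
    with unmap[OF run_sides] obtain v where "w = map r v" "set v \<subseteq> {..<5}" by blast
    with w run show "\<exists>w. length w = n \<and> run d s x w" by auto
  qed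
  have d: "d = of_real s * (z * P) + of_real t * (z * Q) \<longleftrightarrow>
     d = z * (of_real s * P + of_real t * Q)" for d s t
    by (simp add: algebra_simps)
  \<comment> \<open>The line at half height of the cell, in direction P, spells \<open>E i\<close>,
    so its letters are side numbers.\<close>
  have "set (E i) \<subseteq> {..<5}" for i
  proof -
    have "run (of_real 1 * P + of_real 0 * Q) (\<sigma> i)
       (cross (of_real 1 * P + of_real 0 * Q) (k i) - cross P Q * (- ht i / 2)) (E i)"
      by (rule run_E[of 1 0]) (use ht_pos[of i] in \<open>auto simp: in_cell_def\<close>)
    then show ?thesis by (rule run_sides)
  qed
  note hE = hol[OF this]
  have "set (F i) \<subseteq> {..<5}" for i
  proof -
    have "run (of_real 0 * P + of_real 1 * Q) (\<sigma> i)
       (cross (of_real 0 * P + of_real 1 * Q) (k i) - cross P Q * (wd i / 2)) (F i)"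
      by (rule run_F[of 0 1]) (use wd_pos[of i] in \<open>auto simp: in_cell_def\<close>)
    then show ?thesis by (rule run_sides)
  qed
  note hF = hol[OF this]
  show ?thesis
  proof (unfold_locales, goal_cases)
    case 1
    then show ?case using independent by (simp add: cz)
  next
    case (2 s w)
    obtain v where v: "w = map r v" "set v \<subseteq> {..<5}" using unmap 2 by blast
    have "hol (other_sheet (other_sheet s)) w = z * hol (other_sheet s) v"
      unfolding v(1) by (rule hol) fact
    moreover have "hol (other_sheet s) v \<in> lattice P Q"
      using hol_lattice v 2 by simp
    ultimately obtain a b where "a \<in> zgold" "b \<in> zgold"
      "hol s w = z * (of_real a * P + of_real b * Q)"
      by (auto simp: ss lattice_def)
    then show ?case by (intro latticeI[of a b]) (simp_all add: algebra_simps)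
  next
    case (7 s t i \<omega> d)
    then show ?case unfolding d cz using run_E[of s t _ i \<omega>]
      by (simp add: cz run run_sides)
  next
    case (8 s t i \<omega> d)
    then show ?case unfolding d cz using run_F[of s t _ i \<omega>]
      by (simp add: cz run run_sides)
  next
    case (9 s t i \<omega> d)
    then show ?case unfolding d cz using singular[of s t _ i \<omega>] alive
      by (auto simp: cz)
  next
    case (10 s t d sh y)
    define d0 where "d0 = of_real s * P + of_real t * Q"
    have dd: "d = z * d0" using 10 d by (simp add: d0_def)
    have "alive d0 (other_sheet sh) y" using alive[of d0 "other_sheet sh" y] 10 dd by (simp add: ss)
    from entry[OF 10(1,2) d0_def this] obtain w i \<omega>
      where w: "in_cell s t i \<omega>" "run d0 (other_sheet sh) y w" "end_sheet (other_sheet sh) w = \<sigma> i"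
      "y - cross d0 (hol (other_sheet sh) w) = cross d0 (k i) - cross P Q * \<omega>" by blast
    note ws = run_sides[OF w(2)]
    show ?case
      by (rule exI[of _ "map r w"], rule exI[of _ i], rule exI[of _ \<omega>])
         (use w hol[OF ws, of "other_sheet sh"] run[OF ws, of d0 "other_sheet sh" y]
           es[of "other_sheet sh" w] in \<open>auto simp: dd cz ss\<close>)
  qed (auto simp: es sheet_E sheet_F hE hF hol_E hol_F algebra_simps)
qed

section \<open>The twist and the turn of the golden L\<close>

text \<open>The line reaches, after finitely many moves in the old L, a cell \<open>\<rho> j\<close>
  where it lies in the range of the new cell j. This is what \<open>coding_substitution\<close> asks
  for in its last assumption.\<close>

definition hit where
  "hit s t S T \<rho> i \<omega> \<longleftrightarrow> (\<exists>p j. cell_run S T i \<omega> p \<and> end_cell i p = \<rho> j \<and>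
     in_cell s t j (\<omega> + S * run_y i p - T * run_x i p))"

lemma hit_now: "in_cell s t j \<omega> \<Longrightarrow> hit s t S T \<rho> (\<rho> j) \<omega>"
  unfolding hit_def by (rule exI[of _ "[]"]) auto

lemma hit_Rt:
  assumes "T * wd i - S * ht i < \<omega>" "hit s t S T \<rho> (rt i) (\<omega> - T * wd i)"
  shows "hit s t S T \<rho> i \<omega>"
proof -
  from assms obtain p j where "cell_run S T (rt i) (\<omega> - T * wd i) p" "end_cell (rt i) p = \<rho> j"
    "in_cell s t j (\<omega> - T * wd i + S * run_y (rt i) p - T * run_x (rt i) p)"
    by (auto simp: hit_def)
  with assms(1) show ?thesis unfolding hit_def
    by (intro exI[of _ "Rt # p"] exI[of _ j]) (simp add: algebra_simps)
qed

lemma hit_Up: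
  assumes "\<omega> < T * wd i - S * ht i" "hit s t S T \<rho> (up i) (\<omega> + S * ht i)"
  shows "hit s t S T \<rho> i \<omega>"
proof -
  from assms obtain p j where "cell_run S T (up i) (\<omega> + S * ht i) p" "end_cell (up i) p = \<rho> j"
    "in_cell s t j (\<omega> + S * ht i + S * run_y (up i) p - T * run_x (up i) p)"
    by (auto simp: hit_def)
  with assms(1) show ?thesis unfolding hit_def
    by (intro exI[of _ "Up # p"] exI[of _ j]) (simp add: algebra_simps)
qed

text \<open>The product of a with \<open>gold\<close> becomes a variable of its own, tied to a by
  linear inequalities, and multiplying it by \<open>gold\<close> again gives \<open>a - b\<close>.
  In this way the conditions on cells turn into linear arithmetic.\<close>

lemma gold_atom:
  assumes "0 \<le> (a::real)"
  obtains b where "gold * a = b" "gold * b = a - b" "3 * a \<le> 5 * b" "50 * b \<le> 31 * a"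
proof (rule that[of "gold * a"])
  have "3/5 * a \<le> gold * a" "gold * a \<le> 31/50 * a"
    by (rule mult_right_mono; use assms gold_bounds in simp)+
  then show "3 * a \<le> 5 * (gold * a)" "50 * (gold * a) \<le> 31 * a" by simp_all
qed (simp_all add: gold_sq_mult)

text \<open>The horizontal Dehn twist. Both rows of the L have width divided by height equal to 1 +
  \<open>gold\<close>, so the shear by this factor turns each row once around: the upward path first
  runs around the row of its cell.\<close>

fun shear_E :: "cell \<Rightarrow> move list" where "shear_E i = [Rt]"
fun shear_F :: "cell \<Rightarrow> move list" where
  "shear_F Corner = [Rt, Rt, Up]" | "shear_F Arm = [Rt, Rt, Up]" | "shear_F Top = [Rt, Up]"

text \<open>The old cells permuted cyclically, and the paths whose displacements are \<phi>P + Q and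
  \<phi>P + \<phi>Q, scaled by the width or the height of the new cell.\<close>

fun turn :: "cell \<Rightarrow> cell" where "turn Corner = Arm" | "turn Arm = Top" | "turn Top = Corner"
fun turn_E :: "cell \<Rightarrow> move list" where
  "turn_E Corner = [Rt, Up, Rt]" | "turn_E Arm = [Up, Rt]" | "turn_E Top = [Rt, Up, Rt]"
fun turn_F :: "cell \<Rightarrow> move list" where
  "turn_F Corner = [Rt, Up, Rt, Up]" | "turn_F Arm = [Up, Rt, Rt, Up]" | "turn_F Top = [Rt, Up]"

fun turn_back :: "cell \<Rightarrow> cell" where
  "turn_back Arm = Corner" | "turn_back Top = Arm" | "turn_back Corner = Top"

text \<open>A search of depth n for a \<open>hit\<close>, with \<tau> as the inverse of \<rho>, in a
  form that unfolds to linear inequalities. On a tie both implications are vacuous, which is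
  harmless since a surviving line never meets a tie.\<close>

fun hits :: "(cell \<Rightarrow> cell) \<Rightarrow> real \<Rightarrow> real \<Rightarrow> real \<Rightarrow> real \<Rightarrow> nat \<Rightarrow> cell \<Rightarrow> real \<Rightarrow> bool" where
  "hits \<tau> s t S T 0 i \<omega> \<longleftrightarrow> in_cell s t (\<tau> i) \<omega>"
| "hits \<tau> s t S T (Suc n) i \<omega> \<longleftrightarrow> in_cell s t (\<tau> i) \<omega> \<or>
     (T * wd i - S * ht i < \<omega> \<longrightarrow> hits \<tau> s t S T n (rt i) (\<omega> - T * wd i)) \<and>
     (\<omega> < T * wd i - S * ht i \<longrightarrow> hits \<tau> s t S T n (up i) (\<omega> + S * ht i))"

lemma hits_imp_hit:
  assumes "\<And>i. \<rho> (\<tau> i) = i"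
  shows "cell_alive S T i \<omega> \<Longrightarrow> hits \<tau> s t S T n i \<omega> \<Longrightarrow> hit s t S T \<rho> i \<omega>"
proof (induction n arbitrary: i \<omega>)
  case 0
  then show ?case using hit_now[of s t "\<tau> i" \<omega> S T \<rho>] assms by simp
next
  case (Suc n)
  show ?case
  proof (cases "in_cell s t (\<tau> i) \<omega>")
    case True
    then show ?thesis using hit_now[of s t "\<tau> i" \<omega> S T \<rho>] assms by simp
  next
    case False
    from Suc.prems(1) show ?thesis
    proof (cases rule: cell_alive_cases)
      case Rt
      moreover from this have "hits \<tau> s t S T n (rt i) (\<omega> - T * wd i)"
        using Suc.prems(2) False by simp
      ultimately show ?thesis using Suc.IH hit_Rt by blast
    next
      case Up
      moreover from this have "hits \<tau> s t S T n (up i) (\<omega> + S * ht i)"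
        using Suc.prems(2) False by simp
      ultimately show ?thesis using Suc.IH hit_Up by blast
    qed
  qed
qed

text \<open>\<open>in_cell 0 0\<close> holds of no \<omega>. A search for this empty target can
  succeed only because the line runs into a corner of a cell within the given depth.\<close>

lemma hits_dead:
  assumes "\<And>i. \<rho> (\<tau> i) = i" "hits \<tau> 0 0 S T n i \<omega>"
  shows "\<not> cell_alive S T i \<omega>"
proof
  assume "cell_alive S T i \<omega>"
  from hits_imp_hit[OF assms(1) this assms(2)] show False by (auto simp: hit_def in_cell_def)
qed

lemma turn_turn_back: "turn (turn_back i) = i"
  by (cases i) auto

lemmas hits_eval = hits.simps in_cell_def wd.simps ht.simps rt.simps up.simps turn.simps
  turn_back.simps shear_E.simps shear_F.simps turn_E.simps turn_F.simps cell_run.simps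
  mult_zero_left minus_zero mult_1_right One_nat_def numeral_eq_Suc pred_numeral_simps BitM.simps
  eval_nat_numeral id_apply

context
  fixes s t a b S T :: real
  assumes bounds: "0 \<le> s" "0 \<le> t" "3 * s \<le> 5 * a" "50 * a \<le> 31 * s" "3 * t \<le> 5 * b" "50 * b \<le> 31 * t"
    and ST: "S = s + t + b" "T = t"
    and gold: "s * gold = a" "t * gold = b" "S * gold = a + t" "T * gold = b"
begin

lemma shear_cell:
  "in_cell s t i \<omega> \<Longrightarrow> in_cell S T i \<omega>"
  using bounds ST by (induct i; unfold hits_eval gold; smt (verit))

lemma shear_cell_E:
  "in_cell s t i \<omega> \<Longrightarrow> t * wd i - s * ht i < \<omega> \<Longrightarrow> cell_run S T i \<omega> (shear_E i)"
  using bounds ST by (induct i; unfold hits_eval gold; smt (verit))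

lemma shear_cell_F:
  "in_cell s t i \<omega> \<Longrightarrow> \<omega> < t * wd i - s * ht i \<Longrightarrow> cell_run S T i \<omega> (shear_F i)"
  using bounds ST by (induct i; unfold hits_eval gold; smt (verit))

lemma shear_cell_singular:
  "in_cell s t i \<omega> \<Longrightarrow> \<omega> = t * wd i - s * ht i \<Longrightarrow> hits id 0 0 S T 3 i \<omega>"
  using bounds ST by (induct i; unfold hits_eval gold; smt (verit))

lemma shear_cell_entry:
  "in_cell S T i \<omega> \<Longrightarrow> hits id s t S T 2 i \<omega>"
  using bounds ST by (induct i; unfold hits_eval gold; smt (verit))

end

lemma shear_facts:
  fixes s t :: real
  assumes "0 \<le> s" "0 \<le> t"
  defines "S \<equiv> s * 1 + t * (1 + gold)" and "T \<equiv> s * 0 + t * 1"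
  obtains a b where "0 \<le> s" "0 \<le> t"
    "3 * s \<le> 5 * a" "50 * a \<le> 31 * s" "3 * t \<le> 5 * b" "50 * b \<le> 31 * t"
    "S = s + t + b" "T = t" "s * gold = a" "t * gold = b" "S * gold = a + t" "T * gold = b"
proof -
  obtain a b where ab: "gold * s = a" "gold * a = s - a" "3 * s \<le> 5 * a" "50 * a \<le> 31 * s"
    "gold * t = b" "gold * b = t - b" "3 * t \<le> 5 * b" "50 * b \<le> 31 * t"
    using gold_atom[OF assms(1)] gold_atom[OF assms(2)] by metis
  have ST: "S = s + t + b" "T = t" "S * gold = a + t" "T * gold = b"
    unfolding S_def T_def using ab by (simp_all add: algebra_simps)
  show thesis
    by (rule that[OF assms(1,2) ab(3,4,7,8) ST(1,2) ab(1,5)[unfolded mult.commute[of gold]] ST(3,4)])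
qed

context
  fixes s t a b S T :: real
  assumes bounds: "0 \<le> s" "0 \<le> t" "3 * s \<le> 5 * a" "50 * a \<le> 31 * s" "3 * t \<le> 5 * b" "50 * b \<le> 31 * t"
    and ST: "S = s + t + a + b" "T = s + t + b"
    and gold: "s * gold = a" "t * gold = b" "S * gold = s + t" "T * gold = a + t"
begin

lemma turn_cell:
  "in_cell s t i \<omega> \<Longrightarrow> in_cell S T (turn i) \<omega>"
  using bounds ST by (induct i; unfold hits_eval gold; smt (verit))

lemma turn_cell_E:
  "in_cell s t i \<omega> \<Longrightarrow> t * wd i - s * ht i < \<omega> \<Longrightarrow> cell_run S T (turn i) \<omega> (turn_E i)"
  using bounds ST by (induct i; unfold hits_eval gold; smt (verit))

lemma turn_cell_F:
  "in_cell s t i \<omega> \<Longrightarrow> \<omega> < t * wd i - s * ht i \<Longrightarrow> cell_run S T (turn i) \<omega> (turn_F i)"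
  using bounds ST by (induct i; unfold hits_eval gold; smt (verit))

lemma turn_cell_singular:
  assumes "in_cell s t i \<omega>" "\<omega> = t * wd i - s * ht i"
  shows "hits turn_back 0 0 S T 6 (turn i) \<omega>"
proof (cases i)
  case Corner
  show ?thesis
    using bounds ST assms(1) assms(2)[unfolded Corner hits_eval gold] unfolding Corner hits_eval gold by (smt (verit))
next
  case Arm
  show ?thesis
    using bounds ST assms(1) assms(2)[unfolded Arm hits_eval gold] unfolding Arm hits_eval gold by (smt (verit))
next
  case Top
  show ?thesis
    using bounds ST assms(1) assms(2)[unfolded Top hits_eval gold] unfolding Top hits_eval gold by (smt (verit))
qed

text \<open>At most five moves bring any surviving line of the old L into the range of a new
  cell.\<close>

lemma turn_cell_entry:
  assumes "in_cell S T i \<omega>"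
  shows "hits turn_back s t S T 5 i \<omega>"
proof (cases i)
  case Corner
  show ?thesis
    using bounds ST assms(1) unfolding Corner hits_eval gold by (smt (verit))
next
  case Arm
  show ?thesis
    using bounds ST assms(1) unfolding Arm hits_eval gold by (smt (verit))
next
  case Top
  show ?thesis
    using bounds ST assms(1) unfolding Top hits_eval gold by (smt (verit))
qed

end

lemma turn_facts:
  fixes s t :: real
  assumes "0 \<le> s" "0 \<le> t"
  defines "S \<equiv> s * (1 + gold) + t * (1 + gold)" and "T \<equiv> s * 1 + t * (1 + gold)"
  obtains a b where "0 \<le> s" "0 \<le> t"
    "3 * s \<le> 5 * a" "50 * a \<le> 31 * s" "3 * t \<le> 5 * b" "50 * b \<le> 31 * t"
    "S = s + t + a + b" "T = s + t + b" "s * gold = a" "t * gold = b" "S * gold = s + t" "T * gold = a + t"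
proof -
  obtain a b where ab: "gold * s = a" "gold * a = s - a" "3 * s \<le> 5 * a" "50 * a \<le> 31 * s"
    "gold * t = b" "gold * b = t - b" "3 * t \<le> 5 * b" "50 * b \<le> 31 * t"
    using gold_atom[OF assms(1)] gold_atom[OF assms(2)] by metis
  have ST: "S = s + t + a + b" "T = s + t + b" "S * gold = s + t" "T * gold = a + t"
    unfolding S_def T_def using ab by (simp_all add: algebra_simps)
  show thesis
    by (rule that[OF assms(1,2) ab(3,4,7,8) ST(1,2) ab(1,5)[unfolded mult.commute[of gold]] ST(3,4)])
qed

lemma (in coding) coding_shear:
  "coding P ((1 + gold) * P + Q) \<sigma> k E (\<lambda>i. path_word E F i (shear_F i))"
proof -
  have "coding (of_real 1 * P + of_real 0 * Q)
     (of_real (1 + gold) * P + of_real 1 * Q) (\<lambda>i. \<sigma> (id i)) (\<lambda>i. k (id i))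
     (\<lambda>i. path_word E F (id i) (shear_E i)) (\<lambda>i. path_word E F (id i) (shear_F i))"
  proof (rule coding_substitution, goal_cases)
    case (10 i) then show ?case by (cases i) (simp_all add: algebra_simps gold_sq)
  next
    case (11 i) then show ?case by (cases i) (simp_all add: algebra_simps gold_sq)
  next
    case (12 i) then show ?case by (cases i) (simp_all add: algebra_simps gold_sq)
  next
    case (13 i) then show ?case by (cases i) (simp_all add: algebra_simps gold_sq)
  next
    case (14 i) then show ?case by (cases i) (simp_all add: algebra_simps gold_sq)
  next
    case (15 i) then show ?case by (cases i) (simp_all add: algebra_simps gold_sq)
  next
    case (16 s t i \<omega>)
    show ?case unfolding id_apply by (rule shear_facts[OF 16(1,2)], rule shear_cell, assumption+, rule 16)
  next
    case (17 s t i \<omega>)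
    show ?case unfolding id_apply by (rule shear_facts[OF 17(1,2)], rule shear_cell_E, assumption+, (rule 17)+)
  next
    case (18 s t i \<omega>)
    show ?case unfolding id_apply by (rule shear_facts[OF 18(1,2)], rule shear_cell_F, assumption+, (rule 18)+)
  next
    case (19 s t i \<omega>)
    show ?case unfolding id_apply
      by (rule shear_facts[OF 19(1,2)], rule hits_dead[of id id], simp only: id_apply, rule shear_cell_singular, assumption+, (rule 19)+)
  next
    case (20 s t i \<omega>)
    show ?case
      by (rule shear_facts[OF 20(1,2)], rule hits_imp_hit[of id id, unfolded hit_def], simp only: id_apply, rule 20, rule shear_cell_entry,
          assumption+, rule 20)
  qed (use gold_pos in \<open>auto simp: zgold_add zgold_int gold_sq algebra_simps\<close>)
  then show ?thesis by (simp add: algebra_simps)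
qed

lemma (in coding) coding_turn:
  "coding ((1 + gold) * P + Q) ((1 + gold) * (P + Q)) (\<lambda>i. \<sigma> (turn i)) (\<lambda>i. k (turn i))
    (\<lambda>i. path_word E F (turn i) (turn_E i)) (\<lambda>i. path_word E F (turn i) (turn_F i))"
proof -
  have "coding (of_real (1 + gold) * P + of_real 1 * Q)
     (of_real (1 + gold) * P + of_real (1 + gold) * Q) (\<lambda>i. \<sigma> (turn i)) (\<lambda>i. k (turn i))
     (\<lambda>i. path_word E F (turn i) (turn_E i)) (\<lambda>i. path_word E F (turn i) (turn_F i))"
  proof (rule coding_substitution, goal_cases)
    case (10 i) then show ?case by (cases i) (simp_all add: algebra_simps gold_sq)
  next
    case (11 i) then show ?case by (cases i) (simp_all add: algebra_simps gold_sq)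
  next
    case (12 i) then show ?case by (cases i) (simp_all add: algebra_simps gold_sq)
  next
    case (13 i) then show ?case by (cases i) (simp_all add: algebra_simps gold_sq)
  next
    case (14 i) then show ?case by (cases i) (simp_all add: algebra_simps gold_sq)
  next
    case (15 i) then show ?case by (cases i) (simp_all add: algebra_simps gold_sq)
  next
    case (16 s t i \<omega>)
    show ?case by (rule turn_facts[OF 16(1,2)], rule turn_cell, assumption+, rule 16)
  next
    case (17 s t i \<omega>)
    show ?case by (rule turn_facts[OF 17(1,2)], rule turn_cell_E, assumption+, (rule 17)+)
  next
    case (18 s t i \<omega>)
    show ?case by (rule turn_facts[OF 18(1,2)], rule turn_cell_F, assumption+, (rule 18)+)
  next
    case (19 s t i \<omega>)
    show ?case 
      by (rule turn_facts[OF 19(1,2)], rule hits_dead[of turn turn_back], rule turn_turn_back, rule turn_cell_singular, assumption+, (rule 19)+)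
  next
    case (20 s t i \<omega>)
    show ?case
      by (rule turn_facts[OF 20(1,2)], rule hits_imp_hit[of turn turn_back, unfolded hit_def], rule turn_turn_back, rule 20, rule turn_cell_entry,
          assumption+, rule 20)
  qed (use gold_pos in \<open>auto simp: zgold_add zgold_int gold_sq algebra_simps\<close>)
  then show ?thesis by (simp add: algebra_simps)
qed

section \<open>The coding of the double pentagon by two of its diagonals\<close>

lemma corner_cross_diff:
  fixes k i :: nat
  defines "S \<equiv> sin (2 * pi / 5)"
  shows "cross (corner k) (corner (k + 1)) = S" "cross (corner k) (corner (k + 2)) = gold * S"
    "cross (corner k) (corner (k + 3)) = - (gold * S)" "cross (corner k) (corner (k + 4)) = - S"
  unfolding cross_corner S_def using sin_144 sin_216 sin_288 by simp_all

lemma corner_cross: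
  defines "S \<equiv> sin (2 * pi / 5)"
  shows "cross (corner 0) (corner 1) = S" "cross (corner 0) (corner 2) = gold * S"
    "cross (corner 0) (corner 3) = - (gold * S)" "cross (corner 0) (corner 4) = - S"
    "cross (corner 2) (corner 0) = - (gold * S)" "cross (corner 2) (corner 1) = - S"
    "cross (corner 2) (corner 3) = S" "cross (corner 2) (corner 4) = gold * S"
    "cross (corner 4) (corner 0) = S" "cross (corner 4) (corner 1) = gold * S"
    "cross (corner 4) (corner 2) = - (gold * S)" "cross (corner 4) (corner 3) = - S"
  unfolding S_def
  using corner_cross_diff[of 0] corner_cross_diff[of 1] corner_cross_diff[of 2] corner_cross_diff(1)[of 3]
    cross_swap[of "corner 2" "corner 0"] cross_swap[of "corner 2" "corner 1"]
    cross_swap[of "corner 4" "corner 0"] cross_swap[of "corner 4" "corner 1"]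
    cross_swap[of "corner 4" "corner 2"] cross_swap[of "corner 4" "corner 3"]
  by (simp_all add: numeral_2_eq_2[symmetric] del: One_nat_def)

text \<open>Diagonals of the pentagon, parallel to the sides with labels 3 and 4.\<close>

definition P0 :: complex where "P0 = corner 2 - corner 4"
definition Q0 :: complex where "Q0 = corner 2 - corner 0"

text \<open>The L laid out on the double pentagon: \<open>base_pos\<close> is the vertex that serves
  as the lower left corner of the cell, and the words list the sides crossed on the way to the next
  cell.\<close>

fun base_sheet :: "cell \<Rightarrow> sheet" where
  "base_sheet Corner = Neg" | "base_sheet Arm = Pos" | "base_sheet Top = Pos"
fun base_pos :: "cell \<Rightarrow> complex" where
  "base_pos Corner = - corner 2" | "base_pos Arm = corner 0" | "base_pos Top = corner 4"
fun base_E :: "cell \<Rightarrow> nat list" where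
  "base_E Corner = [4]" | "base_E Arm = [1]" | "base_E Top = [2, 3]"
fun base_F :: "cell \<Rightarrow> nat list" where
  "base_F Corner = [4]" | "base_F Arm = [1, 0]" | "base_F Top = [2]"

lemma cgold_mult: "of_real gold * (of_real gold * z) = z - of_real gold * z"
  by (metis gold_sq left_diff_distrib mult.assoc mult_1 of_real_1 of_real_diff of_real_mult)

lemma cgold_sq: "of_real gold * of_real gold = 1 - of_real gold"
  using cgold_mult[of 1] by simp

lemma corner_values:
  "corner 2 = gold * corner 1 - corner 0"
  "corner 3 = - gold * corner 1 - gold * corner 0"
  "corner 4 = gold * corner 0 - corner 1"
  "corner 5 = corner 0"
proof -
  show 2: "corner 2 = gold * corner 1 - corner 0" using corner_rec[of 0] by (simp add: numeral_2_eq_2)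
  show 3: "corner 3 = - gold * corner 1 - gold * corner 0"
    using corner_rec[of 1] by (simp add: numeral_eq_Suc 2[unfolded numeral_eq_Suc, simplified] right_diff_distrib cgold_mult)
  show "corner 5 = corner 0" using corner_5[of 0] by simp
  show "corner 4 = gold * corner 0 - corner 1"
    using corner_rec[of 2] by (simp add: 2 3 algebra_simps cgold_sq cgold_mult)
qed

lemma corner_diff_lattice: "i \<le> 5 \<Longrightarrow> corner i - corner 0 \<in> lattice P0 Q0"
proof -
  have c1: "corner 1 - corner 0 = of_real gold * P0 + of_real 0 * Q0"
    by (simp add: P0_def corner_values algebra_simps cgold_mult cgold_sq)
  have c2: "corner 2 - corner 0 = of_real 0 * P0 + of_real 1 * Q0"
    by (simp add: Q0_def)
  have c3: "corner 3 - corner 0 = of_real (- 1) * P0 + of_real (1 + gold) * Q0"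
    by (simp add: P0_def Q0_def corner_values algebra_simps cgold_mult cgold_sq)
  have c4: "corner 4 - corner 0 = of_real (- 1) * P0 + of_real 1 * Q0"
    by (simp add: P0_def Q0_def)
  have c0: "corner 0 - corner 0 = of_real 0 * P0 + of_real 0 * Q0" by simp
  have z: "1 + gold \<in> zgold" "- 1 \<in> zgold" "0 \<in> zgold" "1 \<in> zgold" "gold \<in> zgold"
    using zgold_int(2-4) zgold_add zgold_minus[OF zgold_int(3)] by auto
  assume "i \<le> 5"
  then consider "i = 0" | "i = 1" | "i = 2" | "i = 3" | "i = 4" | "i = 5" by linarith
  then show ?thesis
    using latticeI[OF z(3,3) c0] latticeI[OF z(5,3) c1] latticeI[OF z(3,4) c2]
      latticeI[OF z(2,1) c3] latticeI[OF z(2,4) c4] corner_values(4) by cases simp_all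
qed

text \<open>Successive translations have opposite signs, so each pair of them is a combination of
  differences of corners.\<close>

lemma hol_lattice_base: "set w \<subseteq> {..<5} \<Longrightarrow> even (length w) \<Longrightarrow> hol s w \<in> lattice P0 Q0"
proof (induction "length w" arbitrary: w rule: less_induct)
  case less
  show ?case
  proof (cases w)
    case Nil
    then show ?thesis by (auto intro!: latticeI[of 0 0] zgold_int)
  next
    case (Cons i v)
    with less.prems obtain j u where w: "w = i # j # u" by (cases v) auto
    have ij: "i < 5" "j < 5" and u: "hol s u \<in> lattice P0 Q0" using less w by auto
    let ?D = "\<lambda>i. corner i - corner 0"
    have D: "?D i \<in> lattice P0 Q0" "?D (Suc i) \<in> lattice P0 Q0"
      "- ?D j \<in> lattice P0 Q0" "- ?D (Suc j) \<in> lattice P0 Q0"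
      using ij by (auto intro!: corner_diff_lattice lattice_minus simp del: minus_diff_eq)
    define m where "m = ((?D i + ?D (Suc i)) + (- ?D j + - ?D (Suc j)))"
    have m: "m \<in> lattice P0 Q0" "- m \<in> lattice P0 Q0"
      unfolding m_def using D by (blast intro: lattice_add lattice_minus)+
    have "hol s w = (if s = Pos then m else - m) + hol s u"
      unfolding w m_def by (cases s) (simp_all add: algebra_simps)
    then show ?thesis using m u lattice_add by auto
  qed
qed

text \<open>With \<open>a\<close> and \<open>b\<close> as s and t multiplied by sin 72, and
  \<open>a1\<close>, \<open>b1\<close> as their multiples by \<open>gold\<close>, all coordinates of
  corners are linear in these four numbers. So are the cell conditions once \<omega> is multiplied
  by K. The singular case and the entry case then need only linear arithmetic.\<close>

lemma base_facts:
  assumes st: "0 \<le> s" "0 \<le> t" and d: "d = of_real s * P0 + of_real t * Q0"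
  obtains a a1 b b1 K where
    "K = cross P0 Q0" "0 < K"
    "0 \<le> a" "0 \<le> b" "3 * a \<le> 5 * a1" "50 * a1 \<le> 31 * a" "3 * b \<le> 5 * b1" "50 * b1 \<le> 31 * b"
    "cross d (corner 0) = - a - a1 - b1" "cross d (corner (Suc 0)) = - a - a1 - 2 * b"
    "cross d (corner 2) = a1 - b1" "cross d (corner 3) = 2 * a + b + b1"
    "cross d (corner 4) = a1 + b + b1" "cross d (corner 5) = - a - a1 - b1"
    "\<And>\<omega>. in_cell s t Corner \<omega> \<longleftrightarrow> - (a + 2 * a1) < K * \<omega> \<and> K * \<omega> < b + 2 * b1"
    "\<And>\<omega>. in_cell s t Arm \<omega> \<longleftrightarrow> - (a + 2 * a1) < K * \<omega> \<and> K * \<omega> < 2 * b - b1"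
    "\<And>\<omega>. in_cell s t Top \<omega> \<longleftrightarrow> - (2 * a - a1) < K * \<omega> \<and> K * \<omega> < b + 2 * b1"
    "K * (t * wd Corner - s * ht Corner) = b + 2 * b1 - a - 2 * a1"
    "K * (t * wd Arm - s * ht Arm) = 2 * b - b1 - a - 2 * a1"
    "K * (t * wd Top - s * ht Top) = b + 2 * b1 - 2 * a + a1"
    "\<And>x j. exits d Pos x j \<longleftrightarrow> j = 1 \<and> - a - a1 - 2 * b < x \<and> x < a1 - b1 \<or>
        j = 2 \<and> a1 - b1 < x \<and> x < 2 * a + b + b1"
    "\<And>x j. exits d Neg x j \<longleftrightarrow> j = 0 \<and> a + a1 + b1 < x \<and> x < a + a1 + 2 * b \<or>
        j = 3 \<and> - (2 * a + b + b1) < x \<and> x < - (a1 + b + b1) \<or>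
        j = 4 \<and> - (a1 + b + b1) < x \<and> x < a + a1 + b1"
    "\<And>x. alive d Pos x \<Longrightarrow>
        - a - a1 - 2 * b < x \<and> x < a1 - b1 \<and> alive d Neg (x + a + 2 * b + b1) \<or>
        a1 - b1 < x \<and> x < 2 * a + b + b1 \<and> alive d Neg (x - a1 - 2 * a - b)"
    "\<And>x. alive d Neg x \<Longrightarrow> a + a1 + b1 < x \<and> x < a + a1 + 2 * b \<and>
          alive d Pos (x - 2 * a - 2 * a1 - 2 * b - b1) \<or>
        - (2 * a + b + b1) < x \<and> x < - (a1 + b + b1) \<and>
          alive d Pos (x + 2 * a + a1 + 2 * b + 2 * b1) \<or>
        - (a1 + b + b1) < x \<and> x < a + a1 + b1 \<and> alive d Pos (x + b - a)"
    "\<And>x. run d Pos x [1] \<longleftrightarrow> - a - a1 - 2 * b < x \<and> x < a1 - b1"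
    "\<And>x. run d Pos x [1, 0] \<longleftrightarrow> - a - a1 - 2 * b < x \<and> x < a1 - b1 \<and>
      a + a1 + b1 < x + a + 2 * b + b1 \<and> x + a + 2 * b + b1 < a + a1 + 2 * b"
    "\<And>x. run d Pos x [2] \<longleftrightarrow> a1 - b1 < x \<and> x < 2 * a + b + b1"
    "\<And>x. run d Pos x [2, 3] \<longleftrightarrow> a1 - b1 < x \<and> x < 2 * a + b + b1 \<and>
      - (2 * a + b + b1) < x - a1 - 2 * a - b \<and> x - a1 - 2 * a - b < - (a1 + b + b1)"
    "\<And>x. run d Neg x [4] \<longleftrightarrow> - (a1 + b + b1) < x \<and> x < a + a1 + b1"
proof -
  define S where "S = sin (2 * pi / 5)"
  have S: "0 < S" unfolding S_def by (rule sin_72_pos)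
  have K: "cross P0 Q0 = S + 2 * (gold * S)"
    unfolding P0_def Q0_def by (simp add: cross_simps corner_cross S_def[symmetric])
  then have Kpos: "0 < cross P0 Q0" using S gold_pos by (simp add: add_pos_pos)
  note PC = corner_cross[folded S_def]
  have P: "cross P0 (corner 0) = - S - gold * S" "cross P0 (corner 1) = - S - gold * S"
    "cross P0 (corner 2) = gold * S" "cross P0 (corner 3) = 2 * S" "cross P0 (corner 4) = gold * S"
    unfolding P0_def by (simp_all add: cross_simps PC del: One_nat_def)
  have Q: "cross Q0 (corner 0) = - (gold * S)" "cross Q0 (corner 1) = - 2 * S"
    "cross Q0 (corner 2) = - (gold * S)" "cross Q0 (corner 3) = S + gold * S" "cross Q0 (corner 4) = S + gold * S"
    unfolding Q0_def by (simp_all add: cross_simps PC del: One_nat_def)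
  define a b where "a = S * s" and "b = S * t"
  define a1 b1 where "a1 = gold * a" and "b1 = gold * b"
  have ab: "0 \<le> a" "0 \<le> b" using st S by (simp_all add: a_def b_def)
  have ab1: "3 * a \<le> 5 * a1" "50 * a1 \<le> 31 * a" "3 * b \<le> 5 * b1" "50 * b1 \<le> 31 * b"
    unfolding a1_def b1_def using gold_atom[OF ab(1)] gold_atom[OF ab(2)] by metis+
  have f: "cross d (corner 0) = - a - a1 - b1" "cross d (corner 1) = - a - a1 - 2 * b"
    "cross d (corner (Suc 0)) = - a - a1 - 2 * b"
    "cross d (corner 2) = a1 - b1" "cross d (corner 3) = 2 * a + b + b1"
    "cross d (corner 4) = a1 + b + b1" "cross d (corner 5) = - a - a1 - b1"
    unfolding d corner_values(4)
    by (simp_all add: cross_simps P P[simplified] Q Q[simplified] a_def b_def a1_def b1_def algebra_simps)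
  define K where "K = cross P0 Q0"
  have Kst: "K * (t * 1) = b + 2 * b1" "K * (t * gold) = 2 * b - b1"
    "K * (s * 1) = a + 2 * a1" "K * (s * gold) = 2 * a - a1"
    unfolding K_def K a_def b_def a1_def b1_def by (simp_all add: algebra_simps gold_sq_mult)
  have in_cell: "in_cell s t i \<omega> \<longleftrightarrow> - (K * (s * ht i)) < K * \<omega> \<and> K * \<omega> < K * (t * wd i)" for i \<omega>
  proof -
    have "- (K * (s * ht i)) < K * \<omega> \<longleftrightarrow> K * (- (s * ht i)) < K * \<omega>" by simp
    then show ?thesis unfolding in_cell_def using Kpos
      by (simp only: K_def[symmetric] mult_less_cancel_left_pos)
  qed
  have cells: "in_cell s t Corner \<omega> \<longleftrightarrow> - (a + 2 * a1) < K * \<omega> \<and> K * \<omega> < b + 2 * b1"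
    "in_cell s t Arm \<omega> \<longleftrightarrow> - (a + 2 * a1) < K * \<omega> \<and> K * \<omega> < 2 * b - b1"
    "in_cell s t Top \<omega> \<longleftrightarrow> - (2 * a - a1) < K * \<omega> \<and> K * \<omega> < b + 2 * b1" for \<omega>
    unfolding in_cell wd.simps ht.simps Kst by (rule refl)+
  have thresholds: "K * (t * wd Corner - s * ht Corner) = b + 2 * b1 - a - 2 * a1"
    "K * (t * wd Arm - s * ht Arm) = 2 * b - b1 - a - 2 * a1"
    "K * (t * wd Top - s * ht Top) = b + 2 * b1 - 2 * a + a1"
    unfolding right_diff_distrib wd.simps ht.simps Kst by simp_all
  have exits: "exits d Pos x j \<longleftrightarrow> j = 1 \<and> - a - a1 - 2 * b < x \<and> x < a1 - b1 \<or>
      j = 2 \<and> a1 - b1 < x \<and> x < 2 * a + b + b1" (is ?pos)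
    "exits d Neg x j \<longleftrightarrow> j = 0 \<and> a + a1 + b1 < x \<and> x < a + a1 + 2 * b \<or>
      j = 3 \<and> - (2 * a + b + b1) < x \<and> x < - (a1 + b + b1) \<or>
      j = 4 \<and> - (a1 + b + b1) < x \<and> x < a + a1 + b1" (is ?neg) for x j
  proof -
    have j: "j < 5 \<longleftrightarrow> j = 0 \<or> j = 1 \<or> j = 2 \<or> j = 3 \<or> j = 4" by linarith
    have Suc: "Suc 1 = 2" "Suc 2 = 3" "Suc 3 = 4" "Suc 4 = 5" by simp_all
    show ?pos
      unfolding exits_def j using ab ab1
      by (elim disj_forward2 | auto simp del: One_nat_def simp: Suc f cross_simps)
    show ?neg
      unfolding exits_def j using ab ab1
      by (auto simp del: One_nat_def simp: Suc f cross_simps)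
  qed
  have alive_Pos: "- a - a1 - 2 * b < x \<and> x < a1 - b1 \<and> alive d Neg (x + a + 2 * b + b1) \<or>
      a1 - b1 < x \<and> x < 2 * a + b + b1 \<and> alive d Neg (x - a1 - 2 * a - b)"
    if alv: "alive d Pos x" for x
  proof -
    obtain j where j: "exits d Pos x j"
      "alive d (other_sheet Pos) (x - cross d (sheet_sign Pos * (corner j + corner (Suc j))))"
      by (rule alive_exits[OF alv])
    have *: "x - cross d (corner 1 + corner 2) = x + a + 2 * b + b1"
      "x - cross d (corner 2 + corner 3) = x - a1 - 2 * a - b"
      by (simp_all add: cross_simps f)
    have j2: "alive d Neg (x - cross d (corner j + corner (Suc j)))" using j(2) by simp
    from j(1) consider "j = 1" "- a - a1 - 2 * b < x" "x < a1 - b1"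
      | "j = 2" "a1 - b1 < x" "x < 2 * a + b + b1" unfolding exits by blast
    then show ?thesis
    proof cases
      case 1
      with j2 show ?thesis by (simp only: Suc_1 *) simp
    next
      case 2
      have "Suc 2 = 3" by simp
      with 2 j2 show ?thesis by (simp only: *) simp
    qed
  qed
  have alive_Neg: "a + a1 + b1 < x \<and> x < a + a1 + 2 * b \<and>
        alive d Pos (x - 2 * a - 2 * a1 - 2 * b - b1) \<or>
      - (2 * a + b + b1) < x \<and> x < - (a1 + b + b1) \<and>
        alive d Pos (x + 2 * a + a1 + 2 * b + 2 * b1) \<or>
      - (a1 + b + b1) < x \<and> x < a + a1 + b1 \<and> alive d Pos (x + b - a)"
    if alv: "alive d Neg x" for x
  proof -
    obtain j where j: "exits d Neg x j"
      "alive d (other_sheet Neg) (x - cross d (sheet_sign Neg * (corner j + corner (Suc j))))"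
      by (rule alive_exits[OF alv])
    have *: "x + cross d (corner 0 + corner 1) = x - 2 * a - 2 * a1 - 2 * b - b1"
      "x + cross d (corner 3 + corner 4) = x + 2 * a + a1 + 2 * b + 2 * b1"
      "x + cross d (corner 4 + corner 5) = x + b - a"
      by (simp_all add: cross_simps f)
    have j2: "alive d Pos (x + cross d (corner j + corner (Suc j)))"
      using j(2) by (simp only: other_sheet.simps sheet_sign.simps mult_minus1 cross_simps(6) diff_minus_eq_add)
    have Suc: "Suc 0 = 1" "Suc 3 = 4" "Suc 4 = 5" by simp_all
    from j(1) consider "j = 0" "a + a1 + b1 < x" "x < a + a1 + 2 * b"
      | "j = 3" "- (2 * a + b + b1) < x" "x < - (a1 + b + b1)"
      | "j = 4" "- (a1 + b + b1) < x" "x < a + a1 + b1" unfolding exits by blast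
    then show ?thesis
    proof cases
      case 1
      with j2 show ?thesis by (simp only: Suc *) simp
    next
      case 2
      with j2 show ?thesis by (simp only: Suc *) simp
    next
      case 3
      with j2 show ?thesis by (simp only: Suc *) simp
    qed
  qed
  have runs: "run d Pos x [1] \<longleftrightarrow> - a - a1 - 2 * b < x \<and> x < a1 - b1" (is ?r1)
    "run d Pos x [1, 0] \<longleftrightarrow> - a - a1 - 2 * b < x \<and> x < a1 - b1 \<and>
      a + a1 + b1 < x + a + 2 * b + b1 \<and> x + a + 2 * b + b1 < a + a1 + 2 * b" (is ?r2)
    "run d Pos x [2] \<longleftrightarrow> a1 - b1 < x \<and> x < 2 * a + b + b1" (is ?r3)
    "run d Pos x [2, 3] \<longleftrightarrow> a1 - b1 < x \<and> x < 2 * a + b + b1 \<and>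
      - (2 * a + b + b1) < x - a1 - 2 * a - b \<and> x - a1 - 2 * a - b < - (a1 + b + b1)" (is ?r4)
    "run d Neg x [4] \<longleftrightarrow> - (a1 + b + b1) < x \<and> x < a + a1 + b1" (is ?r5) for x
  proof -
    have *: "x - cross d (sheet_sign Pos * (corner 1 + corner (Suc 1))) = x + a + 2 * b + b1"
      "x - cross d (sheet_sign Pos * (corner 2 + corner (Suc 2))) = x - a1 - 2 * a - b"
      by (simp_all add: cross_simps f f(4)[unfolded numeral_2_eq_2])
    show ?r1 ?r2 ?r3 ?r4 ?r5
      unfolding run.simps * other_sheet.simps exits by simp_all
  qed
  show thesis
    using that[OF K_def Kpos[folded K_def] ab ab1 f(1,3-7) cells thresholds exits alive_Pos alive_Neg runs] .
qed

lemma base_coding: "coding P0 Q0 base_sheet base_pos base_E base_F"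
proof (unfold_locales, goal_cases)
  case 1
  obtain a a1 b b1 K where "K = cross P0 Q0" "0 < K" by (rule base_facts[of 0 0]) auto
  then show ?case by simp
next
  case (2 s w)
  then show ?case by (rule hol_lattice_base)
next
  case (3 i)
  then show ?case by (cases i) auto
next
  case (4 i)
  then show ?case by (cases i) auto
next
  case (5 i)
  then show ?case
    by (cases i) (simp_all add: P0_def corner_values corner_values(1)[unfolded numeral_2_eq_2]
        algebra_simps cgold_mult cgold_sq)
next
  case (6 i)
  then show ?case
    by (cases i) (simp_all add: Q0_def corner_values corner_values(1)[unfolded numeral_2_eq_2]
        algebra_simps cgold_mult cgold_sq)
next
  case (7 s t i \<omega> d)
  show ?case
  proof (rule base_facts[OF 7(1-3)], goal_cases)
    case (1 a a1 b b1 K)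
    have "K * (t * wd i - s * ht i) < K * \<omega>" using 7(5) 1(2) by simp
    with 7(4) 1(3-8) show ?case
      by (cases i)
         (simp_all only: 1(1)[symmetric] 1(9-20) base_sheet.simps base_pos.simps base_E.simps
           1(25-29) cross_simps, linarith+)
  qed
next
  case (8 s t i \<omega> d)
  show ?case
  proof (rule base_facts[OF 8(1-3)], goal_cases)
    case (1 a a1 b b1 K)
    have "K * \<omega> < K * (t * wd i - s * ht i)" using 8(5) 1(2) by simp
    with 8(4) 1(3-8) show ?case
      by (cases i)
         (simp_all only: 1(1)[symmetric] 1(9-20) base_sheet.simps base_pos.simps base_F.simps
           1(25-29) cross_simps, linarith+)
  qed
next
  case (9 s t i \<omega> d)
  show ?case
  proof (rule base_facts[OF 9(1-3)], goal_cases)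
    case (1 a a1 b b1 K)
    have K\<omega>: "K * \<omega> = K * (t * wd i - s * ht i)" using 9(5) by simp
    show ?case
    proof
      assume alv: "alive d (base_sheet i) (cross d (base_pos i) - cross P0 Q0 * \<omega>)"
      show False
      proof (cases i)
        case Corner
        \<comment> \<open>The upper right corner lies strictly inside the range of the cell, which
          needs s and t to be positive.\<close>
        have "0 < a" "0 < b"
          using 9(4) 1(3-8) unfolding Corner 1(15) K\<omega>[unfolded Corner 1(18)] by linarith+
        have "alive d Neg (a + a1 - b - b1)"
          using alv Corner K\<omega>[unfolded Corner 1(18)]
          by (simp add: 1(1)[symmetric] 1(9-14) cross_simps algebra_simps)
        \<comment> \<open>The only possible exit is side 4, after which the line has exactly the
          coordinate of \<open>corner 2\<close> and cannot leave \<open>Pos\<close>.\<close>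
        from 1(24)[OF this] 1(23)[of "a + a1 - b - b1 + b - a"] \<open>0 < a\<close> \<open>0 < b\<close> 1(3-8)
        show False by (elim disjE conjE) simp_all
      next
        case Arm
        have "0 < a" "0 < b"
          using 9(4) 1(3-8) unfolding Arm 1(16) K\<omega>[unfolded Arm 1(19)] by linarith+
        have "alive d Pos (a1 - 2 * b)"
          using alv Arm K\<omega>[unfolded Arm 1(19)]
          by (simp add: 1(1)[symmetric] 1(9-14) cross_simps algebra_simps)
        from 1(23)[OF this] 1(24)[of "a1 - 2 * b + a + 2 * b + b1"] \<open>0 < a\<close> \<open>0 < b\<close> 1(3-8)
        show False by (elim disjE conjE) simp_all
      next
        case Top
        have "0 < a" "0 < b"
          using 9(4) 1(3-8) unfolding Top 1(17) K\<omega>[unfolded Top 1(20)] by linarith+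
        have "alive d Pos (2 * a - b1)"
          using alv Top K\<omega>[unfolded Top 1(20)]
          by (simp add: 1(1)[symmetric] 1(9-14) cross_simps algebra_simps)
        from 1(23)[OF this] 1(24)[of "2 * a - b1 - a1 - 2 * a - b"] \<open>0 < a\<close> \<open>0 < b\<close> 1(3-8)
        show False by (elim disjE conjE) simp_all
      qed
    qed
  qed
next
  case (10 s t d sh y)
  show ?case
  proof (rule base_facts[OF 10(1-3)], goal_cases)
    case (1 a a1 b b1 K)
    have ex: "\<exists>i \<omega>. in_cell s t i \<omega> \<and> base_sheet i = Pos \<and>
        y = cross d (base_pos i) - cross P0 Q0 * \<omega>" if "alive d Pos y" for y
    proof -
      from 1(23)[OF that] consider "- a - a1 - 2 * b < y" "y < a1 - b1"
        | "a1 - b1 < y" "y < 2 * a + b + b1" by blast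
      then show ?thesis
      proof cases
        case A: 1
        with 1(2-8) show ?thesis
          by (intro exI[of _ Arm] exI[of _ "(- a - a1 - b1 - y) / K"])
             (auto simp: 1(1)[symmetric] 1(9-17))
      next
        case B: 2
        with 1(2-8) show ?thesis
          by (intro exI[of _ Top] exI[of _ "(a1 + b + b1 - y) / K"])
             (auto simp: 1(1)[symmetric] 1(9-17))
      qed
    qed
    show ?case
    proof (cases sh)
      case Pos
      with \<open>alive d sh y\<close> obtain i \<omega> where "in_cell s t i \<omega>" "base_sheet i = sh"
        "y = cross d (base_pos i) - cross P0 Q0 * \<omega>" using ex by blast
      then show ?thesis by (intro exI[of _ "[]"] exI[of _ i] exI[of _ \<omega>]) (simp add: cross_simps)
    next
      case Neg
      obtain j where j: "exits d sh y j"
        "alive d (other_sheet sh) (y - cross d (sheet_sign sh * (corner j + corner (Suc j))))"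
        by (rule alive_exits[OF 10(4)])
      \<comment> \<open>Lines of sheet \<open>Neg\<close> that leave through side 4 lie in
        \<open>Corner\<close>; all others pass into \<open>Pos\<close>, where the two exit intervals
        correspond to \<open>Arm\<close> and \<open>Top\<close>.\<close>
      show ?thesis
      proof (cases "j = 4")
        case True
        with j(1) Neg 1(2-8) show ?thesis
          by (intro exI[of _ "[]"] exI[of _ Corner] exI[of _ "(- a1 + b1 - y) / K"])
             (auto simp: 1(1)[symmetric] 1(9-17) 1(22) cross_simps)
      next
        case False
        let ?y = "y - cross d (sheet_sign sh * (corner j + corner (Suc j)))"
        obtain i \<omega> where "in_cell s t i \<omega>" "base_sheet i = Pos"
          "?y = cross d (base_pos i) - cross P0 Q0 * \<omega>" using ex[of ?y] j(2) Neg by auto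
        with j(1) Neg show ?thesis by (intro exI[of _ "[j]"] exI[of _ i] exI[of _ \<omega>]) simp
      qed
    qed
  qed
qed

section \<open>Rotations of the base coding\<close>

definition base_P :: "nat \<Rightarrow> complex" where "base_P m = cis (real m * pi / 5) * P0"

lemma base_P_Suc: "base_P (Suc m) = cis (pi / 5) * base_P m"
  by (simp add: base_P_def cis_mult distrib_right add_divide_distrib flip: mult.assoc)

lemma rotate_corner: "cis (pi / 5) * corner j = - corner (j + 3)"
proof -
  have "2 * pi * real (j + 3) / 5 + 13 * pi / 10 = pi / 5 + (2 * pi * real j / 5 + 13 * pi / 10) + pi"
    by (simp add: field_simps)
  then show ?thesis unfolding corner_def by (simp only: cis_mult[symmetric] cis_pi) simp
qed

lemma Q0_eq: "Q0 = cis (pi / 5) * P0"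
  using rotate_corner[of 2] rotate_corner[of 4] corner_5[of 0] corner_5[of 2]
  by (simp add: P0_def Q0_def right_diff_distrib)

lemma P0_real: "P0 = of_real (Re P0)"
proof -
  define x where "x = 21 * pi / 10"
  have "corner 2 = cis x" "corner 4 = cis (5 * pi - x)"
    unfolding corner_def x_def by (rule arg_cong[of _ _ cis]; simp add: field_simps)+
  moreover have "sin (5 * pi - x) = sin x"
    using sin_cos_squared_add[of x] sin_npi[of 5] cos_npi[of 5] unfolding sin_diff by simp
  ultimately show ?thesis by (simp add: complex_eq_iff P0_def)
qed

lemma mod_bij: "bij_betw (\<lambda>j. (j + 3) mod 5) {..<5::nat} {..<5}"
proof (rule bij_betw_byWitness[where f' = "\<lambda>j. (j + 2) mod 5"])
  show "\<forall>j\<in>{..<5::nat}. ((j + 3) mod 5 + 2) mod 5 = j" "\<forall>j\<in>{..<5::nat}. ((j + 2) mod 5 + 3) mod 5 = j"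
    by (simp_all only: mod_add_left_eq add.assoc) simp_all
qed auto

lemma corner_mod: "corner ((j + 3) mod 5) = corner (j + 3)" "corner (Suc ((j + 3) mod 5)) = corner (Suc j + 3)"
  if "j < 5"
proof -
  consider "(j + 3) mod 5 = j + 3" | i where "(j + 3) mod 5 = i" "j + 3 = i + 5"
  proof (cases "j < 2")
    case True
    then show ?thesis using that(1) by simp
  next
    case False
    then have "j + 3 = (j - 2) + 5" by simp
    moreover from this have "(j + 3) mod 5 = j - 2" using \<open>j < 5\<close> by (simp only: mod_add_self2) simp
    ultimately show ?thesis using that(2) by blast
  qed
  then have "corner ((j + 3) mod 5) = corner (j + 3) \<and> corner (Suc ((j + 3) mod 5)) = corner (Suc j + 3)"
  proof cases
    case 1
    then show ?thesis by simp
  next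
    case 2
    have "Suc j + 3 = Suc i + 5" using 2(2) by simp
    then show ?thesis unfolding 2(1) unfolding \<open>Suc j + 3 = Suc i + 5\<close> 2(2) by (simp only: corner_5)
  qed
  then show "corner ((j + 3) mod 5) = corner (j + 3)" "corner (Suc ((j + 3) mod 5)) = corner (Suc j + 3)"
    by blast+
qed

lemma rotate_sides:
  "j < 5 \<Longrightarrow> cis (pi / 5) * corner j = - corner ((j + 3) mod 5) \<and>
    cis (pi / 5) * corner (Suc j) = - corner (Suc ((j + 3) mod 5))"
  by (simp only: rotate_corner corner_mod simp_thms)

text \<open>The rotation by pi / 5 is a symmetry of the double pentagon that interchanges its
  polygons, and it carries each pair of consecutive vectors to the next pair.\<close>

lemma coding_base: "\<exists>\<sigma> k E F. coding (base_P m) (base_P (Suc m)) \<sigma> k E F"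
proof (induction m)
  case 0
  have "base_P 0 = P0" "base_P (Suc 0) = Q0" by (simp_all add: base_P_def Q0_eq)
  then show ?case using base_coding by metis
next
  case (Suc m)
  then obtain \<sigma> k E F where "coding (base_P m) (base_P (Suc m)) \<sigma> k E F" by blast
  then have "coding (cis (pi/5) * base_P m) (cis (pi/5) * base_P (Suc m)) (\<lambda>i. other_sheet (\<sigma> i)) (\<lambda>i. cis (pi/5) * k i)
    (\<lambda>i. map (\<lambda>j. (j + 3) mod 5) (E i)) (\<lambda>i. map (\<lambda>j. (j + 3) mod 5) (F i))"
    by (rule coding_symmetry[OF _ norm_cis mod_bij rotate_sides])
  then show ?case unfolding base_P_Suc[of "Suc m", symmetric] base_P_Suc[of m, symmetric]
    by (intro exI)
qed

lemma coding_uminus: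
  assumes "coding P Q \<sigma> k E F"
  shows "coding (- P) (- Q) (\<lambda>i. other_sheet (\<sigma> i)) (\<lambda>i. - k i) E F"
proof -
  have "coding (- 1 * P) (- 1 * Q) (\<lambda>i. other_sheet (\<sigma> i)) (\<lambda>i. - 1 * k i) (\<lambda>i. map id (E i)) (\<lambda>i. map id (F i))"
    by (rule coding_symmetry[OF assms, of "- 1" id]) simp_all
  then show ?thesis by simp
qed

section \<open>The pentagon as an intersection of half planes\<close>

lemma cross_inner: "cross v z = (\<i> * v) \<bullet> z"
  by (simp add: cross_def inner_complex_def)

text \<open>The distance from the line of side k up to a positive factor, counted positive towards
  the inside.\<close>

definition side_value :: "nat \<Rightarrow> sheet \<Rightarrow> complex \<Rightarrow> real" where
  "side_value k s z = cross (sheet_sign s * (corner (Suc k) - corner k)) (z - sheet_sign s * corner k)"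

lemma sheet_sign_cross: "cross (sheet_sign s * a) (sheet_sign s * b) = cross a b"
  by (cases s) (simp_all add: cross_simps)

lemma side_value_corner_diff:
  "side_value k s (sheet_sign s * corner k) = 0"
  "side_value k s (sheet_sign s * corner (k + 1)) = 0"
  "0 < side_value k s (sheet_sign s * corner (k + 2))"
  "0 < side_value k s (sheet_sign s * corner (k + 3))"
  "0 < side_value k s (sheet_sign s * corner (k + 4))"
proof -
  have sv: "side_value k s (sheet_sign s * corner m) =
    cross (corner (k + 1)) (corner m) + cross (corner k) (corner (k + 1)) - cross (corner k) (corner m)" for m
    unfolding side_value_def right_diff_distrib[symmetric] sheet_sign_cross
    using cross_swap[of "corner (Suc k)" "corner k"] by (simp add: cross_simps)
  have gS: "gold * sin (2 * pi / 5) < sin (2 * pi / 5)" "0 < gold * sin (2 * pi / 5)"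
    using sin_72_pos gold_pos gold_less_1 by simp_all
  note c = corner_cross_diff(1)[of k] corner_cross_diff(2)[of k] corner_cross_diff(3)[of k]
    corner_cross_diff(4)[of k] corner_cross_diff(1)[of "k+1"] corner_cross_diff(2)[of "k+1"]
    corner_cross_diff(3)[of "k+1"]
  have e: "k + 1 + 1 = k + 2" "k + 1 + 2 = k + 3" "k + 1 + 3 = k + 4" by simp_all
  show "side_value k s (sheet_sign s * corner k) = 0"
    unfolding sv using cross_swap[of "corner (k+1)" "corner k"] by (simp add: cross_simps)
  show "side_value k s (sheet_sign s * corner (k + 1)) = 0"
    unfolding sv by (simp add: cross_simps)
  show "0 < side_value k s (sheet_sign s * corner (k + 2))"
    "0 < side_value k s (sheet_sign s * corner (k + 3))"
    "0 < side_value k s (sheet_sign s * corner (k + 4))"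
    unfolding sv using c[unfolded e] gS sin_72_pos by linarith+
qed

text \<open>The disjunction describes the two ends of side k, with corner indices understood modulo
  5.\<close>

lemma side_value_corner:
  assumes "k < 5" "m \<le> 5"
  shows "0 \<le> side_value k s (sheet_sign s * corner m)"
    "side_value k s (sheet_sign s * corner m) = 0 \<Longrightarrow> m = k \<or> m = k + 1 \<or> m + 5 = k + 1 \<or> k = 0 \<and> m = 5"
proof -
  consider "m = k" | "m = k + 1" | "m = k + 2" | "m = k + 3" | "m = k + 4" | "m = 5" "k = 0"
    | "m + 5 = k + 1" | "m + 5 = k + 2" | "m + 5 = k + 3" | "m + 5 = k + 4"
  proof -
    have "k = 0 \<or> k = 1 \<or> k = 2 \<or> k = 3 \<or> k = 4" using assms(1) by linarith
    moreover have "m = 0 \<or> m = 1 \<or> m = 2 \<or> m = 3 \<or> m = 4 \<or> m = 5" using assms(2) by linarith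
    ultimately show thesis using that by (elim disjE) simp_all
  qed
  then have "0 \<le> side_value k s (sheet_sign s * corner m) \<and>
    (side_value k s (sheet_sign s * corner m) = 0 \<longrightarrow> m = k \<or> m = k + 1 \<or> m + 5 = k + 1 \<or> k = 0 \<and> m = 5)"
    using side_value_corner_diff[of k s] corner_5[of m] corner_5[of 0]
    by cases (simp_all only: corner_5[symmetric, of m] add_0, auto)
  then show "0 \<le> side_value k s (sheet_sign s * corner m)"
    "side_value k s (sheet_sign s * corner m) = 0 \<Longrightarrow> m = k \<or> m = k + 1 \<or> m + 5 = k + 1 \<or> k = 0 \<and> m = 5"
    by blast+
qed

lemma side_value_affine:
  "side_value k s ((1 - u) *\<^sub>R a + u *\<^sub>R b) = (1 - u) * side_value k s a + u * side_value k s b"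
  by (simp add: side_value_def cross_inner inner_diff_right inner_add_right algebra_simps)

lemma side_value_open_side:
  assumes "z \<in> open_side s j" "j < 5" "k < 5"
  shows "k = j \<Longrightarrow> side_value k s z = 0" "k \<noteq> j \<Longrightarrow> 0 < side_value k s z"
proof -
  from assms obtain u where u: "0 < u" "u < 1"
    and z: "z = (1 - u) *\<^sub>R (sheet_sign s * corner j) + u *\<^sub>R (sheet_sign s * corner (Suc j))"
    by (auto simp: open_side_def in_segment)
  show "side_value k s z = 0" if "k = j"
    unfolding z side_value_affine using that side_value_corner_diff(1,2)[of k s] by simp
  show "0 < side_value k s z" if kj: "k \<noteq> j"
  proof -
    have "0 \<le> side_value k s (sheet_sign s * corner j)" "0 \<le> side_value k s (sheet_sign s * corner (Suc j))"
      using side_value_corner assms by simp_all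
    moreover have "side_value k s (sheet_sign s * corner j) \<noteq> 0 \<or> side_value k s (sheet_sign s * corner (Suc j)) \<noteq> 0"
      using side_value_corner(2)[OF assms(3), of j s] side_value_corner(2)[OF assms(3), of "Suc j" s] assms kj
      by auto
    ultimately show ?thesis unfolding z side_value_affine using u
      by (metis add_nonneg_pos add_pos_nonneg diff_gt_0_iff_gt mult_nonneg_nonneg mult_pos_pos order_le_less)
  qed
qed

lemma side_value_interior:
  assumes "z \<in> interior (polygon s)" "k < 5"
  shows "0 < side_value k s z"
proof -
  define v where "v = \<i> * (sheet_sign s * (corner (Suc k) - corner k))"
  have sv: "side_value k s z = v \<bullet> z - v \<bullet> (sheet_sign s * corner k)" for z
    by (simp add: side_value_def v_def cross_inner inner_diff_right)
  have "v \<noteq> 0"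
  proof
    assume "v = 0"
    then show False using side_value_corner_diff(3)[of k s] by (simp add: sv)
  qed
  have "v \<bullet> (sheet_sign s * corner k) \<le> v \<bullet> (sheet_sign s * corner j)" if "j < 5" for j
    using side_value_corner(1)[OF assms(2), of j s] sv[of "sheet_sign s * corner j"] that by simp
  then have "(\<lambda>j. sheet_sign s * corner j) ` {..<5} \<subseteq> {z. v \<bullet> z \<ge> v \<bullet> (sheet_sign s * corner k)}"
    by auto
  then have "polygon s \<subseteq> {z. v \<bullet> z \<ge> v \<bullet> (sheet_sign s * corner k)}"
    unfolding polygon_def by (rule hull_minimal) (rule convex_halfspace_ge)
  then have "z \<in> interior {z. v \<bullet> z \<ge> v \<bullet> (sheet_sign s * corner k)}"
    using assms(1) interior_mono by blast
  then show ?thesis using interior_halfspace_ge[OF \<open>v \<noteq> 0\<close>] by (simp add: sv)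
qed

text \<open>The three determinants, divided by their sum, are the barycentric coordinates of
  z.\<close>

lemma triangle_hull:
  assumes D: "0 < cross (b - a) (c - a)"
    and "0 \<le> cross (b - a) (z - a)" "0 \<le> cross (c - b) (z - b)" "0 \<le> cross (a - c) (z - c)"
  shows "z \<in> convex hull {a, b, c}"
proof -
  define D where "D = cross (b - a) (c - a)"
  define p q r where "p = cross (c - b) (z - b) / D" and "q = cross (a - c) (z - c) / D"
    and "r = cross (b - a) (z - a) / D"
  have D0: "0 < D" using D by (simp add: D_def)
  have "cross (c - b) (z - b) + cross (a - c) (z - c) + cross (b - a) (z - a) = D"
    by (simp add: D_def cross_def algebra_simps)
  then have sum: "p + q + r = 1" using D0
    by (simp add: p_def q_def r_def add_divide_distrib[symmetric])
  have "D *\<^sub>R z = cross (c - b) (z - b) *\<^sub>R a + cross (a - c) (z - c) *\<^sub>R b + cross (b - a) (z - a) *\<^sub>R c"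
    by (simp add: D_def cross_def complex_eq_iff algebra_simps)
  then have "z = (1 / D) *\<^sub>R (cross (c - b) (z - b) *\<^sub>R a + cross (a - c) (z - c) *\<^sub>R b + cross (b - a) (z - a) *\<^sub>R c)"
    using D0 by (metis divideR_right less_irrefl scaleR_one divide_inverse_commute mult_1_right scaleR_scaleR inverse_eq_divide)
  then have "z = p *\<^sub>R a + q *\<^sub>R b + r *\<^sub>R c"
    by (simp add: p_def q_def r_def scaleR_add_right)
  moreover have "0 \<le> p" "0 \<le> q" "0 \<le> r" using assms(2-4) D0 by (simp_all add: p_def q_def r_def)
  ultimately show ?thesis using sum by (auto simp: convex_hull_3)
qed

text \<open>The points where all side functions are positive form an open set. It lies in the
  pentagon because the two diagonals from corner 0 cut it into parts of three triangles spanned by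
  corners.\<close>

lemma interior_polygonI:
  assumes "\<And>k. k < 5 \<Longrightarrow> 0 < side_value k s z"
  shows "z \<in> interior (polygon s)"
proof (rule interiorI)
  let ?U = "\<Inter>k\<in>{..<5}. {z. 0 < side_value k s z}"
  have "continuous_on UNIV (side_value k s)" for k
    unfolding side_value_def cross_inner by (intro continuous_intros)
  then show "open ?U" by (intro open_INT ballI open_Collect_less continuous_on_const) auto
  show "z \<in> ?U" using assms by simp
  show "?U \<subseteq> polygon s"
  proof
    fix z assume "z \<in> ?U"
    then have sv: "0 < side_value k s z" if "k < 5" for k using that by simp
    define c where "c j = sheet_sign s * corner j" for j
    have side: "side_value k s z = cross (c (Suc k) - c k) (z - c k)" for k
      by (simp add: side_value_def c_def right_diff_distrib)
    have c_in: "c j \<in> (\<lambda>j. sheet_sign s * corner j) ` {..<5}" if "j < 5" for j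
      unfolding c_def using that by (intro imageI) simp
    have tri: "z \<in> polygon s" if "z \<in> convex hull {c i, c j, c k}" "i < 5" "j < 5" "k < 5" for i j k
    proof -
      have "convex hull {c i, c j, c k} \<subseteq> polygon s"
        unfolding polygon_def by (rule hull_mono) (use c_in that in auto)
      then show ?thesis using that by blast
    qed
    have cc: "cross (c i) (c j) = cross (corner i) (corner j)" for i j
      by (simp add: c_def sheet_sign_cross)
    have D: "cross (c j - c i) (c k - c i) = cross (corner j) (corner k) + cross (corner i) (corner j) - cross (corner i) (corner k)"
      for i j k using cross_swap[of "c j" "c i"] by (simp add: cross_simps cc)
    have gS: "gold * sin (2 * pi / 5) < sin (2 * pi / 5)" "0 < gold * sin (2 * pi / 5)"
      using sin_72_pos gold_pos gold_less_1 by simp_all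
    have C: "cross (corner 0) (corner 1) = sin (2 * pi / 5)" "cross (corner 0) (corner 2) = gold * sin (2 * pi / 5)"
      "cross (corner 0) (corner 3) = - (gold * sin (2 * pi / 5))" "cross (corner 0) (corner 4) = - sin (2 * pi / 5)"
      "cross (corner 1) (corner 2) = sin (2 * pi / 5)" "cross (corner 2) (corner 3) = sin (2 * pi / 5)"
      "cross (corner 3) (corner 4) = sin (2 * pi / 5)"
      using corner_cross_diff[of 0] corner_cross_diff(1)[of 1] corner_cross_diff(1)[of 2] corner_cross_diff(1)[of 3]
      by (simp_all add: numeral_2_eq_2[symmetric] del: One_nat_def)
    have D012: "0 < cross (c 1 - c 0) (c 2 - c 0)" and D023: "0 < cross (c 2 - c 0) (c 3 - c 0)"
      and D034: "0 < cross (c 3 - c 0) (c 4 - c 0)"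
      unfolding D C using gS sin_72_pos by linarith+
    have neg: "cross (a - b) (z - b) = - cross (b - a) (z - a)" for a b z
      by (simp add: cross_def algebra_simps)
    have Suc: "Suc 0 = 1" "Suc 1 = 2" "Suc 2 = 3" "Suc 3 = 4" "Suc 4 = 5" by simp_all
    have s0: "0 \<le> cross (c 1 - c 0) (z - c 0)" using sv[of 0] by (simp only: side Suc) simp
    have s1: "0 \<le> cross (c 2 - c 1) (z - c 1)" using sv[of 1] by (simp only: side Suc) simp
    have s2: "0 \<le> cross (c 3 - c 2) (z - c 2)" using sv[of 2] by (simp only: side Suc) simp
    have s3: "0 \<le> cross (c 4 - c 3) (z - c 3)" using sv[of 3] by (simp only: side Suc) simp
    have "c 5 = c 0" using corner_5[of 0] by (simp add: c_def)
    then have s4: "0 \<le> cross (c 0 - c 4) (z - c 4)" using sv[of 4] by (simp only: side Suc) simp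
    consider "cross (c 2 - c 0) (z - c 0) \<le> 0"
      | "0 \<le> cross (c 2 - c 0) (z - c 0)" "cross (c 3 - c 0) (z - c 0) \<le> 0"
      | "0 \<le> cross (c 3 - c 0) (z - c 0)" by linarith
    then show "z \<in> polygon s"
    proof cases
      case 1
      then show ?thesis using tri[OF triangle_hull[OF D012 s0 s1]] neg[of "c 0" "c 2" z] by simp
    next
      case 2
      then show ?thesis using tri[OF triangle_hull[OF D023 _ s2]] neg[of "c 0" "c 3" z] by simp
    next
      case 3
      then show ?thesis using tri[OF triangle_hull[OF D034 _ s3 s4]] by simp
    qed
  qed
qed

section \<open>Trajectories as orbits\<close>

lemma cross_open_side:
  assumes "z \<in> open_side s j"
  obtains u where "0 < u" "u < 1" "z = sheet_sign s * (corner j + of_real u * (corner (Suc j) - corner j))"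
proof -
  from assms obtain u where "0 < u" "u < 1"
    "z = (1 - u) *\<^sub>R (sheet_sign s * corner j) + u *\<^sub>R (sheet_sign s * corner (Suc j))"
    by (auto simp: open_side_def in_segment)
  then show thesis by (intro that[of u]) (simp_all add: scaleR_conv_of_real algebra_simps)
qed

text \<open>The rate at which \<open>side_value\<close> decreases along d; it is positive when d
  points outwards across side j.\<close>

definition side_dir :: "complex \<Rightarrow> sheet \<Rightarrow> nat \<Rightarrow> real" where
  "side_dir d s j = cross d (sheet_sign s * (corner (Suc j) - corner j))"

lemma exits_side_dir: "exits d s x j \<Longrightarrow> 0 < side_dir d s j"
  by (auto simp: exits_def side_dir_def right_diff_distrib cross_simps)

lemma side_value_move:
  "side_value k s (z + of_real t * d) = side_value k s z - t * side_dir d s k"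
proof -
  have "cross v (z + of_real t * d - w) = cross v (z - w) - t * cross d v" for v w
    using cross_swap[of v d] by (simp add: cross_simps algebra_simps)
  then show ?thesis by (simp add: side_value_def side_dir_def)
qed

lemma cross_side:
  "cross d (sheet_sign s * (corner j + of_real u * (corner (Suc j) - corner j))) =
    cross d (sheet_sign s * corner j) + u * side_dir d s j"
proof -
  have "sheet_sign s * (corner j + of_real u * (corner (Suc j) - corner j)) =
    sheet_sign s * corner j + of_real u * (sheet_sign s * (corner (Suc j) - corner j))"
    by (simp add: algebra_simps)
  then show ?thesis by (simp add: cross_simps side_dir_def)
qed

text \<open>At the midpoint of the chord the function of the exit side is positive, and at the
  leaving point it vanishes; so it decreases along d, and d points outwards across the exit
  side.\<close>

lemma chord_exits:
  assumes "is_chord d c" "d \<noteq> 0"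
  shows "exits d (chord_sheet c) (cross d (leave c)) (exit_side c)"
    and "cross d (enter c) = cross d (leave c)"
    and "exit_side c < 5"
proof -
  define s j where "s = chord_sheet c" and "j = exit_side c"
  from assms obtain t where j: "j < 5" and l: "leave c \<in> open_side s j" and t: "0 < t"
    "leave c = enter c + of_real t * d"
    and seg: "open_segment (enter c) (leave c) \<subseteq> interior (polygon s)"
    by (auto simp: is_chord_def s_def j_def)
  have sv: "side_value j s (leave c) = 0" by (rule side_value_open_side(1)[OF l j j refl])
  show "cross d (enter c) = cross d (leave c)" using t(2) by (simp add: cross_simps)
  show "exit_side c < 5" using j by (simp add: j_def)
  have "enter c \<noteq> leave c" using t assms(2) by auto
  then have "enter c + (1/2) *\<^sub>R (leave c - enter c) \<in> open_segment (enter c) (leave c)"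
    by (auto simp: in_segment algebra_simps intro!: exI[of _ "1/2"])
  then have "0 < side_value j s (enter c + (1/2) *\<^sub>R (leave c - enter c))"
    using seg side_value_interior j by blast
  moreover have "enter c + (1/2) *\<^sub>R (leave c - enter c) = leave c + of_real (- t / 2) * d"
    using t(2) by (simp add: scaleR_conv_of_real algebra_simps)
  ultimately have "0 < t * side_dir d s j" using sv side_value_move[of j s "leave c" "- t / 2" d] by simp
  then have "0 < side_dir d s j" using t(1) by (simp add: zero_less_mult_iff)
  moreover obtain u where "0 < u" "u < 1"
    and "leave c = sheet_sign s * (corner j + of_real u * (corner (Suc j) - corner j))"
    by (rule cross_open_side[OF l])
  moreover note cross_side[of d s j u]
  moreover have "cross d (sheet_sign s * corner (Suc j)) = cross d (sheet_sign s * corner j) + side_dir d s j"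
    by (simp add: side_dir_def algebra_simps cross_simps)
  ultimately show "exits d (chord_sheet c) (cross d (leave c)) (exit_side c)"
    using j by (simp add: exits_def s_def[symmetric] j_def[symmetric])
qed

text \<open>The point of side j with transversal coordinate x, by linear interpolation between the
  ends of the side.\<close>

definition side_point :: "complex \<Rightarrow> sheet \<Rightarrow> real \<Rightarrow> nat \<Rightarrow> complex" where
  "side_point d s x j = sheet_sign s * (corner j +
     of_real ((x - cross d (sheet_sign s * corner j)) / side_dir d s j) * (corner (Suc j) - corner j))"

lemma side_point:
  assumes "exits d s x j"
  shows "side_point d s x j \<in> open_side s j" "cross d (side_point d s x j) = x"
proof -
  define u where "u = (x - cross d (sheet_sign s * corner j)) / side_dir d s j"
  have sd: "0 < side_dir d s j" by (rule exits_side_dir[OF assms])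
  have c: "cross d (sheet_sign s * corner (Suc j)) = cross d (sheet_sign s * corner j) + side_dir d s j"
    by (simp add: side_dir_def algebra_simps cross_simps)
  have u: "0 < u" "u < 1" using assms sd c by (auto simp: u_def exits_def)
  have sp': "side_point d s x j = sheet_sign s * (corner j + of_real u * (corner (Suc j) - corner j))"
    by (simp only: side_point_def u_def)
  then have sp: "side_point d s x j = (1 - u) *\<^sub>R (sheet_sign s * corner j) + u *\<^sub>R (sheet_sign s * corner (Suc j))"
    by (simp add: scaleR_conv_of_real algebra_simps)
  have "sheet_sign s * corner j \<noteq> sheet_sign s * corner (Suc j)" using c sd by auto
  with sp u show "side_point d s x j \<in> open_side s j" by (auto simp: open_side_def in_segment)
  have "cross d (side_point d s x j) = cross d (sheet_sign s * corner j) + u * side_dir d s j"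
    unfolding sp' by (rule cross_side)
  then show "cross d (side_point d s x j) = x" using sd by (simp add: u_def)
qed

lemma leave_eq_side_point:
  assumes "is_chord d c" "d \<noteq> 0"
  shows "leave c = side_point d (chord_sheet c) (cross d (leave c)) (exit_side c)"
proof -
  define s j where "s = chord_sheet c" and "j = exit_side c"
  have l: "leave c \<in> open_side s j" using assms by (simp add: is_chord_def s_def j_def)
  have sd: "0 < side_dir d s j" using exits_side_dir[OF chord_exits(1)[OF assms]] by (simp add: s_def j_def)
  obtain u where u: "leave c = sheet_sign s * (corner j + of_real u * (corner (Suc j) - corner j))"
    by (rule cross_open_side[OF l])
  have "cross d (leave c) = cross d (sheet_sign s * corner j) + u * side_dir d s j"
    unfolding u by (rule cross_side)
  then show ?thesis unfolding side_point_def s_def[symmetric] j_def[symmetric] using u sd by simp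
qed

lemma glue_open_side:
  assumes "p \<in> open_side s j"
  shows "glue s j p \<in> open_side (other_sheet s) j"
proof -
  from assms obtain u where ne: "sheet_sign s * corner j \<noteq> sheet_sign s * corner (Suc j)" and u: "0 < u" "u < 1"
    "p = (1 - u) *\<^sub>R (sheet_sign s * corner j) + u *\<^sub>R (sheet_sign s * corner (Suc j))"
    by (auto simp: open_side_def in_segment)
  have ss: "sheet_sign (other_sheet s) = - sheet_sign s" by (cases s) simp_all
  have "glue s j p = (1 - (1 - u)) *\<^sub>R (sheet_sign (other_sheet s) * corner j) +
      (1 - u) *\<^sub>R (sheet_sign (other_sheet s) * corner (Suc j))"
    by (simp add: glue_def u(3) ss scaleR_conv_of_real algebra_simps)
  then show ?thesis using ne u(1,2) unfolding open_side_def in_segment ss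
    by (intro conjI exI[of _ "1 - u"]) auto
qed

lemma other_sheet_other [simp]: "other_sheet (other_sheet s) = s"
  by (cases s) simp_all

lemma sheet_sign_other: "sheet_sign (other_sheet s) = - sheet_sign s"
  by (cases s) simp_all

text \<open>The entering and the leaving point have equal transversal coordinates and hence differ
  by a multiple of d. It is a positive multiple because side j is left outwards, and the open
  segment is interior because no side function vanishes at both points.\<close>

lemma chord_between:
  assumes ex: "exits d s x j" and ex': "exits d (other_sheet s) y i"
    and y: "x = y - cross d (sheet_sign (other_sheet s) * (corner i + corner (Suc i)))"
  shows "is_chord d (Chord s (glue (other_sheet s) i (side_point d (other_sheet s) y i)) (side_point d s x j) j)"
proof -
  define e l where "e = glue (other_sheet s) i (side_point d (other_sheet s) y i)" and "l = side_point d s x j"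
  have i: "i < 5" and j: "j < 5" using ex ex' by (auto simp: exits_def)
  have l: "l \<in> open_side s j" "cross d l = x" using side_point[OF ex] by (simp_all add: l_def)
  have e: "e \<in> open_side s i" "cross d e = x"
    using glue_open_side[OF side_point(1)[OF ex']] side_point(2)[OF ex'] y
    by (simp_all add: e_def glue_def cross_simps)
  have sd: "0 < side_dir d s j" "side_dir d s i < 0"
    using exits_side_dir[OF ex] exits_side_dir[OF ex'] by (simp_all add: side_dir_def sheet_sign_other cross_simps)
  then have ij: "i \<noteq> j" by auto
  have "d \<noteq> 0" using sd by (auto simp: side_dir_def cross_simps)
  have "Im (cnj d * (l - e)) = 0" using l e by (simp add: cross_def algebra_simps)
  then have "cnj d * (l - e) = of_real (Re (cnj d * (l - e)))" by (simp add: complex_eq_iff)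
  moreover define t where "t = Re (cnj d * (l - e)) / (cmod d)\<^sup>2"
  ultimately have "cnj d * (l - e) = of_real t * (d * cnj d)"
    using \<open>d \<noteq> 0\<close> by (simp add: complex_norm_square[symmetric] del: of_real_power)
  then have "cnj d * (l - e) = cnj d * (of_real t * d)" by (simp add: mult_ac)
  then have "l - e = of_real t * d" using \<open>d \<noteq> 0\<close> by (simp only: mult_cancel_left) simp
  then have le: "l = e + of_real t * d" by (simp add: algebra_simps)
  have "side_value j s l = 0" "0 < side_value j s e"
    using side_value_open_side[OF l(1) j j] side_value_open_side(2)[OF e(1) i j] ij by auto
  then have "0 < t * side_dir d s j" using side_value_move[of j s e t d] le by simp
  then have t: "0 < t" using sd by (simp add: zero_less_mult_iff)
  have "open_segment e l \<subseteq> interior (polygon s)"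
  proof
    fix z assume "z \<in> open_segment e l"
    then obtain u where u: "0 < u" "u < 1" "z = (1 - u) *\<^sub>R e + u *\<^sub>R l" by (auto simp: in_segment)
    show "z \<in> interior (polygon s)"
    proof (rule interior_polygonI)
      fix k :: nat assume k: "k < 5"
      have "0 \<le> side_value k s e" "0 \<le> side_value k s l" "0 < side_value k s e \<or> 0 < side_value k s l"
        using side_value_open_side[OF l(1) j k] side_value_open_side[OF e(1) i k] ij
        by (cases "k = j"; cases "k = i"; force)+
      then show "0 < side_value k s z" unfolding u(3) side_value_affine using u(1,2)
        by (metis add_nonneg_pos add_pos_nonneg diff_gt_0_iff_gt mult_nonneg_nonneg mult_pos_pos order_le_less)
    qed
  qed
  with j l(1) le t show ?thesis by (auto simp: is_chord_def e_def[symmetric] l_def[symmetric])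
qed

definition step_vec :: "sheet \<Rightarrow> nat \<Rightarrow> complex" where
  "step_vec s j = sheet_sign s * (corner j + corner (Suc j))"

locale directed =
  fixes d :: complex
  assumes d_nz: "d \<noteq> 0"
begin

definition offset :: "chord \<Rightarrow> real" where "offset c = cross d (enter c)"

lemma trajectory_exits:
  assumes "trajectory d c"
  shows "exits d (chord_sheet (c i)) (offset (c i)) (exit_side (c i))"
    "chord_sheet (c (i + 1)) = other_sheet (chord_sheet (c i))"
    "offset (c (i + 1)) = offset (c i) - cross d (step_vec (chord_sheet (c i)) (exit_side (c i)))"
    "leave (c i) = side_point d (chord_sheet (c i)) (offset (c i)) (exit_side (c i))"
    "enter (c (i + 1)) = glue (chord_sheet (c i)) (exit_side (c i)) (leave (c i))"
proof -
  have ch: "is_chord d (c i)" and f: "follows (c i) (c (i + 1))"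
    using assms by (auto simp: trajectory_def)
  note e = chord_exits[OF ch d_nz] leave_eq_side_point[OF ch d_nz]
  show "exits d (chord_sheet (c i)) (offset (c i)) (exit_side (c i))"
    using e by (simp add: offset_def)
  show "chord_sheet (c (i + 1)) = other_sheet (chord_sheet (c i))"
    "enter (c (i + 1)) = glue (chord_sheet (c i)) (exit_side (c i)) (leave (c i))"
    using f by (simp_all add: follows_def)
  then show "offset (c (i + 1)) = offset (c i) - cross d (step_vec (chord_sheet (c i)) (exit_side (c i)))"
    using e(2) by (simp add: offset_def glue_def step_vec_def cross_simps)
  show "leave (c i) = side_point d (chord_sheet (c i)) (offset (c i)) (exit_side (c i))"
    using e by (simp add: offset_def)
qed

definition sides :: "(int \<Rightarrow> chord) \<Rightarrow> int \<Rightarrow> nat \<Rightarrow> nat list" where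
  "sides c k n = map (\<lambda>i. exit_side (c (k + int i))) [0..<n]"

lemma sides_0 [simp]: "sides c k 0 = []" and length_sides [simp]: "length (sides c k n) = n"
  by (simp_all add: sides_def)

lemma sides_Suc: "sides c k (Suc n) = exit_side (c k) # sides c (k + 1) n"
  by (simp add: sides_def upt_conv_Cons map_Suc_upt[symmetric] del: upt_Suc map_Suc_upt)
     (simp add: algebra_simps)

lemma trajectory_run:
  assumes "trajectory d c"
  shows "run d (chord_sheet (c k)) (offset (c k)) (sides c k n)"
    "chord_sheet (c (k + int n)) = end_sheet (chord_sheet (c k)) (sides c k n)"
    "offset (c (k + int n)) = offset (c k) - cross d (hol (chord_sheet (c k)) (sides c k n))"
proof -
  have "run d (chord_sheet (c k)) (offset (c k)) (sides c k n) \<and>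
    chord_sheet (c (k + int n)) = end_sheet (chord_sheet (c k)) (sides c k n) \<and>
    offset (c (k + int n)) = offset (c k) - cross d (hol (chord_sheet (c k)) (sides c k n))"
  proof (induction n arbitrary: k)
    case (Suc n)
    note t = trajectory_exits(1-3)[OF assms, of k]
    have "k + int (Suc n) = (k + 1) + int n" by simp
    with t Suc.IH[of "k + 1"] show ?case
      by (simp add: sides_Suc step_vec_def cross_simps add.assoc)
  qed (simp add: cross_simps)
  then show "run d (chord_sheet (c k)) (offset (c k)) (sides c k n)"
    "chord_sheet (c (k + int n)) = end_sheet (chord_sheet (c k)) (sides c k n)"
    "offset (c (k + int n)) = offset (c k) - cross d (hol (chord_sheet (c k)) (sides c k n))" by blast+
qed

text \<open>Sheet and offset determine where a chord leaves, but its entering point comes from the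
  previous chord. Hence agreement is needed at two consecutive places.\<close>

lemma chord_eqI:
  assumes "trajectory d c" "trajectory d c'"
    and "chord_sheet (c i) = chord_sheet (c' j)" "offset (c i) = offset (c' j)"
    and "chord_sheet (c (i + 1)) = chord_sheet (c' (j + 1))" "offset (c (i + 1)) = offset (c' (j + 1))"
  shows "c (i + 1) = c' (j + 1)"
proof -
  have 1: "exit_side (c i) = exit_side (c' j)" "exit_side (c (i + 1)) = exit_side (c' (j + 1))"
    using trajectory_exits(1)[OF assms(1)] trajectory_exits(1)[OF assms(2)] assms(3-6) exits_unique by metis+
  then have "leave (c i) = leave (c' j)" "leave (c (i + 1)) = leave (c' (j + 1))"
    using trajectory_exits(4)[OF assms(1)] trajectory_exits(4)[OF assms(2)] assms(3-6) by metis+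
  moreover from this(1) 1 have "enter (c (i + 1)) = enter (c' (j + 1))"
    using trajectory_exits(5)[OF assms(1)] trajectory_exits(5)[OF assms(2)] assms(3) by metis
  ultimately show ?thesis using 1 assms(5) by (intro chord.expand) auto
qed

lemma periodic_mult:
  fixes f :: "int \<Rightarrow> 'a"
  assumes "\<And>i. f (i + int n) = f i"
  shows "f (i + int n * m) = f i"
proof (induction m rule: int_induct[of _ 0])
  case (step1 m)
  then show ?case using assms[of "i + int n * m"] by (simp add: algebra_simps)
next
  case (step2 m)
  then show ?case using assms[of "i + int n * (m - 1)"] by (simp add: algebra_simps)
qed simp

text \<open>Determinism propagates the coincidence at k only forwards; closedness then brings it to
  all indices.\<close>

lemma closed_periodicI:
  assumes c: "closed_trajectory d c"
    and per: "chord_sheet (c (k + int n)) = chord_sheet (c k)" "offset (c (k + int n)) = offset (c k)"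
  shows "c (i + int n) = c i"
proof -
  have t: "trajectory d c" using c by (simp add: closed_trajectory_def)
  obtain N where N: "0 < N" "\<And>i. c (i + int N) = c i" using c by (auto simp: closed_trajectory_def)
  have fwd: "chord_sheet (c (k + int m + int n)) = chord_sheet (c (k + int m)) \<and>
     offset (c (k + int m + int n)) = offset (c (k + int m))" for m
  proof (induction m)
    case (Suc m)
    have "exit_side (c (k + int m + int n)) = exit_side (c (k + int m))"
      using trajectory_exits(1)[OF t] Suc exits_unique by metis
    moreover have "k + int (Suc m) = (k + int m) + 1" "k + int (Suc m) + int n = (k + int m + int n) + 1" by simp_all
    ultimately show ?case using Suc trajectory_exits(2,3)[OF t] by metis
  qed (use per in simp)
  define M where "M = \<bar>k\<bar> + \<bar>i\<bar> + 1"
  \<comment> \<open>A multiple of the period N moves i beyond k; the shift by 1 leaves room for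
    \<open>chord_eqI\<close>.\<close>
  define j where "j = i - 1 + int N * M"
  have "M \<le> int N * M" using mult_right_mono[of 1 "int N" M] N(1) by (simp add: M_def)
  then have "k \<le> j" unfolding j_def M_def by linarith
  then obtain m where m: "j = k + int m" by (metis zle_iff_zadd)
  have "c (j + int n + 1) = c (j + 1)"
    by (rule chord_eqI[OF t t]) (use fwd[of m] fwd[of "Suc m"] m in \<open>simp_all add: algebra_simps\<close>)
  moreover have "j + int n + 1 = (i + int n) + int N * M" "j + 1 = i + int N * M" by (simp_all add: j_def)
  ultimately show ?thesis using periodic_mult[of c N, OF N(2)] by metis
qed

lemma periodic_nat_mod:
  fixes f :: "int \<Rightarrow> 'a"
  assumes "\<And>i. f (i + int n) = f i" "0 < n"
  shows "f (k + i) = f (k + int (nat (i mod int n)))"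
proof -
  have "k + i = k + int (nat (i mod int n)) + int n * (i div int n)"
    using assms(2) by simp
  then show ?thesis using periodic_mult[of f n, OF assms(1)] by metis
qed

lemma closed_word:
  assumes c: "closed_trajectory d c" and w: "w \<noteq> []"
    and run: "run d (chord_sheet (c k)) (offset (c k)) w"
    and ret: "end_sheet (chord_sheet (c k)) w = chord_sheet (c k)" "cross d (hol (chord_sheet (c k)) w) = 0"
  shows "sides c k (length w) = w" "c (i + int (length w)) = c i"
proof -
  have t: "trajectory d c" using c by (simp add: closed_trajectory_def)
  show s: "sides c k (length w) = w"
  proof -
    have "\<exists>u. sides c k (length w) = w @ u"
      by (rule run_deterministic[OF run trajectory_run(1)[OF t]]) simp
    then obtain u where u: "sides c k (length w) = w @ u" by blast
    then have "length (w @ u) = length w" by (metis length_sides)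
    then show ?thesis using u by simp
  qed
  show "c (i + int (length w)) = c i"
    by (rule closed_periodicI[OF c, of k]) (use trajectory_run(2,3)[OF t, of k "length w"] s ret in simp_all)
qed

text \<open>A straight-line homotopy joins two closed trajectories with the same itinerary.\<close>

lemma same_itinerary_imp_same_strip:
  assumes c: "closed_trajectory d c" and c': "closed_trajectory d c'"
    and it: "\<And>i. chord_sheet (c' (i + m)) = chord_sheet (c i)" "\<And>i. exit_side (c' (i + m)) = exit_side (c i)"
  shows "same_strip d c c'"
proof -
  have t: "trajectory d c" "trajectory d c'" using c c' by (auto simp: closed_trajectory_def)
  obtain N where N: "0 < N" "\<And>i. c (i + int N) = c i" using c by (auto simp: closed_trajectory_def)
  obtain N' where N': "0 < N'" "\<And>i. c' (i + int N') = c' i" using c' by (auto simp: closed_trajectory_def)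
  define mix where "mix r x y = (1 - r) *\<^sub>R x + r *\<^sub>R y" for r :: real and x y :: complex
  define F where "F r i = Chord (chord_sheet (c i)) (mix r (enter (c i)) (enter (c' (i + m))))
    (mix r (leave (c i)) (leave (c' (i + m)))) (exit_side (c i))" for r i
  have chord: "is_chord d (F r i)" if r: "r \<in> {0..1}" for r i
  proof -
    have ch: "is_chord d (c i)" "is_chord d (c' (i + m))" using t by (auto simp: trajectory_def)
    obtain a where a: "0 < a" "leave (c i) = enter (c i) + of_real a * d"
      using ch(1) by (auto simp: is_chord_def)
    obtain b where b: "0 < b" "leave (c' (i + m)) = enter (c' (i + m)) + of_real b * d"
      using ch(2) by (auto simp: is_chord_def)
    have conv: "convex (open_side s j)" "convex (interior (polygon s))" for s j
      by (simp_all add: open_side_def polygon_def convex_interior)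
    have mix_in: "mix r x y \<in> A" if "convex A" "x \<in> A" "y \<in> A" for A x y
      using that r by (auto simp: mix_def convex_alt)
    have 1: "mix r (leave (c i)) (leave (c' (i + m))) \<in> open_side (chord_sheet (c i)) (exit_side (c i))"
      using ch it[of i] by (intro mix_in conv) (auto simp: is_chord_def)
    have 2: "mix r (leave (c i)) (leave (c' (i + m))) = mix r (enter (c i)) (enter (c' (i + m))) +
        of_real ((1 - r) * a + r * b) * d"
      by (simp add: a(2) b(2) mix_def scaleR_conv_of_real algebra_simps)
    have 3: "0 < (1 - r) * a + r * b"
      using r a(1) b(1) by (cases "r = 0") (auto intro!: add_nonneg_pos)
    have 4: "open_segment (mix r (enter (c i)) (enter (c' (i + m)))) (mix r (leave (c i)) (leave (c' (i + m))))
        \<subseteq> interior (polygon (chord_sheet (c i)))"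
    proof
      fix z assume "z \<in> open_segment (mix r (enter (c i)) (enter (c' (i + m)))) (mix r (leave (c i)) (leave (c' (i + m))))"
      then obtain u where u: "0 < u" "u < 1"
        "z = mix u (mix r (enter (c i)) (enter (c' (i + m)))) (mix r (leave (c i)) (leave (c' (i + m))))"
        by (auto simp: in_segment mix_def)
      have "z = mix r (mix u (enter (c i)) (leave (c i))) (mix u (enter (c' (i + m))) (leave (c' (i + m))))"
        by (simp add: u(3) mix_def scaleR_conv_of_real algebra_simps)
      moreover have "mix u (enter (c i)) (leave (c i)) \<in> interior (polygon (chord_sheet (c i)))"
      proof -
        have "mix u (enter (c i)) (leave (c i)) \<in> open_segment (enter (c i)) (leave (c i))"
          using u(1,2) a d_nz by (auto simp: in_segment mix_def)
        then show ?thesis using ch(1) by (auto simp: is_chord_def)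
      qed
      moreover have "mix u (enter (c' (i + m))) (leave (c' (i + m))) \<in> interior (polygon (chord_sheet (c i)))"
      proof -
        have "mix u (enter (c' (i + m))) (leave (c' (i + m))) \<in> open_segment (enter (c' (i + m))) (leave (c' (i + m)))"
          using u(1,2) b d_nz by (auto simp: in_segment mix_def)
        then show ?thesis using ch(2) it[of i] by (auto simp: is_chord_def)
      qed
      ultimately show "z \<in> interior (polygon (chord_sheet (c i)))" using mix_in conv by metis
    qed
    have "exit_side (c i) < 5" using ch by (auto simp: is_chord_def)
    with 1 2 3 4 show ?thesis by (auto simp: is_chord_def F_def)
  qed
  have follow: "follows (F r i) (F r (i + 1))" for r i
  proof -
    have m: "i + 1 + m = i + m + 1" by simp
    have e: "enter (c (i + 1)) = glue (chord_sheet (c i)) (exit_side (c i)) (leave (c i))"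
      "enter (c' (i + 1 + m)) = glue (chord_sheet (c i)) (exit_side (c i)) (leave (c' (i + m)))"
      using trajectory_exits(5)[OF t(1)] trajectory_exits(5)[OF t(2), of "i + m"] it[of i]
      unfolding m by simp_all
    have "enter (F r (i + 1)) = glue (chord_sheet (F r i)) (exit_side (F r i)) (leave (F r i))"
      unfolding F_def chord.sel e by (simp add: mix_def glue_def scaleR_conv_of_real algebra_simps)
    then show ?thesis using trajectory_exits(2)[OF t(1), of i] by (simp add: follows_def F_def)
  qed
  have closed: "closed_trajectory d (F r)" if "r \<in> {0..1}" for r
  proof -
    have "c (i + int (N * N')) = c i" for i using periodic_mult[of c N, OF N(2), of i "int N'"] by simp
    moreover have "c' (i + int (N * N')) = c' i" for i
      using periodic_mult[of c' N', OF N'(2), of i "int N"] by (simp add: mult.commute)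
    moreover from this[of "i + m" for i] have "c' (i + int (N * N') + m) = c' (i + m)" for i
      by (simp add: algebra_simps)
    ultimately have "F r (i + int (N * N')) = F r i" for i by (simp add: F_def)
    then show ?thesis using chord[OF that] follow N(1) N'(1)
      by (auto simp: closed_trajectory_def trajectory_def intro!: exI[of _ "N * N'"])
  qed
  have "F 0 = c" by (rule ext, rule chord.expand) (simp add: F_def mix_def)
  moreover have "F 1 = (\<lambda>i. c' (i + m))" by (rule ext, rule chord.expand) (simp add: F_def mix_def it)
  moreover have "continuous_on {0..1} (\<lambda>r. enter (F r i))" for i
    unfolding F_def mix_def chord.sel by (intro continuous_intros)
  ultimately show ?thesis using closed unfolding same_strip_def
    by (intro exI[of _ F] exI[of _ m]) (simp add: F_def)
qed

text \<open>During the deformation the offset of each chord varies continuously and stays in the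
  open interval of its exit side. So the exit side is locally constant in the parameter, and
  constant as the parameter interval is connected.\<close>

lemma same_strip_imp_same_itinerary:
  assumes "same_strip d c c'"
  shows "closed_trajectory d c'"
    "\<exists>m. \<forall>i. chord_sheet (c' (i + m)) = chord_sheet (c i) \<and> exit_side (c' (i + m)) = exit_side (c i)"
proof -
  from assms obtain F :: "real \<Rightarrow> int \<Rightarrow> chord" and m :: int where "F 0 = c \<and> F 1 = (\<lambda>i. c' (i + m)) \<and>
     (\<forall>t\<in>{0..1}. closed_trajectory d (F t)) \<and>
     (\<forall>i. (\<forall>t\<in>{0..1}. chord_sheet (F t i) = chord_sheet (c i)) \<and>
        continuous_on {0..1} (\<lambda>t. enter (F t i)))"
    unfolding same_strip_def by blast
  then have F: "F 0 = c" "F 1 = (\<lambda>i. c' (i + m))"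
    "\<And>r. r \<in> {0..1} \<Longrightarrow> closed_trajectory d (F r)"
    "\<And>i r. r \<in> {0..1} \<Longrightarrow> chord_sheet (F r i) = chord_sheet (c i)"
    "\<And>i. continuous_on {0..1} (\<lambda>r. enter (F r i))"
    by auto
  have "closed_trajectory d (\<lambda>i. c' (i + m))" using F(2) F(3)[of 1] by simp
  then have cl: "\<And>i. is_chord d (c' (i + m))" "\<And>i. follows (c' (i + m)) (c' (i + 1 + m))"
    "\<exists>n>0. \<forall>i. c' (i + int n + m) = c' (i + m)"
    by (auto simp: closed_trajectory_def trajectory_def)
  show "closed_trajectory d c'"
    unfolding closed_trajectory_def trajectory_def
    using cl(1)[of "i - m" for i] cl(2)[of "i - m" for i] cl(3)
    by (auto simp: algebra_simps) (metis add.commute diff_add_cancel add_diff_eq)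
  have "exit_side (F 1 i) = exit_side (F 0 i)" for i
  proof -
    have tr: "trajectory d (F r)" if "r \<in> {0..1}" for r using F(3)[OF that] by (simp add: closed_trajectory_def)
    have ex: "exits d (chord_sheet (c i)) (offset (F r i)) (exit_side (F r i))" if "r \<in> {0..1}" for r
      using trajectory_exits(1)[OF tr[OF that], of i] F(4)[OF that, of i] by simp
    have cont: "continuous_on {0..1} (\<lambda>r. offset (F r i))"
      unfolding offset_def cross_def by (intro continuous_intros F(5))
    show ?thesis
    proof (rule connected_local_const[of "{0..1::real}"])
      show "connected {0..1::real}" "1 \<in> {0..1::real}" "0 \<in> {0..1::real}" by simp_all
      show "\<forall>a\<in>{0..1}. \<forall>\<^sub>F b in at a within {0..1}. exit_side (F a i) = exit_side (F b i)"
      proof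
        fix a :: real assume a: "a \<in> {0..1}"
        let ?j = "exit_side (F a i)" and ?s = "sheet_sign (chord_sheet (c i))"
        have lim: "((\<lambda>r. offset (F r i)) \<longlongrightarrow> offset (F a i)) (at a within {0..1})"
          using cont a by (auto simp: continuous_on_def)
        have "\<forall>\<^sub>F r in at a within {0..1}. cross d (?s * corner ?j) < offset (F r i)"
          "\<forall>\<^sub>F r in at a within {0..1}. offset (F r i) < cross d (?s * corner (Suc ?j))"
          using order_tendstoD[OF lim] ex[OF a] by (auto simp: exits_def)
        moreover have "\<forall>\<^sub>F r in at a within {0..1}. r \<in> {0..1}"
          by (simp add: eventually_at_filter)
        ultimately show "\<forall>\<^sub>F b in at a within {0..1}. exit_side (F a i) = exit_side (F b i)"
        proof eventually_elim
          case (elim r)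
          then have "exits d (chord_sheet (c i)) (offset (F r i)) ?j"
            using ex[OF a] by (auto simp: exits_def)
          then show ?case using ex[OF elim(3)] exits_unique by blast
        qed
      qed
    qed
  qed
  moreover have "chord_sheet (F 1 i) = chord_sheet (c i)" for i using F(4)[of 1 i] by simp
  ultimately show "\<exists>m. \<forall>i. chord_sheet (c' (i + m)) = chord_sheet (c i) \<and> exit_side (c' (i + m)) = exit_side (c i)"
    unfolding F(1,2) by blast
qed

end

section \<open>Itineraries, periods and strips\<close>

lemma cyclic_rotate: "cyclic (rotate r w) = cyclic w"
proof (cases "w = []")
  case True
  then show ?thesis by (simp add: cyclic_def)
next
  case False
  have "rotate k w \<in> range (\<lambda>k. rotate k (rotate r w))" for k
  proof -
    define n where "n = length w"
    have n: "0 < n" using False by (simp add: n_def)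
    have "rotate (k + (n - r mod n)) (rotate r w) = rotate (k + (n - r mod n) + r) w"
      by (simp add: rotate_rotate)
    also have "\<dots> = rotate ((k + (n - r mod n) + r) mod n) w" by (simp add: n_def rotate_conv_mod[symmetric])
    also have "k + (n - r mod n) + r = k + n * (1 + r div n)"
    proof -
      have "r mod n \<le> n" using n by (simp add: less_imp_le)
      moreover have "n * (r div n) + r mod n = r" by simp
      moreover have "n * (1 + r div n) = n + n * (r div n)" by simp
      ultimately show ?thesis by linarith
    qed
    also have "(k + n * (1 + r div n)) mod n = k mod n" by (rule mod_mult_self2)
    also have "rotate (k mod n) w = rotate k w" by (simp add: n_def rotate_conv_mod[symmetric])
    finally show ?thesis by (metis rangeI)
  qed
  then show ?thesis by (auto simp: cyclic_def rotate_rotate)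
qed

lemma end_sheet_parity: "end_sheet s w = (if even (length w) then s else other_sheet s)"
  by (induction w arbitrary: s) auto

text \<open>Powers of words of odd length do not count: an odd number of crossings ends in the other
  sheet and cannot be a period of a trajectory.\<close>

definition primitive_word :: "nat list \<Rightarrow> bool" where
  "primitive_word w \<longleftrightarrow> (\<forall>m v. w = concat (replicate m v) \<and> even (length v) \<longrightarrow> m \<le> 1)"

context directed
begin

definition itinerary :: "(int \<Rightarrow> chord) \<Rightarrow> int \<Rightarrow> sheet \<Rightarrow> nat list \<Rightarrow> bool" where
  "itinerary c k s w \<longleftrightarrow> chord_sheet (c k) = s \<and> sides c k (length w) = w"

lemma nth_sides: "i < n \<Longrightarrow> sides c k n ! i = exit_side (c (k + int i))"
  by (simp add: sides_def)

lemma sides_add: "sides c k (m + n) = sides c k m @ sides c (k + int m) n"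
  by (rule nth_equalityI) (auto simp: nth_sides nth_append algebra_simps)

lemma itinerary_periodic:
  assumes "closed_trajectory d c" "itinerary c k s w" "w \<noteq> []" "end_sheet s w = s" "cross d (hol s w) = 0"
  shows "c (i + int (length w)) = c i"
proof (rule closed_word(2)[OF assms(1,3)])
  have "trajectory d c" using assms(1) by (simp add: closed_trajectory_def)
  from trajectory_run(1)[OF this, of k "length w"] assms(2)
  show "run d (chord_sheet (c k)) (offset (c k)) w" by (simp add: itinerary_def)
qed (use assms in \<open>simp_all add: itinerary_def\<close>)

lemma itinerary_same:
  assumes c: "closed_trajectory d c" "itinerary c k s w" and c': "closed_trajectory d c'" "itinerary c' k' s w"
    and w: "w \<noteq> []" "end_sheet s w = s" "cross d (hol s w) = 0"
  shows "chord_sheet (c' (i + (k' - k))) = chord_sheet (c i)" "exit_side (c' (i + (k' - k))) = exit_side (c i)"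
proof -
  let ?n = "length w"
  define r where "r = nat ((i - k) mod int ?n)"
  have n: "0 < ?n" using w by simp
  then have r: "r < ?n" by (simp add: r_def nat_less_iff)
  have "c (k + (i - k)) = c (k + int r)"
    unfolding r_def by (rule periodic_nat_mod[of c ?n, OF itinerary_periodic[OF c w] n])
  moreover have "c' (k' + (i - k)) = c' (k' + int r)"
    unfolding r_def by (rule periodic_nat_mod[of c' ?n, OF itinerary_periodic[OF c' w] n])
  moreover have "k + (i - k) = i" "k' + (i - k) = i + (k' - k)" by simp_all
  ultimately have e: "c i = c (k + int r)" "c' (i + (k' - k)) = c' (k' + int r)" by metis+
  have t: "trajectory d c" "trajectory d c'" using c c' by (auto simp: closed_trajectory_def)
  have s: "sides c k ?n = w" "sides c' k' ?n = w" using c(2) c'(2) by (simp_all add: itinerary_def)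
  show "exit_side (c' (i + (k' - k))) = exit_side (c i)"
    unfolding e using nth_sides[OF r, of c k] nth_sides[OF r, of c' k'] s by simp
  have "sides c k r = sides c' k' r"
    by (rule nth_equalityI)
       (use nth_sides[of _ ?n c k] nth_sides[of _ ?n c' k'] s r in \<open>auto simp: nth_sides\<close>)
  then show "chord_sheet (c' (i + (k' - k))) = chord_sheet (c i)"
    unfolding e trajectory_run(2)[OF t(1)] trajectory_run(2)[OF t(2)] using c(2) c'(2)
    by (simp add: itinerary_def)
qed

text \<open>The word is read modulo its length. After one reading sheet and offset return to their
  initial values, so the chords given by \<open>chord_between\<close> fit together
  periodically.\<close>

lemma closed_trajectory_of_run:
  assumes run: "run d s x w" and w: "w \<noteq> []" "end_sheet s w = s" "cross d (hol s w) = 0"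
  obtains c where "closed_trajectory d c" "itinerary c 0 s w"
proof -
  let ?n = "length w"
  have n: "0 < ?n" using w by simp
  define r where "r i = nat (i mod int ?n)" for i
  define St where "St i = end_sheet s (take (r i) w)" for i
  define X where "X i = x - cross d (hol s (take (r i) w))" for i
  define J where "J i = w ! r i" for i
  have r: "r i < ?n" for i using n by (simp add: r_def nat_less_iff)
  have per: "r (i + int ?n) = r i" for i by (simp add: r_def)
  have r_Suc: "r (i + 1) = (if Suc (r i) < ?n then Suc (r i) else 0)" for i
  proof -
    have b: "0 \<le> i mod int ?n" "i mod int ?n < int ?n" using n by auto
    have "(i + 1) mod int ?n = (i mod int ?n + 1) mod int ?n" by (simp add: mod_add_left_eq)
    also have "\<dots> = (if i mod int ?n + 1 < int ?n then i mod int ?n + 1 else 0)"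
    proof (cases "i mod int ?n + 1 < int ?n")
      case True
      then show ?thesis using b(1) by (simp add: mod_pos_pos_trivial)
    next
      case False
      then have "i mod int ?n + 1 = int ?n" using b(2) by linarith
      then show ?thesis by simp
    qed
    finally show ?thesis unfolding r_def using b by auto
  qed
  have take: "St (i + 1) = end_sheet s (take (Suc (r i)) w)"
    "X (i + 1) = x - cross d (hol s (take (Suc (r i)) w))" for i
    using w r[of i] by (auto simp: St_def X_def r_Suc cross_simps not_less)
  have split: "take (Suc (r i)) w = take (r i) w @ [J i]" for i
    using r[of i] by (simp add: J_def take_Suc_conv_app_nth)
  have "run d s x (take (r i) w @ J i # drop (Suc (r i)) w)" for i
    using run r[of i] id_take_nth_drop[OF r[of i]] by (simp add: J_def)
  then have ex: "exits d (St i) (X i) (J i)" for i by (simp add: run_append St_def X_def)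
  have step: "St (i + 1) = other_sheet (St i)" "X (i + 1) = X i - cross d (step_vec (St i) (J i))" for i
    unfolding take split by (simp_all add: St_def X_def end_sheet_append hol_append step_vec_def cross_simps)
  define c where "c i = Chord (St i) (glue (St (i - 1)) (J (i - 1)) (side_point d (St (i - 1)) (X (i - 1)) (J (i - 1))))
     (side_point d (St i) (X i) (J i)) (J i)" for i
  have "is_chord d (c i)" for i
  proof -
    have S: "St (i - 1) = other_sheet (St i)" using step(1)[of "i - 1"] by simp
    show ?thesis unfolding c_def S
      by (rule chord_between) (use ex[of i] ex[of "i - 1"] step(2)[of "i - 1"] S in \<open>simp_all add: step_vec_def\<close>)
  qed
  moreover have "follows (c i) (c (i + 1))" for i
    using step(1)[of i] by (simp add: c_def follows_def)
  moreover have "c (i + int ?n) = c i" for i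
  proof -
    have "r (i + int ?n - 1) = r (i - 1)" using per[of "i - 1"] by (simp add: algebra_simps)
    then show ?thesis using per[of i] by (simp add: c_def St_def X_def J_def)
  qed
  ultimately have "closed_trajectory d c" using n by (auto simp: closed_trajectory_def trajectory_def)
  moreover have "itinerary c 0 s w"
  proof -
    have "r (int i) = i" if "i < ?n" for i using that by (simp add: r_def)
    then have "sides c 0 ?n = w" by (intro nth_equalityI) (auto simp: nth_sides c_def J_def)
    moreover have "St 0 = s" by (simp add: St_def r_def)
    ultimately show ?thesis by (simp add: itinerary_def c_def)
  qed
  ultimately show thesis by (rule that)
qed

lemma sum_chords:
  assumes "trajectory d c"
  shows "(\<Sum>i<n. leave (c (k + int i)) - enter (c (k + int i))) =
    enter (c (k + int n)) - enter (c k) + hol (chord_sheet (c k)) (sides c k n)"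
proof (induction n)
  case (Suc n)
  have "enter (c (k + int n + 1)) = leave (c (k + int n)) - step_vec (chord_sheet (c (k + int n))) (exit_side (c (k + int n)))"
    using trajectory_exits(5)[OF assms, of "k + int n"] by (simp add: glue_def step_vec_def)
  moreover have "hol (chord_sheet (c k)) (sides c k (Suc n)) = hol (chord_sheet (c k)) (sides c k n) +
     step_vec (chord_sheet (c (k + int n))) (exit_side (c (k + int n)))"
    using sides_add[of c k n 1] trajectory_run(2)[OF assms, of k n]
    by (simp add: hol_append sides_Suc step_vec_def)
  moreover have "k + int (Suc n) = k + int n + 1" by simp
  ultimately show ?case using Suc by (simp add: algebra_simps)
qed simp

text \<open>The least period divides the length of w, so w is a power of a word of even length, and
  primitivity makes the two lengths equal. As every chord is a positive multiple of d, the total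
  length can be read off from the holonomy.\<close>

lemma closed_itinerary:
  assumes c: "closed_trajectory d c" and it: "itinerary c k s w"
    and w: "w \<noteq> []" "end_sheet s w = s" "hol s w = of_real l * d" and prim: "primitive_word w"
  shows "period c = length w" "trajectory_length c = l * cmod d"
    "cyclic (crossing_word c) = cyclic (map side_label w)"
proof -
  let ?n = "length w"
  have t: "trajectory d c" using c by (simp add: closed_trajectory_def)
  have per: "c (i + int ?n) = c i" for i
    by (rule itinerary_periodic[OF c it w(1,2)]) (simp add: w(3) cross_simps)
  have n: "0 < ?n" using w by simp
  define p where "p = period c"
  have "0 < p \<and> (\<forall>i. c (i + int p) = c i)" unfolding p_def period_def
    by (rule LeastI[of _ ?n]) (use per n in auto)
  then have p: "0 < p" "c (i + int p) = c i" for i by auto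
  have min: "p \<le> m" if "0 < m" "\<And>i. c (i + int m) = c i" for m
    unfolding p_def period_def by (rule Least_le) (use that in auto)
  have "c (i + int (?n mod p)) = c i" for i
  proof -
    have "i + int (?n mod p) + int p * int (?n div p) = i + int ?n"
      by (metis add.assoc mod_mult_div_eq of_nat_add of_nat_mult)
    then show ?thesis using periodic_mult[of c p, OF p(2), of "i + int (?n mod p)" "int (?n div p)"] per[of i] by metis
  qed
  then have "?n mod p = 0" using min[of "?n mod p"] p(1) by (meson mod_less_divisor not_less neq0_conv)
  then obtain m where m: "?n = p * m" by auto
  have "sides c k (p * m) = concat (replicate m (sides c k p))" for m
  proof (induction m)
    case (Suc m)
    have "sides c (k + int p) (p * m) = sides c k (p * m)"
      by (rule nth_equalityI) (use p(2) in \<open>auto simp: nth_sides\<close>, metis add.assoc add.commute)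
    then show ?case using Suc sides_add[of c k p "p * m"] by simp
  qed simp
  then have "w = concat (replicate m (sides c k p))" using it m by (metis itinerary_def)
  moreover have "even (length (sides c k p))"
  proof -
    have "other_sheet s' \<noteq> s'" for s' by (cases s') auto
    then show ?thesis using trajectory_run(2)[OF t, of k p] p(2)[of k] end_sheet_parity by metis
  qed
  ultimately have "m \<le> 1" using prim unfolding primitive_word_def by blast
  with m n have pn: "p = ?n" by (cases m) auto
  then show "period c = length w" by (simp add: p_def)
  \<comment> \<open>The holonomy of a full period is independent of the starting chord. This matters
    because \<open>trajectory_length\<close> starts at chord 0 while the itinerary is known from
    chord k on.\<close>
  define G where "G j = hol (chord_sheet (c j)) (sides c j ?n)" for j
  have "G (j + int 1) = G j" for j
  proof -
    have "step_vec (chord_sheet (c j)) (exit_side (c j)) + hol (chord_sheet (c (j + 1))) (sides c (j + 1) ?n) =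
      hol (chord_sheet (c j)) (sides c j (Suc ?n))"
      using trajectory_exits(2)[OF t, of j] by (simp add: sides_Suc step_vec_def)
    also have "\<dots> = hol (chord_sheet (c j)) (sides c j ?n) + step_vec (chord_sheet (c (j + int ?n))) (exit_side (c (j + int ?n)))"
      using sides_add[of c j ?n 1] trajectory_run(2)[OF t, of j ?n]
      by (simp add: hol_append sides_Suc step_vec_def)
    finally show ?thesis using per[of j] by (simp add: G_def)
  qed
  from periodic_mult[of G 1, OF this, of 0 k] have "G 0 = G k" by simp
  also have "\<dots> = of_real l * d" using it w(3) by (simp add: G_def itinerary_def)
  finally have "(\<Sum>i<?n. leave (c (int i)) - enter (c (int i))) = of_real l * d"
    using sum_chords[OF t, of 0 ?n] per[of 0] by (simp add: G_def)
  then have "Re (cnj d * (\<Sum>i<?n. leave (c (int i)) - enter (c (int i)))) = l * (cmod d)\<^sup>2"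
    unfolding cmod_power2 by (simp add: power2_eq_square algebra_simps)
  then have sum: "(\<Sum>i<?n. Re (cnj d * (leave (c (int i)) - enter (c (int i))))) = l * (cmod d)\<^sup>2"
    by (simp add: sum_distrib_left)
  have "dist (enter (c i)) (leave (c i)) = Re (cnj d * (leave (c i) - enter (c i))) / cmod d" for i
  proof -
    have "is_chord d (c i)" using t by (simp add: trajectory_def)
    then obtain a where a: "0 < a" "leave (c i) = enter (c i) + of_real a * d" by (auto simp: is_chord_def)
    then have "Re (cnj d * (leave (c i) - enter (c i))) = a * (cmod d)\<^sup>2"
      unfolding cmod_power2 by (simp add: power2_eq_square algebra_simps)
    moreover have "dist (enter (c i)) (leave (c i)) = a * cmod d"
      using a by (simp add: dist_norm norm_mult)
    ultimately show ?thesis using d_nz by (simp add: power2_eq_square)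
  qed
  then have "trajectory_length c = (\<Sum>i<?n. Re (cnj d * (leave (c (int i)) - enter (c (int i)))) / cmod d)"
    unfolding trajectory_length_def p_def[symmetric] pn by simp
  also have "\<dots> = l * cmod d"
    unfolding sum_divide_distrib[symmetric] sum using d_nz by (simp add: power2_eq_square)
  finally show "trajectory_length c = l * cmod d" .
  \<comment> \<open>For the same reason the crossing word is w rotated by -k modulo its
    length.\<close>
  define q where "q = nat ((- k) mod int ?n)"
  have "sides c 0 ?n = rotate q w"
  proof (rule nth_equalityI)
    fix i assume "i < length (sides c 0 ?n)"
    then have i: "i < ?n" by simp
    have "(q + i) mod ?n < ?n" using n by simp
    then have "rotate q w ! i = exit_side (c (k + int ((q + i) mod ?n)))"
      using it i nth_sides[of "(q + i) mod ?n" ?n c k] by (simp add: nth_rotate itinerary_def)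
    also have "int ((q + i) mod ?n) = (int i - k) mod int ?n"
      using n by (simp add: q_def zmod_int mod_simps algebra_simps)
    also have "c (k + (int i - k) mod int ?n) = c (int i)"
    proof -
      have "int ?n * ((int i - k) div int ?n) + (int i - k) mod int ?n = int i - k" by (rule mult_div_mod_eq)
      then have "k + (int i - k) mod int ?n + int ?n * ((int i - k) div int ?n) = int i" by linarith
      then show ?thesis using periodic_mult[of c ?n, OF per] by metis
    qed
    finally show "sides c 0 ?n ! i = rotate q w ! i" using i by (simp add: nth_sides)
  qed simp
  moreover have "crossing_word c = map side_label (sides c 0 ?n)"
    by (simp add: crossing_word_def p_def[symmetric] pn sides_def)
  ultimately have "crossing_word c = rotate q (map side_label w)" by (simp add: rotate_map)
  then show "cyclic (crossing_word c) = cyclic (map side_label w)" by (simp add: cyclic_rotate)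
qed

text \<open>A strip consists exactly of the closed trajectories that share a periodic itinerary, so
  two itineraries that cover all closed trajectories yield all strips. The strict inequality between
  the lengths tells them apart.\<close>

theorem two_strips:
  assumes band1: "run d s1 x1 w1" "w1 \<noteq> []" "end_sheet s1 w1 = s1" "hol s1 w1 = of_real l1 * d" "primitive_word w1"
    and band2: "run d s2 x2 w2" "w2 \<noteq> []" "end_sheet s2 w2 = s2" "hol s2 w2 = of_real l2 * d" "primitive_word w2"
    and "l1 < l2"
    and cover: "\<And>c. closed_trajectory d c \<Longrightarrow> \<exists>k. itinerary c k s1 w1 \<or> itinerary c k s2 w2"
  obtains S L where "shorter_longer_strips d S L"
    "\<forall>c\<in>S. cyclic (crossing_word c) = cyclic (map side_label w1)"
    "\<forall>c\<in>L. cyclic (crossing_word c) = cyclic (map side_label w2)"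
proof -
  define band where "band s w = {c. closed_trajectory d c \<and> (\<exists>k. itinerary c k s w)}" for s w
  have strip: "{c'. same_strip d c c'} = band s w"
    if c: "c \<in> band s w" and w: "w \<noteq> []" "end_sheet s w = s" "hol s w = of_real l * d" for c s w l
  proof -
    from c obtain k where k: "closed_trajectory d c" "itinerary c k s w" by (auto simp: band_def)
    have w0: "cross d (hol s w) = 0" by (simp add: w(3) cross_simps)
    show ?thesis
    proof (intro set_eqI iffI; unfold mem_Collect_eq)
      fix c' assume "c' \<in> band s w"
      then obtain k' where k': "closed_trajectory d c'" "itinerary c' k' s w" by (auto simp: band_def)
      show "same_strip d c c'"
        using same_itinerary_imp_same_strip[OF k(1) k'(1)] itinerary_same[OF k k' w(1,2) w0] by blast
    next
      fix c' assume "same_strip d c c'"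
      from same_strip_imp_same_itinerary[OF this] obtain m where "closed_trajectory d c'"
        "\<And>i. chord_sheet (c' (i + m)) = chord_sheet (c i)" "\<And>i. exit_side (c' (i + m)) = exit_side (c i)" by blast
      moreover from this(3) have "sides c' (k + m) (length w) = sides c k (length w)"
        by (intro nth_equalityI) (auto simp: nth_sides algebra_simps, metis add.assoc add.commute)
      ultimately have "itinerary c' (k + m) s w" using k(2) by (simp add: itinerary_def)
      with \<open>closed_trajectory d c'\<close> show "c' \<in> band s w" by (auto simp: band_def)
    qed
  qed
  have ne: "band s w \<noteq> {}" if "run d s x w" "w \<noteq> []" "end_sheet s w = s" "hol s w = of_real l * d" for s x w l
    by (rule closed_trajectory_of_run[OF that(1-3)]) (use that(4) in \<open>auto simp: band_def cross_simps\<close>)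
  obtain c1 where c1: "c1 \<in> band s1 w1" using ne[OF band1(1-4)] by blast
  obtain c2 where c2: "c2 \<in> band s2 w2" using ne[OF band2(1-4)] by blast
  have closed: "closed_trajectory d c \<longleftrightarrow> c \<in> band s1 w1 \<or> c \<in> band s2 w2" for c
    using cover[of c] by (auto simp: band_def)
  have "strips d = {band s1 w1, band s2 w2}"
  proof (intro equalityI subsetI)
    fix X assume "X \<in> strips d"
    then obtain c where "X = {c'. same_strip d c c'}" "c \<in> band s1 w1 \<or> c \<in> band s2 w2"
      unfolding strips_def closed by blast
    then show "X \<in> {band s1 w1, band s2 w2}"
      using strip[OF _ band1(2-4), of c] strip[OF _ band2(2-4), of c] by auto
  next
    fix X assume "X \<in> {band s1 w1, band s2 w2}"
    then have "X = {c'. same_strip d c1 c'} \<or> X = {c'. same_strip d c2 c'}"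
      using strip[OF c1 band1(2-4)] strip[OF c2 band2(2-4)] by auto
    then show "X \<in> strips d" unfolding strips_def closed using c1 c2 by blast
  qed
  moreover have "trajectory_length c = l1 * cmod d" "cyclic (crossing_word c) = cyclic (map side_label w1)"
    if "c \<in> band s1 w1" for c
    using that closed_itinerary[OF _ _ band1(2-5)] by (auto simp: band_def)
  moreover have "trajectory_length c = l2 * cmod d" "cyclic (crossing_word c) = cyclic (map side_label w2)"
    if "c \<in> band s2 w2" for c
    using that closed_itinerary[OF _ _ band2(2-5)] by (auto simp: band_def)
  ultimately show thesis using \<open>l1 < l2\<close> d_nz
    by (intro that[of "band s1 w1" "band s2 w2"]) (auto simp: shorter_longer_strips_def)
qed

end

section \<open>The orbits of the two directions of a coding\<close>

text \<open>Infinite descent: modulo 2 the equation forces x and y to be even. This amounts to the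
  irrationality of the golden ratio.\<close>

lemma golden_form_zero:
  fixes x y :: int
  shows "x * x = y * y + x * y \<Longrightarrow> y = 0"
proof (induction "nat \<bar>y\<bar>" arbitrary: x y rule: less_induct)
  case less
  show ?case
  proof (rule ccontr)
    assume "y \<noteq> 0"
    have "even (x * x) \<longleftrightarrow> even (y * y + x * y)" by (simp only: less.prems)
    then have "even x \<and> even y" unfolding even_add even_mult_iff by argo
    then obtain a b where "x = 2 * a" "y = 2 * b" by blast
    with less.prems have "a * a = b * b + a * b" by (simp add: algebra_simps)
    moreover have "nat \<bar>b\<bar> < nat \<bar>y\<bar>" using \<open>y = 2 * b\<close> \<open>y \<noteq> 0\<close> by simp
    ultimately have "b = 0" using less.hyps by blast
    then show False using \<open>y = 2 * b\<close> \<open>y \<noteq> 0\<close> by simp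
  qed
qed

lemma zgold_unique:
  assumes "of_int x + of_int y * gold = (0::real)"
  shows "x = 0 \<and> y = 0"
proof -
  have x: "of_int x = - (of_int y * gold :: real)" using assms by simp
  have "of_int x * of_int x = (of_int y * of_int y :: real) * (gold * gold)" unfolding x by simp
  also have "\<dots> = of_int y * of_int y + of_int x * of_int y" unfolding gold_sq x by (simp add: algebra_simps)
  finally have "real_of_int (x * x) = real_of_int (y * y + x * y)" by simp
  then have "x * x = y * y + x * y" by (simp only: of_int_eq_iff)
  then have "y = 0" by (rule golden_form_zero)
  then show ?thesis using assms by simp
qed

lemma zgold_divisor:
  assumes "a \<in> zgold" "real m * a = of_int p + of_int q * gold" "coprime p q"
  shows "m \<le> 1"
proof -
  from assms(1) obtain x y where a: "a = of_int x + of_int y * gold" by (auto simp: zgold_def)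
  have "of_int (int m * x - p) + of_int (int m * y - q) * gold = (0::real)"
    using assms(2) by (simp add: a algebra_simps)
  from zgold_unique[OF this] have "int m dvd p" "int m dvd q" by (auto simp: eq_iff_diff_eq_0[symmetric])
  with assms(3) have "is_unit (int m)" by (meson coprime_common_divisor)
  then show ?thesis by simp
qed

text \<open>The square of the unit vector along v, that is, the point at infinity that represents
  its direction.\<close>

definition dir :: "complex \<Rightarrow> complex" where "dir v = v / cnj v"

context coding
begin

lemma P_nz: "P \<noteq> 0" and Q_nz: "Q \<noteq> 0"
  using independent by (auto simp: cross_simps)

lemma combination_unique:
  assumes "of_real a * P + of_real b * Q = of_real a' * P + of_real b' * Q"
  shows "a = a'"
proof -
  have "cross (of_real a * P + of_real b * Q) Q = cross (of_real a' * P + of_real b' * Q) Q"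
    using assms by simp
  then show ?thesis using independent by (simp add: cross_simps)
qed

text \<open>If w were the m-th power of an even word, then P or (1 + \<open>gold\<close>) P would be
  m times a lattice vector. The coordinates of 1 and of 1 + \<open>gold\<close> with respect to 1
  and \<open>gold\<close> are coprime, so m is at most 1.\<close>

lemma primitive:
  assumes "run d s x w" "end_sheet s w = s" "hol s w = of_real l * P" "l = 1 \<or> l = 1 + gold"
  shows "primitive_word w"
  unfolding primitive_word_def
proof (intro allI impI; elim conjE)
  fix m v assume w: "w = concat (replicate m v)" and v: "even (length v)"
  show "m \<le> 1"
  proof (cases m)
    case (Suc n)
    then have "set v \<subseteq> {..<5}" using run_sides[OF assms(1)] w by auto
    from hol_lattice[OF this v, of s] obtain a b where ab: "a \<in> zgold" "hol s v = of_real a * P + of_real b * Q"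
      by (auto simp: lattice_def)
    have "hol s (concat (replicate m v)) = of_nat m * hol s v" for m
      using v by (induction m) (auto simp: hol_append end_sheet_parity algebra_simps)
    with w assms(3) ab have "of_real (real m * a) * P + of_real (real m * b) * Q =
        of_real l * P + of_real 0 * Q"
      by (simp add: algebra_simps)
    then have "real m * a = l" by (rule combination_unique)
    with assms(4) have "real m * a = of_int 1 + of_int 0 * gold \<or> real m * a = of_int 1 + of_int 1 * gold" by auto
    then show ?thesis using zgold_divisor[OF ab(1)] by (metis coprime_1_left)
  qed simp
qed

lemma trajectory_at:
  assumes "d \<noteq> 0" and t: "trajectory d c" and run: "run d (chord_sheet (c j)) (directed.offset d (c j)) w"
  shows "directed.sides c j (length w) = w"
    "chord_sheet (c (j + int (length w))) = end_sheet (chord_sheet (c j)) w"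
    "directed.offset d (c (j + int (length w))) =
       directed.offset d (c j) - cross d (hol (chord_sheet (c j)) w)"
proof -
  interpret directed d by unfold_locales fact
  have "\<exists>u. sides c j (length w) = w @ u"
    by (rule run_deterministic[OF run trajectory_run(1)[OF t]]) simp
  then show "sides c j (length w) = w" by (metis append_Nil2 append_eq_append_conv length_sides append.right_neutral length_append add_cancel_left_right length_0_conv)
  then show "chord_sheet (c (j + int (length w))) = end_sheet (chord_sheet (c j)) w"
    "offset (c (j + int (length w))) = offset (c j) - cross d (hol (chord_sheet (c j)) w)"
    using trajectory_run(2,3)[OF t, of j "length w"] by simp_all
qed

text \<open>In direction P every line leaves its cell to the right and so stays in its row. The rows
  have circumferences 1 and 1 + \<open>gold\<close>; a trajectory found in \<open>Arm\<close> is
  followed one cell further, to the place where the word of its row begins.\<close>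

lemma strips_P:
  assumes r: "0 < r"
  obtains S L where "shorter_longer_strips (of_real r * P) S L"
    "\<forall>c\<in>S. cyclic (crossing_word c) = cyclic (map side_label (E Top))"
    "\<forall>c\<in>L. cyclic (crossing_word c) = cyclic (map side_label (E Corner @ E Arm))"
proof -
  define d where "d = of_real r * P"
  have d: "d = of_real r * P + of_real 0 * Q" by (simp add: d_def)
  have nz: "d \<noteq> 0" using r P_nz by (simp add: d_def)
  interpret directed d by unfold_locales (rule nz)
  let ?x = "\<lambda>i \<omega>. cross d (k i) - cross P Q * \<omega>"
  let ?long = "E Corner @ E Arm"
  have run1: "run d (\<sigma> i) (?x i \<omega>) (E i)" if "in_cell r 0 i \<omega>" for i \<omega>
    by (rule run_E[OF _ _ d that]) (use that r in \<open>auto simp: in_cell_def\<close>)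
  have run2: "run d (\<sigma> Corner) (?x Corner \<omega>) ?long" if "in_cell r 0 Corner \<omega>" for \<omega>
    using run_path[OF _ _ d that, of "[Rt, Rt]"] that r by (simp add: in_cell_def)
  have hol1: "hol (\<sigma> Top) (E Top) = of_real 1 * P" using hol_E[of Top] by simp
  have hol2: "hol (\<sigma> Corner) ?long = of_real (1 + gold) * P"
    using path_hol[of Corner "[Rt, Rt]"] by simp
  have sh1: "end_sheet (\<sigma> Top) (E Top) = \<sigma> Top" using sheet_E[of Top] by simp
  have sh2: "end_sheet (\<sigma> Corner) ?long = \<sigma> Corner" using path_sheet[of Corner "[Rt, Rt]"] by simp
  have ne1: "E Top \<noteq> []"
  proof
    assume "E Top = []" then show False using hol1 P_nz by simp
  qed
  have ne2: "?long \<noteq> []"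
  proof
    assume "?long = []" then have "of_real (1 + gold) * P = 0" using hol2 by simp
    then show False using P_nz gold_pos by (simp del: of_real_add)
  qed
  have h1: "hol (\<sigma> Top) (E Top) = of_real (1 / r) * d" using hol1 r by (simp add: d_def)
  have h2: "hol (\<sigma> Corner) ?long = of_real ((1 + gold) / r) * d" using hol2 r by (simp add: d_def)
  have c1: "in_cell r 0 Top (- (r * gold / 2))" and c2: "in_cell r 0 Corner (- (r / 2))"
    using r gold_pos by (auto simp: in_cell_def)
  have cover: "\<exists>j. itinerary c j (\<sigma> Top) (E Top) \<or> itinerary c j (\<sigma> Corner) ?long"
    if c: "closed_trajectory d c" for c
  proof -
    have t: "trajectory d c" using c by (simp add: closed_trajectory_def)
    note at = trajectory_at[OF nz t]
    have "alive d (chord_sheet (c 0)) (offset (c 0))"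
      unfolding alive_def
    proof
      fix n
      show "\<exists>w. length w = n \<and> run d (chord_sheet (c 0)) (offset (c 0)) w"
        by (rule exI[of _ "sides c 0 n"]) (simp add: trajectory_run(1)[OF t])
    qed
    from entry[OF less_imp_le[OF r] order_refl d this] obtain w i \<omega> where w: "in_cell r 0 i \<omega>"
      "run d (chord_sheet (c 0)) (offset (c 0)) w" "end_sheet (chord_sheet (c 0)) w = \<sigma> i"
      "offset (c 0) - cross d (hol (chord_sheet (c 0)) w) = ?x i \<omega>" by blast
    define j where "j = int (length w)"
    have j: "chord_sheet (c j) = \<sigma> i" "offset (c j) = ?x i \<omega>"
      using at[OF w(2)] w(3,4) by (simp_all add: j_def)
    have corner: "itinerary c j (\<sigma> Corner) ?long"
      if "chord_sheet (c j) = \<sigma> Corner" "offset (c j) = ?x Corner \<omega>" "in_cell r 0 Corner \<omega>" for j \<omega>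
      using at(1)[of j ?long] run2[OF that(3)] that(1,2) by (simp add: itinerary_def)
    show ?thesis
    proof (cases i)
      case Top
      then show ?thesis using at(1)[of j "E Top"] run1[OF w(1)] j by (auto simp: itinerary_def)
    next
      case Corner
      then show ?thesis using corner j w(1) by blast
    next
      case Arm
      let ?j = "j + int (length (E Arm))"
      have "run d (chord_sheet (c j)) (offset (c j)) (E Arm)" using run1[OF w(1)] j Arm by simp
      from at(2,3)[OF this] have "chord_sheet (c ?j) = \<sigma> Corner" "offset (c ?j) = ?x Corner \<omega>"
        using j Arm sheet_E[of Arm] path_step_E[OF d, of Arm \<omega>] by simp_all
      moreover have "in_cell r 0 Corner \<omega>" using w(1) Arm by (simp add: in_cell_def)
      ultimately show ?thesis using corner by blast
    qed
  qed
  show thesis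
    by (rule two_strips[OF run1[OF c1] ne1 sh1 h1 primitive[OF run1[OF c1] sh1 hol1]
          run2[OF c2] ne2 sh2 h2 primitive[OF run2[OF c2] sh2 hol2] _ cover])
       (use r gold_pos that[unfolded d_def[symmetric]] in \<open>auto simp: divide_strict_right_mono\<close>)
qed

end

text \<open>The two orientations are P and -P divided by their length. For the second one
  \<open>coding_uminus\<close> supplies a coding with the same words.\<close>

lemma coding_orbits_P:
  assumes "coding P Q \<sigma> k E F"
  shows "short_orbit (dir P) (cyclic (map side_label (E Top)))"
    "long_orbit (dir P) (cyclic (map side_label (E Corner @ E Arm)))"
proof -
  have "\<exists>S L. shorter_longer_strips d S L \<and>
    (\<forall>c\<in>S. cyclic (crossing_word c) = cyclic (map side_label (E Top))) \<and>
    (\<forall>c\<in>L. cyclic (crossing_word c) = cyclic (map side_label (E Corner @ E Arm)))" if d: "d\<^sup>2 = dir P" for d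
  proof -
    have P: "P \<noteq> 0" by (rule coding.P_nz[OF assms])
    have "(d * of_real (cmod P))\<^sup>2 = P / cnj P * (P * cnj P)"
      unfolding power_mult_distrib d dir_def
      by (simp only: complex_norm_square[symmetric] of_real_power)
    also have "\<dots> = P\<^sup>2" using P by (simp add: power2_eq_square)
    finally consider "d * of_real (cmod P) = P" | "d * of_real (cmod P) = - P"
      by (auto simp: power2_eq_iff)
    then show ?thesis
    proof cases
      case 1
      then have "d = of_real (1 / cmod P) * P" using P by (simp add: field_simps)
      then show ?thesis using coding.strips_P[OF assms, of "1 / cmod P"] P by (metis zero_less_divide_1_iff zero_less_norm_iff)
    next
      case 2
      then have "d = of_real (1 / cmod P) * (- P)" using P by (simp add: field_simps)
      then show ?thesis using coding.strips_P[OF coding_uminus[OF assms], of "1 / cmod P"] P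
        by (metis zero_less_divide_1_iff zero_less_norm_iff)
    qed
  qed
  then show "short_orbit (dir P) (cyclic (map side_label (E Top)))"
    "long_orbit (dir P) (cyclic (map side_label (E Corner @ E Arm)))"
    unfolding short_orbit_def long_orbit_def by blast+
qed

lemma coding_orbits_Q:
  assumes "coding P Q \<sigma> k E F"
  shows "short_orbit (dir Q) (cyclic (map side_label (F Arm)))"
    "long_orbit (dir Q) (cyclic (map side_label (F Corner @ F Top)))"
  using coding_orbits_P[OF coding.coding_swap[OF assms]] by simp_all

section \<open>Directions and hyperbolic reflections in linear coordinates\<close>

lemma dir_eq_iff:
  assumes "v \<noteq> 0" "w \<noteq> 0"
  shows "dir v = dir w \<longleftrightarrow> cross v w = 0"
proof -
  have "dir v = dir w \<longleftrightarrow> v * cnj w = w * cnj v"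
    using assms by (simp add: dir_def frac_eq_eq)
  also have "\<dots> \<longleftrightarrow> cross v w = 0"
    by (auto simp: complex_eq_iff cross_def algebra_simps)
  finally show ?thesis .
qed

lemma dir_scale: "r \<noteq> 0 \<Longrightarrow> dir (of_real r * v) = dir v"
  by (simp add: dir_def)

lemma dir_uminus: "dir (- v) = dir v"
  by (simp add: dir_def)

lemma cross_nz: "cross P Q \<noteq> 0 \<Longrightarrow> P \<noteq> 0 \<and> Q \<noteq> 0"
  by (auto simp: cross_simps)

lemma cross_combine:
  "cross (of_real a * P + of_real b * Q) (of_real a' * P + of_real b' * Q) =
    (a * b' - b * a') * cross P Q"
  using cross_swap[of Q P] by (simp add: cross_simps algebra_simps)

lemma combine_nz:
  assumes "cross P Q \<noteq> 0" "a \<noteq> 0 \<or> b \<noteq> 0"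
  shows "of_real a * P + of_real b * Q \<noteq> 0"
proof
  assume z: "of_real a * P + of_real b * Q = 0"
  have "b * cross P Q = 0" "a * cross P Q = 0"
    using cross_combine[of 1 P 0 Q a b] cross_combine[of a P b Q 0 1] z by (simp_all add: cross_simps)
  with assms show False by simp
qed

lemma dir_combine_eq_iff:
  assumes "cross P Q \<noteq> 0" "a \<noteq> 0 \<or> b \<noteq> 0" "a' \<noteq> 0 \<or> b' \<noteq> 0"
  shows "dir (of_real a * P + of_real b * Q) = dir (of_real a' * P + of_real b' * Q)
    \<longleftrightarrow> a * b' = b * a'"
  unfolding dir_eq_iff[OF combine_nz[OF assms(1,2)] combine_nz[OF assms(1,3)]] cross_combine
  using assms(1) by simp

text \<open>On directions, the reflection in the geodesic with ends P and Q is the linear map that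
  changes the sign of the Q-coordinate.\<close>

lemma hyp_reflection_dir:
  assumes "cross P Q \<noteq> 0" "a \<noteq> 0 \<or> b \<noteq> 0"
  shows "hyp_reflection (dir P) (dir Q) (dir (of_real a * P + of_real b * Q)) =
    dir (of_real a * P - of_real b * Q)"
proof -
  define v w where "v = of_real a * P + of_real b * Q"
    and "w = of_real a * P - of_real b * Q"
  have nz: "P \<noteq> 0" "Q \<noteq> 0" using cross_nz[OF assms(1)] by auto
  have v: "v \<noteq> 0" unfolding v_def by (rule combine_nz[OF assms])
  have w: "w \<noteq> 0" using combine_nz[OF assms(1), of a "- b"] assms(2) by (simp add: w_def)
  \<comment> \<open>Up to a constant factor this is \<open>cross P Q\<close>; it splits off from
    both the numerator and the denominator of the reflection and cancels.\<close>
  define D where "D = P * cnj Q - Q * cnj P"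
  have D: "D \<noteq> 0" using assms(1) by (auto simp: D_def cross_def complex_eq_iff algebra_simps)
  define p q where "p = cnj P" and "q = cnj Q"
  have pq: "p \<noteq> 0" "q \<noteq> 0" using nz by (simp_all add: p_def q_def)
  have cv: "cnj v = of_real a * p + of_real b * q" by (simp add: v_def p_def q_def)
  have cw: "cnj w = of_real a * p - of_real b * q" by (simp add: w_def p_def q_def)
  have Dpq: "D = P * q - Q * p" by (simp add: D_def p_def q_def)
  have num: "2 * (P / p) * (Q / q) * (cnj v / v) - (P / p + Q / q) = - (D * w) / (p * q * v)"
    using pq v by (simp add: divide_simps) (simp add: v_def w_def Dpq p_def q_def algebra_simps)
  have den: "(P / p + Q / q) * (cnj v / v) - 2 = - (D * cnj w) / (p * q * v)"
    using pq v by (simp add: divide_simps) (simp add: v_def w_def Dpq p_def q_def algebra_simps)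
  have "hyp_reflection (dir P) (dir Q) (dir v) = (- (D * w) / (p * q * v)) / (- (D * cnj w) / (p * q * v))"
    unfolding hyp_reflection_def dir_def p_def[symmetric] q_def[symmetric] num[symmetric] den[symmetric]
    by simp
  also have "\<dots> = w / cnj w" using D pq v w by simp
  finally show ?thesis by (simp add: v_def w_def dir_def)
qed

section \<open>Pentagons of the tiling and their sides\<close>

definition gphi :: real where "gphi = 1 + gold"

abbreviation \<phi> :: complex where "\<phi> \<equiv> of_real gphi"

lemma gphi: "0 < gphi" "gphi * gphi = gphi + 1" "1 < gphi" "gphi * (gphi * x) = gphi * x + x"
proof -
  show "0 < gphi" "1 < gphi" using gold_pos by (simp_all add: gphi_def)
  show g: "gphi * gphi = gphi + 1" by (simp add: gphi_def algebra_simps gold_sq)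
  show "gphi * (gphi * x) = gphi * x + x" unfolding mult.assoc[symmetric] g by (simp add: algebra_simps)
qed

lemma cphi: "of_real gphi * of_real gphi = of_real gphi + 1"
  "of_real gphi * (of_real gphi * z) = of_real gphi * z + z"
proof -
  show g: "of_real gphi * of_real gphi = of_real gphi + 1"
    by (metis gphi(2) of_real_1 of_real_add of_real_mult)
  show "of_real gphi * (of_real gphi * z) = of_real gphi * z + z"
    unfolding mult.assoc[symmetric] g by (simp add: algebra_simps)
qed

text \<open>The regular pentagon whose consecutive vertices are \<open>A\<close>, \<open>B\<close>, \<open>\<phi> B - A\<close>, \<open>B - A\<close>, \<open>B - \<phi> A\<close>
  as directions, and its mirror image in the side \<open>A B\<close>.\<close>

definition pent :: "complex \<Rightarrow> complex \<Rightarrow> complex set set" where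
  "pent A B = {{dir A, dir B}, {dir B, dir (\<phi> * B - A)}, {dir (\<phi> * B - A), dir (B - A)},
     {dir (B - A), dir (B - \<phi> * A)}, {dir (B - \<phi> * A), dir A}}"

definition child_pent :: "complex \<times> complex \<Rightarrow> complex set set" where
  "child_pent = (\<lambda>(P, Q). {{dir P, dir (\<phi> * P + Q)}, {dir (\<phi> * P + Q), dir (\<phi> * P + \<phi> * Q)},
     {dir (\<phi> * P + \<phi> * Q), dir (P + \<phi> * Q)}, {dir (P + \<phi> * Q), dir Q}, {dir P, dir Q}})"

definition children :: "complex \<times> complex \<Rightarrow> (complex \<times> complex) set" where
  "children = (\<lambda>(P, Q). {(P, \<phi> * P + Q), (\<phi> * P + Q, \<phi> * P + \<phi> * Q),
     (\<phi> * P + \<phi> * Q, P + \<phi> * Q), (P + \<phi> * Q, Q)})"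

lemma reflect_pent:
  assumes "cross A B \<noteq> 0"
  shows "reflect_polygon (dir A) (dir B) (pent A B) = child_pent (A, B)"
proof -
  note h = hyp_reflection_dir[OF assms]
  have 1: "hyp_reflection (dir A) (dir B) (dir A) = dir A" using h[of 1 0] by simp
  have 2: "hyp_reflection (dir A) (dir B) (dir B) = dir B" using h[of 0 1] by (simp add: dir_uminus)
  have 3: "hyp_reflection (dir A) (dir B) (dir (\<phi> * B - A)) = dir (A + \<phi> * B)"
    using h[of "- 1" gphi] dir_uminus[of "A + \<phi> * B"] by simp
  have 4: "hyp_reflection (dir A) (dir B) (dir (B - A)) = dir (\<phi> * A + \<phi> * B)"
    using h[of "- 1" 1] dir_uminus[of "A + B"] dir_scale[of gphi "A + B"] gphi(1) by (simp add: distrib_left)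
  have 5: "hyp_reflection (dir A) (dir B) (dir (B - \<phi> * A)) = dir (\<phi> * A + B)"
    using h[of "- gphi" 1] dir_uminus[of "\<phi> * A + B"] by simp
  show ?thesis unfolding reflect_polygon_def pent_def child_pent_def
    by (simp add: 1 2 3 4 5 insert_commute)
qed

text \<open>Each new side of the reflected pentagon, taken as the first side, generates this same
  pentagon. The reflection in a new side is therefore again an instance of
  \<open>reflect_pent\<close>.\<close>

lemma pent_children:
  assumes "(A, B) \<in> children (P, Q)"
  shows "pent A B = child_pent (P, Q)"
proof -
  define r1 r2 r3 where "r1 = \<phi> * P + Q" and "r2 = \<phi> * P + \<phi> * Q" and "r3 = P + \<phi> * Q"
  have gnz: "of_real (gphi - 1) \<noteq> 0" using gphi by simp
  have s: "dir (of_real (gphi - 1) * v) = dir v" for v by (rule dir_scale) (use gphi in simp)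
  have inv: "of_real (gphi - 1) * (of_real gphi * z) = z" for z
    by (simp add: left_diff_distrib cphi)
  have "(A, B) = (P, r1) \<or> (A, B) = (r1, r2) \<or> (A, B) = (r2, r3) \<or> (A, B) = (r3, Q)"
    using assms by (auto simp: children_def r1_def r2_def r3_def)
  then show ?thesis
  proof (elim disjE)
    assume e: "(A, B) = (P, r1)"
    have "\<phi> * B - A = r2" "B - A = of_real (gphi - 1) * r3" "B - \<phi> * A = Q"
      using e by (simp_all add: r1_def r2_def r3_def algebra_simps cphi)
    then show ?thesis using e s by (simp add: pent_def child_pent_def r1_def[symmetric] r2_def[symmetric] r3_def[symmetric] insert_commute)
  next
    assume e: "(A, B) = (r1, r2)"
    have "\<phi> * B - A = r3" "B - A = of_real (gphi - 1) * Q" "B - \<phi> * A = - P"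
      using e by (simp_all add: r1_def r2_def r3_def algebra_simps cphi)
    then show ?thesis using e s dir_uminus by (simp add: pent_def child_pent_def r1_def[symmetric] r2_def[symmetric] r3_def[symmetric] insert_commute)
  next
    assume e: "(A, B) = (r2, r3)"
    have "\<phi> * B - A = Q" "B - A = - (of_real (gphi - 1) * P)" "B - \<phi> * A = - r1"
      using e by (simp_all add: r1_def r2_def r3_def algebra_simps cphi)
    then show ?thesis using e s dir_uminus by (simp add: pent_def child_pent_def r1_def[symmetric] r2_def[symmetric] r3_def[symmetric] insert_commute)
  next
    assume e: "(A, B) = (r3, Q)"
    have "\<phi> * B - A = - P" "B - A = - (of_real (gphi - 1) * r1)" "B - \<phi> * A = - r2"
      using e by (simp_all add: r1_def r2_def r3_def algebra_simps cphi)
    then show ?thesis using e s dir_uminus by (simp add: pent_def child_pent_def r1_def[symmetric] r2_def[symmetric] r3_def[symmetric] insert_commute)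
  qed
qed

text \<open>\<open>edges k\<close> are the sides of generation \<open>k\<close> across which generation \<open>k + 1\<close> is added, oriented
  counterclockwise and represented by vectors normalised so that \<open>children\<close> applies.\<close>

fun descendants :: "nat \<Rightarrow> complex \<times> complex \<Rightarrow> (complex \<times> complex) set" where
  "descendants 0 e = {e}"
| "descendants (Suc n) e = \<Union> (children ` descendants n e)"

definition edges :: "nat \<Rightarrow> (complex \<times> complex) set" where
  "edges k = (\<Union>m<5. descendants k (base_P m, base_P (Suc m)))"

lemma edges_Suc: "edges (Suc k) = \<Union> (children ` edges k)"
  by (auto simp: edges_def)

lemma descendants_add: "descendants (m + n) e = \<Union> (descendants n ` descendants m e)"
  by (induction n) auto

lemma edges_add: "edges (m + n) = \<Union> (descendants n ` edges m)"
  by (auto simp: edges_def descendants_add)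

section \<open>Nested and disjoint arcs\<close>

text \<open>The arc cut off by an edge, as the directions of the open cone of its two vectors. The
  new vertices of all pentagons beyond the edge lie in it.\<close>

definition ideal_arc :: "complex \<times> complex \<Rightarrow> complex set" where
  "ideal_arc = (\<lambda>(P, Q). {dir (of_real s * P + of_real t * Q) | s t. 0 < s \<and> 0 < t})"

definition ends :: "complex \<times> complex \<Rightarrow> complex set" where
  "ends = (\<lambda>(P, Q). {dir P, dir Q})"

lemma child_combination:
  assumes "(A, B) \<in> children (P, Q)"
  obtains a b c e where "0 \<le> a" "0 \<le> b" "0 \<le> c" "0 \<le> e" "a * e - b * c = 1"
    "A = of_real a * P + of_real b * Q" "B = of_real c * P + of_real e * Q"
    "(a, b, c, e) \<in> {(1, 0, gphi, 1), (gphi, 1, gphi, gphi), (gphi, gphi, 1, gphi), (1, gphi, 0, 1)}"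
proof -
  have "(A, B) = (P, \<phi> * P + Q) \<or> (A, B) = (\<phi> * P + Q, \<phi> * P + \<phi> * Q) \<or>
     (A, B) = (\<phi> * P + \<phi> * Q, P + \<phi> * Q) \<or> (A, B) = (P + \<phi> * Q, Q)"
    using assms by (auto simp: children_def)
  then show thesis
  proof (elim disjE)
    assume "(A, B) = (P, \<phi> * P + Q)"
    then show thesis by (intro that[of 1 0 gphi 1]) (use gphi in auto)
  next
    assume "(A, B) = (\<phi> * P + Q, \<phi> * P + \<phi> * Q)"
    then show thesis by (intro that[of gphi 1 gphi gphi]) (use gphi in auto)
  next
    assume "(A, B) = (\<phi> * P + \<phi> * Q, P + \<phi> * Q)"
    then show thesis by (intro that[of gphi gphi 1 gphi]) (use gphi in auto)
  next
    assume "(A, B) = (P + \<phi> * Q, Q)"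
    then show thesis by (intro that[of 1 gphi 0 1]) (use gphi in auto)
  qed
qed

lemma child_cross: "(A, B) \<in> children (P, Q) \<Longrightarrow> cross A B = cross P Q"
  by (erule child_combination) (simp add: cross_combine)

lemma child_arc: "(A, B) \<in> children (P, Q) \<Longrightarrow> ideal_arc (A, B) \<subseteq> ideal_arc (P, Q)"
proof (erule child_combination)
  fix a b c e assume h: "0 \<le> a" "0 \<le> b" "0 \<le> c" "0 \<le> e" "a * e - b * c = 1"
    "A = of_real a * P + of_real b * Q" "B = of_real c * P + of_real e * Q"
    "(a, b, c, e) \<in> {(1, 0, gphi, 1), (gphi, 1, gphi, gphi), (gphi, gphi, 1, gphi), (1, gphi, 0, 1::real)}"
  show ?thesis
  proof
    fix z assume "z \<in> ideal_arc (A, B)"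
    then obtain s t where st: "0 < s" "0 < t" "z = dir (of_real s * A + of_real t * B)"
      by (auto simp: ideal_arc_def)
    have eq: "of_real s * A + of_real t * B =
      of_real (s * a + t * c) * P + of_real (s * b + t * e) * Q"
      by (simp add: h algebra_simps)
    have pos: "0 < s * a + t * c" "0 < s * b + t * e"
      using h(8) st gphi(1) by (auto simp: add_pos_pos)
    show "z \<in> ideal_arc (P, Q)" unfolding st(3) ideal_arc_def prod.case eq
      by (intro CollectI exI[of _ "s * a + t * c"] exI[of _ "s * b + t * e"] conjI refl pos)
  qed
qed

lemma child_ends: "e \<in> children (P, Q) \<Longrightarrow> ends e \<subseteq> ideal_arc (P, Q) \<union> ends (P, Q)"
proof -
  have r: "dir (of_real s * P + of_real t * Q) \<in> ideal_arc (P, Q)" if "0 < s" "0 < t" for s t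
    using that by (auto simp: ideal_arc_def)
  assume "e \<in> children (P, Q)"
  then show ?thesis
    using r[of gphi 1] r[of gphi gphi] r[of 1 gphi] gphi by (auto simp: children_def ends_def)
qed

lemma ends_not_arc: "cross P Q \<noteq> 0 \<Longrightarrow> ends (P, Q) \<inter> ideal_arc (P, Q) = {}"
proof -
  assume c: "cross P Q \<noteq> 0"
  have "dir P \<noteq> dir (of_real s * P + of_real t * Q)"
    "dir Q \<noteq> dir (of_real s * P + of_real t * Q)" if "0 < s" "0 < t" for s t
    using dir_combine_eq_iff[OF c, of 1 0 s t] dir_combine_eq_iff[OF c, of 0 1 s t] that by auto
  then show ?thesis by (auto simp: ends_def ideal_arc_def)
qed

text \<open>The quotient of the two coordinates is a coordinate on the arc. The three new vertices
  of the reflected pentagon have the ratios \<open>gphi\<close>, 1 and \<open>gphi - 1\<close>,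
  which is the inverse of \<open>gphi\<close>.\<close>

definition has_ratio :: "complex \<Rightarrow> complex \<Rightarrow> complex \<Rightarrow> real \<Rightarrow> bool" where
  "has_ratio P Q z r \<longleftrightarrow> (\<exists>y>0. 0 < r \<and> z = dir (of_real (r * y) * P + of_real y * Q))"

lemma has_ratio_unique:
  assumes "cross P Q \<noteq> 0" "has_ratio P Q z r" "has_ratio P Q z r'"
  shows "r = r'"
proof -
  obtain y y' where "0 < y" "0 < y'" "z = dir (of_real (r * y) * P + of_real y * Q)"
    "z = dir (of_real (r' * y') * P + of_real y' * Q)"
    using assms(2,3) unfolding has_ratio_def by blast
  then have "r * y * y' = y * (r' * y')" using dir_combine_eq_iff[OF assms(1), of "r * y" y "r' * y'" y'] by simp
  then show ?thesis using \<open>0 < y\<close> \<open>0 < y'\<close> by simp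
qed

lemma has_ratioI:
  "0 < x \<Longrightarrow> 0 < y \<Longrightarrow> has_ratio P Q (dir (of_real x * P + of_real y * Q)) (x / y)"
  unfolding has_ratio_def by (intro exI[of _ y]) simp

lemma child_arc_ratio:
  assumes "z \<in> ideal_arc e"
  shows "e = (P, \<phi> * P + Q) \<Longrightarrow> \<exists>r. has_ratio P Q z r \<and> gphi < r"
    "e = (\<phi> * P + Q, \<phi> * P + \<phi> * Q) \<Longrightarrow> \<exists>r. has_ratio P Q z r \<and> 1 < r \<and> r < gphi"
    "e = (\<phi> * P + \<phi> * Q, P + \<phi> * Q) \<Longrightarrow> \<exists>r. has_ratio P Q z r \<and> gphi - 1 < r \<and> r < 1"
    "e = (P + \<phi> * Q, Q) \<Longrightarrow> \<exists>r. has_ratio P Q z r \<and> r < gphi - 1"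
proof -
  obtain A B where AB: "e = (A, B)" by (cases e)
  obtain s t where st: "0 < s" "0 < t" and z: "z = dir (of_real s * A + of_real t * B)"
    using assms by (auto simp: ideal_arc_def AB)
  have ratio: "has_ratio P Q z (x / y)"
    if "A = of_real a * P + of_real b * Q" "B = of_real c * P + of_real e' * Q"
      "x = s * a + t * c" "y = s * b + t * e'" "0 < x" "0 < y" for a b c e' x y
  proof -
    have "of_real s * A + of_real t * B = of_real x * P + of_real y * Q"
      by (simp add: that(1-4) algebra_simps)
    then show ?thesis unfolding z using has_ratioI[OF that(5,6)] by simp
  qed
  have pos: "0 < s + t * gphi" "0 < s * gphi + t" "0 < s * gphi + t * gphi"
    using st gphi(1) by (auto intro!: add_pos_pos mult_pos_pos)
  have g: "s < s * gphi" "t < t * gphi" using st gphi(3) by simp_all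
  have e: "(s + t * gphi) * gphi = s * gphi + t * gphi + t" "(s * gphi + t * gphi) * (gphi - 1) = s + t"
    "(s * gphi + t) * (gphi - 1) = s + (t * gphi - t)"
    using gphi(2) by (simp_all add: algebra_simps gphi)
  have d: "l < x / y" if "0 < y" "y * l < x" for l x y :: real
    using that by (simp add: pos_less_divide_eq mult.commute[of y])
  have d': "x / y < l" if "0 < y" "x < y * l" for l x y :: real
    using that by (simp add: pos_divide_less_eq mult.commute[of y])
  show "\<exists>r. has_ratio P Q z r \<and> gphi < r" if "e = (P, \<phi> * P + Q)"
  proof (intro exI conjI)
    show "has_ratio P Q z ((s + t * gphi) / t)"
      by (rule ratio[of 1 0 gphi 1]) (use that AB st pos in simp_all)
    have "t * gphi < s + t * gphi" using st by (linarith | argo | simp)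
    then show "gphi < (s + t * gphi) / t" by (rule d[OF st(2)])
  qed
  show "\<exists>r. has_ratio P Q z r \<and> 1 < r \<and> r < gphi" if "e = (\<phi> * P + Q, \<phi> * P + \<phi> * Q)"
  proof (intro exI conjI)
    show "has_ratio P Q z ((s * gphi + t * gphi) / (s + t * gphi))"
      by (rule ratio[of gphi 1 gphi gphi]) (use that AB st pos in simp_all)
    have "(s + t * gphi) * 1 < s * gphi + t * gphi" using g by (linarith | argo | simp)
    then show "1 < (s * gphi + t * gphi) / (s + t * gphi)" by (rule d[OF pos(1)])
    have "s * gphi + t * gphi < (s + t * gphi) * gphi" unfolding e using st by (linarith | argo | simp)
    then show "(s * gphi + t * gphi) / (s + t * gphi) < gphi" by (rule d'[OF pos(1)])
  qed
  show "\<exists>r. has_ratio P Q z r \<and> gphi - 1 < r \<and> r < 1" if "e = (\<phi> * P + \<phi> * Q, P + \<phi> * Q)"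
  proof (intro exI conjI)
    show "has_ratio P Q z ((s * gphi + t) / (s * gphi + t * gphi))"
      by (rule ratio[of gphi gphi 1 gphi]) (use that AB st pos in simp_all)
    have "(s * gphi + t * gphi) * (gphi - 1) < s * gphi + t" unfolding e using g by (linarith | argo | simp)
    then show "gphi - 1 < (s * gphi + t) / (s * gphi + t * gphi)" by (rule d[OF pos(3)])
    have "s * gphi + t < (s * gphi + t * gphi) * 1" using g by (linarith | argo | simp)
    then show "(s * gphi + t) / (s * gphi + t * gphi) < 1" by (rule d'[OF pos(3)])
  qed
  show "\<exists>r. has_ratio P Q z r \<and> r < gphi - 1" if "e = (P + \<phi> * Q, Q)"
  proof (intro exI conjI)
    show "has_ratio P Q z (s / (s * gphi + t))"
      by (rule ratio[of 1 gphi 0 1]) (use that AB st pos in simp_all)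
    have "s < (s * gphi + t) * (gphi - 1)" unfolding e using g by (linarith | argo | simp)
    then show "s / (s * gphi + t) < gphi - 1" by (rule d'[OF pos(2)])
  qed
qed

text \<open>In terms of the ratio, the arcs of the four children lie in the four intervals into
  which the ratios of the new vertices divide the positive half line.\<close>

lemma siblings:
  assumes c: "cross P Q \<noteq> 0" and e: "e \<in> children (P, Q)" "e' \<in> children (P, Q)"
  shows "e \<noteq> e' \<Longrightarrow> ideal_arc e \<inter> ideal_arc e' = {}" "ends e' \<inter> ideal_arc e = {}"
proof -
  let ?r1 = "\<phi> * P + Q" and ?r2 = "\<phi> * P + \<phi> * Q" and ?r3 = "P + \<phi> * Q"
  have g: "1 < gphi" "gphi < 2" using gold_less_1 gphi by (simp_all add: gphi_def)
  have "1 / gphi = gphi - 1" using g gphi(2) by (simp add: divide_eq_eq left_diff_distrib)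
  then have r1: "has_ratio P Q (dir ?r1) gphi" and r2: "has_ratio P Q (dir ?r2) 1"
    and r3: "has_ratio P Q (dir ?r3) (gphi - 1)"
    using has_ratioI[of gphi 1 P Q] has_ratioI[of gphi gphi P Q] has_ratioI[of 1 gphi P Q] gphi(1) by simp_all
  have nP: "\<not> has_ratio P Q (dir P) r" and nQ: "\<not> has_ratio P Q (dir Q) r" for r
    using dir_combine_eq_iff[OF c, of 1 0 "r * y" y for y] dir_combine_eq_iff[OF c, of 0 1 "r * y" y for y]
    by (auto simp: has_ratio_def)
  let ?e1 = "(P, ?r1)" and ?e2 = "(?r1, ?r2)" and ?e3 = "(?r2, ?r3)" and ?e4 = "(?r3, Q)"
  have ch: "children (P, Q) = {?e1, ?e2, ?e3, ?e4}" by (simp add: children_def)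
  define J where "J z A \<longleftrightarrow> (\<exists>r\<in>A. has_ratio P Q z r)" for z A
  note ratio = child_arc_ratio[of _ _ P Q, OF _ refl]
  have a: "z \<in> ideal_arc ?e1 \<Longrightarrow> J z {gphi<..}" "z \<in> ideal_arc ?e2 \<Longrightarrow> J z {1<..<gphi}"
    "z \<in> ideal_arc ?e3 \<Longrightarrow> J z {gphi - 1<..<1}" "z \<in> ideal_arc ?e4 \<Longrightarrow> J z {..<gphi - 1}" for z
    using ratio(1)[of z] ratio(2)[of z] ratio(3)[of z] ratio(4)[of z] unfolding J_def by fastforce+
  have D: "S \<inter> S' = {}" if "\<And>z. z \<in> S \<Longrightarrow> J z A" "\<And>z. z \<in> S' \<Longrightarrow> J z A'" "A \<inter> A' = {}" for S S' A A'
    using that has_ratio_unique[OF c] unfolding J_def by (metis disjoint_iff)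
  have i: "{gphi<..} \<inter> {1<..<gphi} = {}" "{gphi<..} \<inter> {gphi - 1<..<1} = {}" "{gphi<..} \<inter> {..<gphi - 1} = {}"
    "{1<..<gphi} \<inter> {gphi - 1<..<1} = {}" "{1<..<gphi} \<inter> {..<gphi - 1} = {}" "{gphi - 1<..<1} \<inter> {..<gphi - 1} = {}"
    using g by (auto simp: disjoint_iff)
  note dis = D[OF a(1) a(2) i(1)] D[OF a(1) a(3) i(2)] D[OF a(1) a(4) i(3)] D[OF a(2) a(3) i(4)]
    D[OF a(2) a(4) i(5)] D[OF a(3) a(4) i(6)]
  show "ideal_arc e \<inter> ideal_arc e' = {}" if ne: "e \<noteq> e'"
  proof -
    have sub: "ideal_arc e \<inter> ideal_arc e' = {}" if "e = x" "e' = y" "ideal_arc x \<inter> ideal_arc y = {} \<or> ideal_arc y \<inter> ideal_arc x = {}" for x y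
      using that by blast
    have E: "x = ?e1 \<or> x = ?e2 \<or> x = ?e3 \<or> x = ?e4" if "x \<in> children (P, Q)" for x
      using that unfolding ch by (simp only: insert_iff empty_iff simp_thms)
    from E[OF e(1)] consider "e = ?e1" | "e = ?e2" | "e = ?e3" | "e = ?e4" by argo
    then show ?thesis
    proof cases
      case 1
      with ne E[OF e(2)] have "e' = ?e2 \<or> e' = ?e3 \<or> e' = ?e4" by argo
      then show ?thesis by (elim disjE) (rule sub[OF 1], assumption, simp only: dis simp_thms)+
    next
      case 2
      with ne E[OF e(2)] have "e' = ?e1 \<or> e' = ?e3 \<or> e' = ?e4" by argo
      then show ?thesis by (elim disjE) (rule sub[OF 2], assumption, simp only: dis simp_thms)+
    next
      case 3
      with ne E[OF e(2)] have "e' = ?e1 \<or> e' = ?e2 \<or> e' = ?e4" by argo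
      then show ?thesis by (elim disjE) (rule sub[OF 3], assumption, simp only: dis simp_thms)+
    next
      case 4
      with ne E[OF e(2)] have "e' = ?e1 \<or> e' = ?e2 \<or> e' = ?e3" by argo
      then show ?thesis by (elim disjE) (rule sub[OF 4], assumption, simp only: dis simp_thms)+
    qed
  qed
  have x: "x \<notin> ideal_arc e" if "has_ratio P Q x r" "r \<in> {gphi, 1, gphi - 1}" for x r
  proof
    assume "x \<in> ideal_arc e"
    with e(1) have "J x {gphi<..} \<or> J x {1<..<gphi} \<or> J x {gphi - 1<..<1} \<or> J x {..<gphi - 1}"
      unfolding ch using a by blast
    then have "r \<in> {gphi<..} \<union> {1<..<gphi} \<union> {gphi - 1<..<1} \<union> {..<gphi - 1}"
      unfolding J_def using has_ratio_unique[OF c that(1)] by blast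
    then show False using that(2) g by auto
  qed
  have n: "x \<notin> ideal_arc e" if "\<And>r. \<not> has_ratio P Q x r" for x
    using e(1) a that unfolding ch J_def by blast
  have "ends e' \<subseteq> {dir P, dir Q, dir ?r1, dir ?r2, dir ?r3}"
    using e(2) unfolding ch by (auto simp: ends_def)
  then show "ends e' \<inter> ideal_arc e = {}" using x[OF r1] x[OF r2] x[OF r3] n[OF nP] n[OF nQ] by blast
qed

lemma base_cross_Suc: "cross (base_P m) (base_P (Suc m)) = cross P0 Q0"
proof -
  have "base_P (Suc m) = cis (real m * pi / 5) * Q0"
    by (simp add: base_P_def Q0_eq cis_mult add_divide_distrib distrib_right add.commute flip: mult.assoc)
  then show ?thesis unfolding base_P_def by (simp add: cross_mult_left)
qed

lemma base_cross_pos: "0 < cross P0 Q0"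
proof -
  obtain a a1 b b1 K where "K = cross P0 Q0" "0 < K" by (rule base_facts[of 0 0]) auto
  then show ?thesis by simp
qed

lemma base_cross: "cross (base_P m) (base_P n) = (Re P0)\<^sup>2 * sin ((real n - real m) * pi / 5)"
proof -
  have "base_P k = of_real (Re P0) * cis (real k * pi / 5)" for k
    using P0_real by (simp add: base_P_def mult.commute)
  then have "cross (base_P m) (base_P n) = Re P0 * (Re P0 * cross (cis (real m * pi / 5)) (cis (real n * pi / 5)))"
    by (simp only: cross_simps)
  also have "\<dots> = (Re P0)\<^sup>2 * sin ((real n - real m) * pi / 5)"
    by (simp add: cross_cis power2_eq_square left_diff_distrib diff_divide_distrib)
  finally show ?thesis .
qed

lemma P0_nz: "Re P0 \<noteq> 0"
proof
  assume "Re P0 = 0"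
  then have "P0 = 0" using P0_real by simp
  then show False using base_cross_pos by (simp add: cross_simps)
qed

text \<open>The determinant is a nonnegative combination of sines of angles between 0 and pi, and a
  term with positive sine has a positive coefficient.\<close>

lemma base_cones:
  assumes mn: "m < n" "n < 5" and st: "0 \<le> s" "0 \<le> t" "0 \<le> s'" "0 \<le> t'" "0 < s \<or> 0 < t" "0 < s' \<or> 0 < t'"
    "0 < s \<and> 0 < t \<or> 0 < s' \<and> 0 < t'"
  shows "cross (of_real s * base_P m + of_real t * base_P (Suc m))
    (of_real s' * base_P n + of_real t' * base_P (Suc n)) \<noteq> 0"
proof -
  define S where "S j = sin (real j * pi / 5)" for j :: nat
  have S0: "0 \<le> S j" if "j \<le> 5" for j unfolding S_def by (rule sin_ge_zero) (use that in auto)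
  have S1: "0 < S j" if "1 \<le> j" "j \<le> 4" for j unfolding S_def by (rule sin_gt_zero) (use that in auto)
  define k where "k = n - m"
  have k: "1 \<le> k" "k \<le> 4" using mn by (auto simp: k_def)
  have r: "real n - real m = real k" "real (Suc n) - real m = real (k + 1)" "real n - real (Suc m) = real (k - 1)"
    "real (Suc n) - real (Suc m) = real k" using mn by (simp_all add: k_def of_nat_diff)
  have "cross (of_real s * base_P m + of_real t * base_P (Suc m))
    (of_real s' * base_P n + of_real t' * base_P (Suc n)) =
    (Re P0)\<^sup>2 * (s * s' * S k + s * t' * S (k + 1) + t * s' * S (k - 1) + t * t' * S k)"
    by (simp only: cross_simps base_cross r S_def[symmetric]) (simp add: algebra_simps)
  moreover have "0 < s * s' * S k + s * t' * S (k + 1) + t * s' * S (k - 1) + t * t' * S k"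
  proof -
    have "0 \<le> s * t' * S (k + 1)" "0 \<le> t * s' * S (k - 1)" "0 \<le> s * s' * S k" "0 \<le> t * t' * S k"
      using st S0[of "k + 1"] S0[of "k - 1"] S0[of k] k by simp_all
    moreover have "0 < s * s' * S k \<or> 0 < t * t' * S k"
      using st(5-7) S1[OF k] by auto
    ultimately show ?thesis by linarith
  qed
  ultimately show ?thesis using P0_nz by simp
qed

lemma base_disjoint:
  assumes "m < 5" "n < 5" "m \<noteq> n"
  shows "ideal_arc (base_P m, base_P (Suc m)) \<inter> ideal_arc (base_P n, base_P (Suc n)) = {}"
    "ends (base_P n, base_P (Suc n)) \<inter> ideal_arc (base_P m, base_P (Suc m)) = {}"
proof -
  have c: "cross (base_P m) (base_P (Suc m)) \<noteq> 0" for m using base_cross_Suc base_cross_pos by simp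
  let ?v = "\<lambda>m s t. of_real s * base_P m + of_real t * base_P (Suc m)"
  have ne: "dir (?v m s t) \<noteq> dir (?v n s' t')"
    if "0 < s" "0 < t" "0 \<le> s'" "0 \<le> t'" "0 < s' \<or> 0 < t'" for s t s' t'
  proof -
    have v: "?v m s t \<noteq> 0" "?v n s' t' \<noteq> 0" using combine_nz[OF c] that by auto
    have "cross (?v m s t) (?v n s' t') \<noteq> 0"
    proof (cases "m < n")
      case True
      then show ?thesis using base_cones[of m n s t s' t'] assms that by auto
    next
      case False
      then have "cross (?v n s' t') (?v m s t) \<noteq> 0" using base_cones[of n m s' t' s t] assms that by auto
      then show ?thesis using cross_swap[of "?v n s' t'" "?v m s t"] by simp
    qed
    then show ?thesis using dir_eq_iff[OF v] by simp
  qed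
  show "ideal_arc (base_P m, base_P (Suc m)) \<inter> ideal_arc (base_P n, base_P (Suc n)) = {}"
    using ne unfolding ideal_arc_def prod.case by fastforce
  show "ends (base_P n, base_P (Suc n)) \<inter> ideal_arc (base_P m, base_P (Suc m)) = {}"
    using ne[of _ _ 1 0] ne[of _ _ 0 1] unfolding ideal_arc_def ends_def prod.case by fastforce
qed

lemma edges_0: "edges 0 = (\<lambda>m. (base_P m, base_P (Suc m))) ` {..<5}"
  by (auto simp: edges_def)

lemma descendant_properties:
  assumes "f \<in> descendants n e"
  shows "ideal_arc f \<subseteq> ideal_arc e" "ends f \<subseteq> ideal_arc e \<union> ends e" "case_prod cross f = case_prod cross e"
proof -
  have "ideal_arc f \<subseteq> ideal_arc e \<and> ends f \<subseteq> ideal_arc e \<union> ends e \<and> case_prod cross f = case_prod cross e"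
    using assms
  proof (induction n arbitrary: f)
    case (Suc n)
    then obtain h where h: "h \<in> descendants n e" "f \<in> children h" by auto
    obtain A B P Q where "f = (A, B)" "h = (P, Q)" by (cases f, cases h) auto
    then show ?case using Suc.IH[OF h(1)] h(2) child_arc[of A B P Q] child_ends[of f P Q] child_cross[of A B P Q]
      by auto
  qed simp
  then show "ideal_arc f \<subseteq> ideal_arc e" "ends f \<subseteq> ideal_arc e \<union> ends e" "case_prod cross f = case_prod cross e" by auto
qed

lemma edges_cross: "e \<in> edges k \<Longrightarrow> case_prod cross e = cross P0 Q0"
  unfolding edges_def using descendant_properties(3) base_cross_Suc by fastforce

lemma edges_cross_pos: "(P, Q) \<in> edges k \<Longrightarrow> 0 < cross P Q"
  using edges_cross base_cross_pos by fastforce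

lemma edges_disjoint:
  assumes "e \<in> edges k" "e' \<in> edges k"
  shows "e \<noteq> e' \<Longrightarrow> ideal_arc e \<inter> ideal_arc e' = {}" "ends e' \<inter> ideal_arc e = {}"
proof -
  have "(e \<noteq> e' \<longrightarrow> ideal_arc e \<inter> ideal_arc e' = {}) \<and> ends e' \<inter> ideal_arc e = {}"
    using assms
  proof (induction k arbitrary: e e')
    case 0
    then obtain m n where mn: "m < 5" "n < 5" "e = (base_P m, base_P (Suc m))" "e' = (base_P n, base_P (Suc n))"
      by (auto simp: edges_0)
    show ?case
    proof (cases "m = n")
      case True
      then show ?thesis using mn ends_not_arc[of "base_P m" "base_P (Suc m)"] base_cross_Suc[of m] base_cross_pos by simp
    next
      case False
      then show ?thesis using mn base_disjoint by simp
    qed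
  next
    case (Suc k)
    then obtain p p' where p: "p \<in> edges k" "e \<in> children p" "p' \<in> edges k" "e' \<in> children p'"
      by (auto simp: edges_Suc)
    obtain P Q P' Q' where PQ: "p = (P, Q)" "p' = (P', Q')" by (cases p, cases p') auto
    show ?case
    proof (cases "p = p'")
      case True
      then show ?thesis using siblings[of P Q e e'] edges_cross_pos[of P Q k] p PQ by auto
    next
      case False
      have "ideal_arc e \<subseteq> ideal_arc p" "ideal_arc e' \<subseteq> ideal_arc p'" "ends e' \<subseteq> ideal_arc p' \<union> ends p'"
        using child_arc child_ends p(2,4) PQ by (metis prod.collapse)+
      then show ?thesis using Suc.IH[OF p(1,3)] False by blast
    qed
  qed
  then show "e \<noteq> e' \<Longrightarrow> ideal_arc e \<inter> ideal_arc e' = {}" "ends e' \<inter> ideal_arc e = {}" by auto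
qed

lemma edges_ancestor:
  assumes "e \<in> edges k" "j \<le> k"
  obtains e0 where "e0 \<in> edges j" "e \<in> descendants (k - j) e0"
  using assms edges_add[of j "k - j"] by auto

text \<open>The arc of e lies in the arc of its ancestor at level j, which contains no end of an
  edge of that level.\<close>

lemma lower_ends:
  assumes "e \<in> edges k" "e' \<in> edges j" "j \<le> k"
  shows "ends e' \<inter> ideal_arc e = {}"
proof -
  obtain e0 where "e0 \<in> edges j" "e \<in> descendants (k - j) e0" by (rule edges_ancestor[OF assms(1,3)])
  then show ?thesis using edges_disjoint(2)[OF _ assms(2)] descendant_properties(1) by blast
qed

section \<open>The generations of the tiling\<close>

lemma base_P_rec: "base_P (Suc (Suc m)) = \<phi> * base_P (Suc m) - base_P m"
proof -
  have "cis (pi / 5) * Q0 = \<phi> * Q0 - P0"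
  proof -
    have "cis (pi / 5) * Q0 = corner 3 - corner 0"
      using rotate_corner[of 2] rotate_corner[of 0] corner_5[of 0] by (simp add: Q0_def right_diff_distrib)
    moreover have "\<phi> * Q0 - P0 = corner 3 - corner 0"
      by (simp add: Q0_def P0_def gphi_def corner_values algebra_simps cgold_mult cgold_sq)
    ultimately show ?thesis by simp
  qed
  moreover have "base_P (Suc m) = cis (real m * pi / 5) * Q0"
    by (simp add: base_P_def Q0_eq cis_mult add_divide_distrib distrib_right add.commute flip: mult.assoc)
  moreover have "base_P (Suc (Suc m)) = cis (real m * pi / 5) * (cis (pi / 5) * Q0)"
    by (simp add: base_P_def Q0_eq cis_mult add_divide_distrib distrib_right add.commute flip: mult.assoc)
  moreover have "base_P m = cis (real m * pi / 5) * P0" by (simp add: base_P_def)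
  ultimately show ?thesis by (simp only:) (simp add: algebra_simps)
qed

lemma dir_base_P: "dir (base_P m) = cis (2 * (real m * pi / 5))"
proof -
  define c where "c = cis (real m * pi / 5)"
  have "base_P m = of_real (Re P0) * c" using P0_real by (simp add: base_P_def c_def mult.commute)
  then have "dir (base_P m) = dir c" using dir_scale[OF P0_nz] by simp
  also have "\<dots> = c * c" by (simp add: dir_def c_def cis_cnj cis_divide cis_mult)
  finally show ?thesis by (simp add: c_def cis_mult mult.commute)
qed

lemma side_direction_base: "side_direction (m + 3) = dir (base_P m)"
  by (simp add: side_direction_def dir_base_P)

lemma side_direction_5: "side_direction (m + 5) = side_direction m"
proof -
  have "2 * ((real (m + 5) - 3) * pi / 5) = 2 * ((real m - 3) * pi / 5) + 2 * pi" by (simp add: field_simps)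
  then show ?thesis unfolding side_direction_def by (simp only: cis_mult[symmetric] cis_2pi mult_1_right)
qed

lemma ends_base_5: "ends (base_P (m + 5), base_P (Suc (m + 5))) = ends (base_P m, base_P (Suc m))"
  using side_direction_5[of "m + 3"] side_direction_5[of "Suc m + 3"]
  by (simp add: ends_def side_direction_base[symmetric] add.commute add.left_commute)

lemma base_pentagon_eq: "base_pentagon = ends ` edges 0"
proof -
  let ?f = "\<lambda>k. {side_direction k, side_direction (Suc k)}"
  let ?e = "\<lambda>m. ends (base_P m, base_P (Suc m))"
  have f: "?f (m + 3) = ?e m" for m
    using side_direction_base[of m] side_direction_base[of "Suc m"] by (simp add: ends_def)
  have f5: "?f k = ?f (k + 5)" for k
    using side_direction_5[of k] side_direction_5[of "Suc k"] by simp
  have "?f 1 = ?e 3" "?f 2 = ?e 4" "?f 3 = ?e 0" "?f 4 = ?e 1" "?f 5 = ?e 2"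
    using f5[of 1] f5[of 2] f[of 3] f[of 4] f[of 0] f[of 1] f[of 2] by simp_all
  moreover have "base_pentagon = ?f ` {1, 2, 3, 4, 5}"
  proof -
    have "{1..5::nat} = {1, 2, 3, 4, 5}" by auto
    then show ?thesis unfolding base_pentagon_def by blast
  qed
  moreover have "ends ` edges 0 = ?e ` {0, 1, 2, 3, 4}"
  proof -
    have "{..<5::nat} = {0, 1, 2, 3, 4}" by auto
    then show ?thesis unfolding edges_0 image_image by simp
  qed
  moreover have "{c, d, x, y, z} = {x, y, z, c, d}" for c d x y z :: "complex set" by blast
  ultimately show ?thesis by (simp only: image_insert image_empty)
qed

text \<open>By the recurrence \<open>base_P_rec\<close>, the vectors in \<open>pent A B\<close> are,
  up to scalars, the successive rotations of A by pi / 5; the fifth one is -A, which has the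
  direction of A again.\<close>

lemma base_pent:
  assumes "(A, B) \<in> edges 0"
  shows "pent A B = base_pentagon"
proof -
  define E where "E n = ends (base_P n, base_P (n + 1))" for n
  obtain m where m: "m < 5" "A = base_P m" "B = base_P (m + 1)" using assms by (auto simp: edges_0)
  have s: "dir (\<phi> * v) = dir v" for v by (rule dir_scale) (use gphi in simp)
  have rec: "base_P (n + 2) = \<phi> * base_P (n + 1) - base_P n" for n using base_P_rec[of n] by simp
  have 2: "base_P (m + 2) = \<phi> * B - A" using rec[of m] m by simp
  have "base_P (m + 3) = \<phi> * base_P (m + 2) - base_P (m + 1)" using rec[of "m + 1"] by (simp add: numeral_eq_Suc)
  then have 3: "base_P (m + 3) = \<phi> * (B - A)" unfolding 2 m(3)[symmetric] by (simp add: algebra_simps cphi)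
  have "base_P (m + 4) = \<phi> * base_P (m + 3) - base_P (m + 2)" using rec[of "m + 2"] by (simp add: numeral_eq_Suc)
  then have 4: "base_P (m + 4) = B - \<phi> * A" unfolding 2 3 by (simp add: algebra_simps cphi)
  have "base_P (m + 5) = \<phi> * base_P (m + 4) - base_P (m + 3)" using rec[of "m + 3"] by (simp add: numeral_eq_Suc)
  then have 5: "base_P (m + 5) = - A" unfolding 3 4 by (simp add: algebra_simps cphi)
  have n: "m + 1 + 1 = m + 2" "m + 2 + 1 = m + 3" "m + 3 + 1 = m + 4" "m + 4 + 1 = m + 5" by simp_all
  have pent: "pent A B = {E m, E (m + 1), E (m + 2), E (m + 3), E (m + 4)}"
    unfolding pent_def E_def ends_def prod.case n 2 3 4 5 m(2,3)[symmetric] s dir_uminus by (rule refl)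
  have E5: "E (n + 5) = E n" for n using ends_base_5[of n] by (simp add: E_def)
  have base: "base_pentagon = {E 0, E 1, E 2, E 3, E 4}"
  proof -
    have "{..<5::nat} = {0, 1, 2, 3, 4}" by auto
    then have "base_pentagon = E ` {0, 1, 2, 3, 4}"
      unfolding base_pentagon_eq edges_0 image_image E_def by simp
    then show ?thesis by simp
  qed
  from m(1) consider "m = 0" | "m = 1" | "m = 2" | "m = 3" | "m = 4" by linarith
  then show ?thesis
  proof cases
    case 1
    then show ?thesis unfolding pent base by (simp add: numeral_2_eq_2)
  next
    case 2
    have "pent A B = {E 1, E 2, E 3, E 4, E (0 + 5)}" unfolding pent 2 by (simp add: numeral_eq_Suc)
    then show ?thesis unfolding E5 base by blast
  next
    case 3
    have "pent A B = {E 2, E 3, E 4, E (0 + 5), E (1 + 5)}" unfolding pent 3 by simp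
    then show ?thesis unfolding E5 base by blast
  next
    case 4
    have "pent A B = {E 3, E 4, E (0 + 5), E (1 + 5), E (2 + 5)}" unfolding pent 4 by simp
    then show ?thesis unfolding E5 base by blast
  next
    case 5
    have "pent A B = {E 4, E (0 + 5), E (1 + 5), E (2 + 5), E (3 + 5)}" unfolding pent 5 by simp
    then show ?thesis unfolding E5 base by blast
  qed
qed

lemma child_pent_eq: "child_pent e = ends ` children e \<union> {ends e}"
  by (cases e) (auto simp: child_pent_def children_def ends_def)

lemma Union_child_pent: "\<Union> (child_pent e) = \<Union> (ends ` children e)"
  by (cases e) (auto simp: child_pent_def children_def ends_def)

lemma hyp_reflection_sym: "hyp_reflection p q = hyp_reflection q p"
  by (rule ext) (simp add: hyp_reflection_def add.commute mult.commute mult.left_commute)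

lemma reflect_ends:
  assumes "{p, q} = ends (A, B)" "cross A B \<noteq> 0"
  shows "reflect_polygon p q (pent A B) = child_pent (A, B)"
proof -
  have "p = dir A \<and> q = dir B \<or> p = dir B \<and> q = dir A"
    using assms(1) by (auto simp: ends_def doubleton_eq_iff)
  then show ?thesis using reflect_pent[OF assms(2)] hyp_reflection_sym[of "dir A" "dir B"]
    by (auto simp: reflect_polygon_def)
qed

lemma child_end_in_arc: "f \<in> children e \<Longrightarrow> ends f \<inter> ideal_arc e \<noteq> {}"
proof -
  obtain P Q where e: "e = (P, Q)" by (cases e)
  have r: "dir (of_real s * P + of_real t * Q) \<in> ideal_arc (P, Q)" if "0 < s" "0 < t" for s t
    using that by (auto simp: ideal_arc_def)
  assume "f \<in> children e"
  then show ?thesis using r[of gphi 1] r[of gphi gphi] r[of 1 gphi] gphi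
    by (auto simp: e children_def ends_def)
qed

text \<open>The linear recursion of edges reproduces the reflections. The two further statements are
  carried through the induction to recognise the sides shared with the previous generation: its
  vertices are ends of edges of level k, and those edges are sides of it.\<close>

lemma generation_Suc: "generation (Suc k) = child_pent ` edges k \<and>
    (\<forall>R\<in>generation k. \<Union> R \<subseteq> \<Union> (ends ` edges k)) \<and> ends ` edges k \<subseteq> \<Union> (generation k)"
proof (induction k)
  case 0
  have "generation (Suc 0) = child_pent ` edges 0"
  proof (intro equalityI subsetI)
    fix R assume "R \<in> generation (Suc 0)"
    then obtain p q where pq: "R = reflect_polygon p q base_pentagon" "{p, q} \<in> base_pentagon" by auto
    then obtain e where e: "e \<in> edges 0" "{p, q} = ends e" unfolding base_pentagon_eq by blast
    obtain A B where AB: "e = (A, B)" by (cases e)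
    have "cross A B \<noteq> 0" using edges_cross_pos[of A B 0] e AB by simp
    then have "R = child_pent e"
      using pq(1) reflect_ends[of p q A B] base_pent[of A B] e AB by simp
    then show "R \<in> child_pent ` edges 0" using e(1) by blast
  next
    fix R assume "R \<in> child_pent ` edges 0"
    then obtain e where e: "e \<in> edges 0" "R = child_pent e" by blast
    obtain A B where AB: "e = (A, B)" by (cases e)
    have "cross A B \<noteq> 0" using edges_cross_pos[of A B 0] e AB by simp
    then have R: "R = reflect_polygon (dir A) (dir B) base_pentagon"
      using reflect_pent[of A B] base_pent[of A B] e AB by simp
    have "ends e = {dir A, dir B}" by (simp add: ends_def AB)
    then have "{dir A, dir B} \<in> base_pentagon" unfolding base_pentagon_eq using e(1) by blast
    with R have "\<exists>p q. R = reflect_polygon p q base_pentagon \<and> {p, q} \<in> base_pentagon" by blast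
    then show "R \<in> generation (Suc 0)" by auto
  qed
  then show ?case using base_pentagon_eq by auto
next
  case (Suc k)
  have g: "generation (Suc k) = child_pent ` edges k" using Suc by blast
  have V: "\<Union> R \<subseteq> \<Union> (ends ` edges k)" if "R \<in> generation k" for R using Suc that by blast
  have E: "ends e \<in> \<Union> (generation k)" if "e \<in> edges k" for e using Suc that by blast
  have refl: "reflect_polygon p q (child_pent e) = child_pent (A, B)"
    if "e \<in> edges k" "(A, B) \<in> children e" "{p, q} = ends (A, B)" for e A B p q
  proof -
    obtain P Q where e: "e = (P, Q)" by (cases e)
    have "(A, B) \<in> edges (Suc k)" using that by (auto simp: edges_Suc)
    then have "cross A B \<noteq> 0" using edges_cross_pos[of A B "Suc k"] by simp
    then show ?thesis using reflect_ends[OF that(3)] pent_children[of A B P Q] that(2) e by simp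
  qed
  have "generation (Suc (Suc k)) = child_pent ` edges (Suc k)"
  proof (intro equalityI subsetI)
    fix R assume "R \<in> generation (Suc (Suc k))"
    then obtain p q X where X: "R = reflect_polygon p q X" "X \<in> generation (Suc k)" "{p, q} \<in> X"
      "{p, q} \<notin> \<Union> (generation k)" unfolding generation.simps(3) by blast
    from X(2) obtain e where "X = child_pent e" "e \<in> edges k" unfolding g by (rule imageE)
    with X have h: "R = reflect_polygon p q (child_pent e)" "e \<in> edges k" "{p, q} \<in> child_pent e"
      "{p, q} \<notin> \<Union> (generation k)" by simp_all
    then have "{p, q} \<in> ends ` children e" using E[OF h(2)] by (auto simp: child_pent_eq)
    then obtain f where f: "f \<in> children e" "{p, q} = ends f" by blast
    obtain A B where AB: "f = (A, B)" by (cases f)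
    have "R = child_pent f" using refl[OF h(2)] f h(1) AB by simp
    moreover have "f \<in> edges (Suc k)" using f(1) h(2) by (auto simp: edges_Suc)
    ultimately show "R \<in> child_pent ` edges (Suc k)" by blast
  next
    fix R assume "R \<in> child_pent ` edges (Suc k)"
    then obtain f e where f: "R = child_pent f" "e \<in> edges k" "f \<in> children e"
      unfolding edges_Suc by blast
    obtain A B where "f = (A, B)" by (cases f)
    with f have h: "R = child_pent (A, B)" "e \<in> edges k" "(A, B) \<in> children e" by simp_all
    have AB: "{dir A, dir B} = ends (A, B)" by (simp add: ends_def)
    \<comment> \<open>A new side has an end inside the arc of e, where generation k has no
      vertex.\<close>
    have "{dir A, dir B} \<notin> \<Union> (generation k)"
    proof
      assume "{dir A, dir B} \<in> \<Union> (generation k)"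
      then have "ends (A, B) \<subseteq> \<Union> (ends ` edges k)" using V AB by blast
      moreover obtain z where z: "z \<in> ends (A, B)" "z \<in> ideal_arc e" using child_end_in_arc[OF h(3)] by blast
      ultimately obtain e' where "e' \<in> edges k" "z \<in> ends e'" by blast
      then show False using z(2) edges_disjoint(2)[OF h(2)] by blast
    qed
    moreover have "{dir A, dir B} \<in> child_pent e" unfolding AB child_pent_eq using h(3) by blast
    moreover have "R = reflect_polygon (dir A) (dir B) (child_pent e)" using refl[OF h(2,3) AB] h(1) by simp
    moreover have "child_pent e \<in> generation (Suc k)" using g h(2) by blast
    ultimately show "R \<in> generation (Suc (Suc k))" unfolding generation.simps(3) by blast
  qed
  moreover have "\<Union> R \<subseteq> \<Union> (ends ` edges (Suc k))" if RR: "R \<in> generation (Suc k)" for R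
  proof -
    from RR obtain e where e: "R = child_pent e" "e \<in> edges k" unfolding g by (rule imageE)
    have "children e \<subseteq> edges (Suc k)" using e(2) by (auto simp: edges_Suc)
    then show ?thesis unfolding e(1) Union_child_pent by blast
  qed
  moreover have "ends ` edges (Suc k) \<subseteq> \<Union> (generation (Suc k))"
    unfolding g by (auto simp: edges_Suc child_pent_eq)
  ultimately show ?case by blast
qed

lemma joined_iff: "joined p q \<longleftrightarrow> (\<exists>i. \<exists>e\<in>edges i. {p, q} = ends e)"
proof
  assume "joined p q"
  then obtain k where k: "{p, q} \<in> \<Union> (generation k)" by (auto simp: joined_def)
  show "\<exists>i. \<exists>e\<in>edges i. {p, q} = ends e"
  proof (cases k)
    case 0
    then show ?thesis using k by (auto simp: base_pentagon_eq)
  next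
    case (Suc j)
    then obtain e where "e \<in> edges j" "{p, q} \<in> child_pent e" using k generation_Suc[of j] by auto
    moreover have "children e \<subseteq> edges (Suc j)" using \<open>e \<in> edges j\<close> by (auto simp: edges_Suc)
    ultimately show ?thesis unfolding child_pent_eq by blast
  qed
next
  assume "\<exists>i. \<exists>e\<in>edges i. {p, q} = ends e"
  then obtain i e where e: "e \<in> edges i" "{p, q} = ends e" by blast
  then have "{p, q} \<in> \<Union> (generation i)" using generation_Suc[of i] by blast
  then show "joined p q" unfolding joined_def by (rule exI)
qed

text \<open>The ends of the mirror edge already belong to the previous generation, so at its first
  appearance \<beta> is one of the three new vertices.\<close>

lemma first_pentagon_cases:
  assumes "first_pentagon \<beta> R" "\<beta> \<notin> \<Union> base_pentagon"
  obtains k P Q where "(P, Q) \<in> edges k" "R = child_pent (P, Q)"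
    "\<beta> = dir (\<phi> * P + Q) \<or> \<beta> = dir (\<phi> * P + \<phi> * Q) \<or> \<beta> = dir (P + \<phi> * Q)"
proof -
  obtain k where k: "R \<in> generation k" "\<beta> \<in> \<Union> R" "\<And>j R. j < k \<Longrightarrow> R \<in> generation j \<Longrightarrow> \<beta> \<notin> \<Union> R"
    using assms(1) unfolding first_pentagon_def by blast
  then obtain j where j: "k = Suc j" using assms(2) by (cases k) auto
  then obtain e where e: "e \<in> edges j" "R = child_pent e" using k(1) generation_Suc[of j] by blast
  obtain P Q where "e = (P, Q)" by (cases e)
  with e have PQ: "(P, Q) \<in> edges j" "R = child_pent (P, Q)" by simp_all
  then obtain R' where "R' \<in> generation j" "ends (P, Q) \<in> R'" using generation_Suc[of j] by blast
  then have "\<beta> \<notin> ends (P, Q)" using k(3)[of j] j by blast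
  moreover have "\<beta> \<in> \<Union> (ends ` children (P, Q))" using k(2) PQ Union_child_pent by metis
  ultimately show thesis by (intro that[OF PQ]) (auto simp: ends_def children_def)
qed

section \<open>The points joined to a vertex, in their order\<close>

text \<open>A common form for the counterclockwise angle (\<epsilon> = 1) and the clockwise angle
  (\<epsilon> = -1) from B. Of the two vectors V and -V of any other direction, one satisfies the
  sign condition, and on such vectors the order of angles is given by determinants.\<close>

definition oriented_angle :: "real \<Rightarrow> complex \<Rightarrow> (complex \<Rightarrow> real) \<Rightarrow> bool" where
  "oriented_angle \<epsilon> B \<Theta> \<longleftrightarrow>
     (\<forall>V. 0 < \<epsilon> * cross B V \<longrightarrow> 0 < \<Theta> (dir V)) \<and>
     (\<forall>V W. 0 < \<epsilon> * cross B V \<longrightarrow> 0 < \<epsilon> * cross B W \<longrightarrow>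
        (\<Theta> (dir V) < \<Theta> (dir W) \<longleftrightarrow> 0 < \<epsilon> * cross V W))"

lemma Arg2pi_dir:
  assumes "0 < Im w"
  shows "Arg2pi (dir w) = 2 * Arg2pi w" "0 < Arg2pi w" "Arg2pi w < pi"
proof -
  have w: "w \<noteq> 0" using assms by auto
  show a: "0 < Arg2pi w" "Arg2pi w < pi" using assms Arg2pi_lt_pi[of w] by blast+
  define r where "r = cmod w"
  have r: "0 < r" using w by (simp add: r_def)
  have e: "w = of_real r * exp (\<i> * of_real (Arg2pi w))" using Arg2pi_eq[of w] by (simp add: r_def)
  have c: "cnj (exp (\<i> * of_real (Arg2pi w))) = exp (- (\<i> * of_real (Arg2pi w)))"
    by (simp add: exp_cnj)
  have "dir w = exp (\<i> * of_real (Arg2pi w)) / exp (- (\<i> * of_real (Arg2pi w)))"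
    unfolding dir_def by (subst (1 2) e) (use r c in simp)
  also have "\<dots> = exp (\<i> * of_real (2 * Arg2pi w))"
    by (simp add: exp_minus exp_add[symmetric] field_simps)
  finally have "of_real 1 * exp (\<i> * of_real (2 * Arg2pi w)) = dir w" by simp
  then show "Arg2pi (dir w) = 2 * Arg2pi w" by (rule Arg2pi_unique) (use a in auto)
qed

lemma cross_Arg:
  assumes "0 < Im v" "0 < Im w"
  shows "0 < cross v w \<longleftrightarrow> Arg2pi v < Arg2pi w"
proof -
  have nz: "v \<noteq> 0" "w \<noteq> 0" using assms by auto
  have "v = of_real (cmod v) * cis (Arg2pi v)" "w = of_real (cmod w) * cis (Arg2pi w)"
    using Arg2pi_eq[of v] Arg2pi_eq[of w] by (simp_all only: cis_conv_exp)
  then have "cross v w = cmod v * (cmod w * cross (cis (Arg2pi v)) (cis (Arg2pi w)))"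
    by (metis cross_simps(7,8))
  then have c: "cross v w = cmod v * cmod w * sin (Arg2pi w - Arg2pi v)" by (simp add: cross_cis)
  have a: "0 < Arg2pi v" "Arg2pi v < pi" "0 < Arg2pi w" "Arg2pi w < pi" using Arg2pi_dir(2,3) assms by auto
  have "0 < sin (Arg2pi w - Arg2pi v) \<longleftrightarrow> Arg2pi v < Arg2pi w"
  proof
    assume s: "0 < sin (Arg2pi w - Arg2pi v)"
    show "Arg2pi v < Arg2pi w"
    proof (rule ccontr)
      assume "\<not> Arg2pi v < Arg2pi w"
      then have "0 \<le> sin (Arg2pi v - Arg2pi w)" using a by (intro sin_ge_zero) auto
      then show False using s sin_minus[of "Arg2pi w - Arg2pi v"] by simp
    qed
  next
    assume "Arg2pi v < Arg2pi w"
    then show "0 < sin (Arg2pi w - Arg2pi v)" using a by (intro sin_gt_zero) auto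
  qed
  moreover have "0 < cmod v * cmod w" using nz by simp
  ultimately show ?thesis unfolding c using mult_less_cancel_left_pos[of "cmod v * cmod w" 0] by simp
qed

lemma Im_of_real_mult: "Im (of_real r * z) = r * Im z"
  by simp

lemma cross_div: "B \<noteq> 0 \<Longrightarrow> cross B V = (cmod B)\<^sup>2 * Im (V / B)"
proof -
  assume B: "B \<noteq> 0"
  have "cnj B * V = (B * cnj B) * (V / B)" using B by simp
  also have "\<dots> = of_real ((cmod B)\<^sup>2) * (V / B)" by (simp only: complex_norm_square)
  finally show ?thesis unfolding cross_def by (simp only: Im_of_real_mult)
qed

lemma cross_div_div: "B \<noteq> 0 \<Longrightarrow> cross V W = (cmod B)\<^sup>2 * cross (V / B) (W / B)"
proof -
  assume B: "B \<noteq> 0"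
  have "cnj V * W = (B * cnj B) * (cnj (V / B) * (W / B))" using B by simp
  also have "\<dots> = of_real ((cmod B)\<^sup>2) * (cnj (V / B) * (W / B))" by (simp only: complex_norm_square)
  finally show ?thesis unfolding cross_def by (simp only: Im_of_real_mult)
qed

lemma ccw_oriented: "B \<noteq> 0 \<Longrightarrow> oriented_angle 1 B (ccw_angle (dir B))"
proof -
  assume B: "B \<noteq> 0"
  have dd: "dir V / dir B = dir (V / B)" for V using B by (simp add: dir_def)
  have im: "0 < cross B V \<longleftrightarrow> 0 < Im (V / B)" for V
    unfolding cross_div[OF B] using B by (simp add: zero_less_mult_iff)
  have cr: "0 < cross V W \<longleftrightarrow> 0 < cross (V / B) (W / B)" for V W
    unfolding cross_div_div[OF B, of V W] using B by (simp add: zero_less_mult_iff)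
  show ?thesis unfolding oriented_angle_def ccw_angle_def mult_1
  proof (intro conjI allI impI)
    fix V assume "0 < cross B V"
    then show "0 < Arg2pi (dir V / dir B)"
      unfolding dd using im[of V] Arg2pi_dir[of "V / B"] by simp
  next
    fix V W assume VW: "0 < cross B V" "0 < cross B W"
    then have i: "0 < Im (V / B)" "0 < Im (W / B)" using im by blast+
    show "Arg2pi (dir V / dir B) < Arg2pi (dir W / dir B) \<longleftrightarrow> 0 < cross V W"
      unfolding dd Arg2pi_dir(1)[OF i(1)] Arg2pi_dir(1)[OF i(2)] cr[of V W] cross_Arg[OF i] by simp
  qed
qed

text \<open>Complex conjugation reverses the orientation and reduces the claim to the
  counterclockwise case.\<close>

lemma cw_oriented: "B \<noteq> 0 \<Longrightarrow> oriented_angle (- 1) B (cw_angle (dir B))"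
proof -
  assume "B \<noteq> 0"
  then have B: "cnj B \<noteq> 0" by simp
  have d: "cw_angle (dir B) (dir V) = ccw_angle (dir (cnj B)) (dir (cnj V))" for V
    by (simp add: cw_angle_def ccw_angle_def dir_def divide_simps mult.commute)
  have c: "- 1 * cross V W = cross (cnj V) (cnj W)" for V W by (simp add: cross_def algebra_simps)
  have s: "0 < - 1 * cross V W \<longleftrightarrow> 0 < 1 * cross (cnj V) (cnj W)" for V W unfolding c by simp
  show ?thesis unfolding oriented_angle_def d s
    using ccw_oriented[OF B] unfolding oriented_angle_def by blast
qed

lemma decreasing_enumeration_unique:
  fixes \<Theta> :: "'a \<Rightarrow> real"
  assumes g: "\<And>n. \<Theta> (g (Suc n)) < \<Theta> (g n)" and h: "\<And>n. \<Theta> (h (Suc n)) < \<Theta> (h n)"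
    and "range g = range h"
  shows "g n = h n"
proof (induction n rule: less_induct)
  case (less n)
  have mono: "\<Theta> (f j) < \<Theta> (f i)" if "\<And>n. \<Theta> (f (Suc n)) < \<Theta> (f n)" "i < j" for f :: "nat \<Rightarrow> 'a" and i j
    using that(2) by (induction rule: strict_inc_induct) (use that(1) less_trans in blast)+
  obtain m where m: "g n = h m" using assms(3) by (metis rangeI imageE)
  obtain m' where m': "h n = g m'" using assms(3) by (metis rangeI imageE)
  have "n \<le> m"
  proof (rule ccontr)
    assume "\<not> n \<le> m"
    then have "m < n" by simp
    then have "g m = h m" "\<Theta> (g n) < \<Theta> (g m)" using less.IH mono[of g, OF g] by blast+
    with m show False by simp
  qed
  moreover have "n \<le> m'"
  proof (rule ccontr)
    assume "\<not> n \<le> m'"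
    then have "m' < n" by simp
    then have "g m' = h m'" "\<Theta> (h n) < \<Theta> (h m')" using less.IH mono[of h, OF h] by blast+
    with m' show False by simp
  qed
  moreover have "\<not> n < m" 
  proof
    assume "n < m"
    then have "\<Theta> (g n) < \<Theta> (h n)" using mono[of h, OF h] m by simp
    moreover have "\<Theta> (g m') \<le> \<Theta> (g n)" using mono[of g, OF g, of n m'] \<open>n \<le> m'\<close> by (cases "n = m'") auto
    ultimately show False using m' by simp
  qed
  ultimately show ?case using m by simp
qed

lemma children_swap: "children (Q, P) = prod.swap ` children (P, Q)"
proof -
  have c: "\<phi> * Q + P = P + \<phi> * Q" "\<phi> * Q + \<phi> * P = \<phi> * P + \<phi> * Q" "Q + \<phi> * P = \<phi> * P + Q"
    by simp_all
  show ?thesis unfolding children_def prod.case c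
    by (simp only: image_insert image_empty swap_simp insert_commute)
qed

lemma descendants_swap: "descendants n (Q, P) = prod.swap ` descendants n (P, Q)"
proof (induction n)
  case (Suc n)
  have "children (prod.swap e) = prod.swap ` children e" for e :: "complex \<times> complex"
    by (cases e) (simp only: swap_simp, rule children_swap)
  with Suc show ?case by (simp add: image_UN)
qed simp

lemma ends_swap: "ends (prod.swap e) = ends e"
  by (cases e) (simp add: ends_def insert_commute)

lemma arc_swap: "ideal_arc (prod.swap e) = ideal_arc e"
proof -
  have sub: "ideal_arc (Q, P) \<subseteq> ideal_arc (P, Q)" for P Q
  proof
    fix z assume "z \<in> ideal_arc (Q, P)"
    then obtain s t where st: "0 < s" "0 < t" "z = dir (of_real s * Q + of_real t * P)"
      unfolding ideal_arc_def prod.case by blast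
    show "z \<in> ideal_arc (P, Q)" unfolding ideal_arc_def prod.case
      by (intro CollectI exI[of _ t] exI[of _ s]) (simp add: st add.commute)
  qed
  obtain P Q where "e = (P, Q)" by (cases e)
  then show ?thesis using sub[of P Q] sub[of Q P] by simp
qed

text \<open>The n-fold passage to the child edge that keeps the end B.\<close>

definition fan_edge :: "complex \<times> complex \<Rightarrow> nat \<Rightarrow> complex \<times> complex" where
  "fan_edge = (\<lambda>(B, Y) n. (B, Y + of_nat n * (\<phi> * B)))"

lemma fan_edge_descendant: "fan_edge e n \<in> descendants n e"
proof (induction n)
  case 0
  show ?case by (cases e) (simp add: fan_edge_def)
next
  case (Suc n)
  obtain B Y where e: "e = (B, Y)" by (cases e)
  have "fan_edge e (Suc n) = (B, \<phi> * B + (Y + of_nat n * (\<phi> * B)))"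
    by (simp add: fan_edge_def e algebra_simps)
  then have "fan_edge e (Suc n) \<in> children (fan_edge e n)" by (simp add: children_def fan_edge_def e)
  with Suc show ?case by auto
qed

text \<open>B never lies inside the arc of a descendant, so it must be an end of every edge on the
  way down; among four children only one keeps it.\<close>

lemma fan_edge_unique:
  assumes "cross B Y \<noteq> 0" "f \<in> descendants n (B, Y)" "dir B \<in> ends f"
  shows "f = fan_edge (B, Y) n"
  using assms(2,3)
proof (induction n arbitrary: f)
  case 0
  then show ?case by (simp add: fan_edge_def)
next
  case (Suc n)
  then obtain h where h: "h \<in> descendants n (B, Y)" "f \<in> children h" by auto
  obtain P Q where PQ: "h = (P, Q)" by (cases h)
  have notin: "dir B \<notin> ideal_arc h"
    using descendant_properties(1)[OF h(1)] ends_not_arc[OF assms(1)] by (auto simp: ends_def)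
  then have "dir B \<in> ends h" using child_ends[of f P Q] h(2) PQ Suc.prems(2) by auto
  then have hn: "h = fan_edge (B, Y) n" using Suc.IH h(1) by simp
  then have P: "P = B" and Q: "Q = Y + of_nat n * (\<phi> * B)" using PQ by (simp_all add: fan_edge_def)
  have r: "dir (of_real s * P + of_real t * Q) \<noteq> dir B" if "0 < s" "0 < t" for s t
    using notin that unfolding PQ ideal_arc_def by auto
  have c: "cross B Q = cross B Y"
    using descendant_properties(3)[OF h(1)] PQ P by simp
  then have "dir Q \<noteq> dir B" using assms(1) dir_eq_iff[of B Q] cross_nz[of B Q] by auto
  moreover have "f = (P, \<phi> * P + Q) \<or> f = (\<phi> * P + Q, \<phi> * P + \<phi> * Q) \<or>
     f = (\<phi> * P + \<phi> * Q, P + \<phi> * Q) \<or> f = (P + \<phi> * Q, Q)"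
    using h(2) by (simp add: PQ children_def)
  ultimately have "f = (P, \<phi> * P + Q)"
    using Suc.prems(2) r[of gphi 1] r[of gphi gphi] r[of 1 gphi] gphi(1) by (auto simp: ends_def)
  then show ?case by (simp add: fan_edge_def P Q algebra_simps)
qed

text \<open>A side that joins B to a point p inside the arc must be of level greater than k. Its
  ancestor at level k has p in its arc or among its ends; by disjointness it is the given edge, and
  \<open>fan_edge_unique\<close> applies.\<close>

lemma fan_points:
  assumes e: "(B, Y) \<in> edges k \<or> (Y, B) \<in> edges k"
  shows "joined (dir B) p \<and> (p \<in> ideal_arc (B, Y) \<or> p = dir Y) \<longleftrightarrow> (\<exists>n. p = dir (snd (fan_edge (B, Y) n)))"
proof -
  define e0 where "e0 = (if (B, Y) \<in> edges k then (B, Y) else (Y, B))"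
  have e0: "e0 \<in> edges k" "e0 = (B, Y) \<or> e0 = prod.swap (B, Y)" using e by (auto simp: e0_def)
  have c: "cross B Y \<noteq> 0" using edges_cross_pos[of B Y k] edges_cross_pos[of Y B k] cross_swap[of B Y] e by auto
  have arc0: "ideal_arc e0 = ideal_arc (B, Y)" and ends0: "ends e0 = {dir B, dir Y}"
    using e0(2) arc_swap[of "(B, Y)"] ends_swap[of "(B, Y)"] by (auto simp: ends_def)
  have desc: "f \<in> descendants n e0 \<longleftrightarrow> (if (B, Y) \<in> edges k then f else prod.swap f) \<in> descendants n (B, Y)" for f n
    unfolding e0_def by (cases f) (auto simp: descendants_swap[of n Y B])
  show ?thesis
  proof
    assume p: "joined (dir B) p \<and> (p \<in> ideal_arc (B, Y) \<or> p = dir Y)"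
    show "\<exists>n. p = dir (snd (fan_edge (B, Y) n))"
    proof (cases "p = dir Y")
      case True
      then show ?thesis by (intro exI[of _ 0]) (simp add: fan_edge_def)
    next
      case False
      with p have pa: "p \<in> ideal_arc e0" and "joined (dir B) p" by (auto simp: arc0)
      then obtain i f where f: "f \<in> edges i" "{dir B, p} = ends f" by (auto simp: joined_iff)
      have "k < i"
      proof (rule ccontr)
        assume "\<not> k < i"
        then show False using lower_ends[OF e0(1) f(1)] f(2) pa by auto
      qed
      then obtain h where h: "h \<in> edges k" "f \<in> descendants (i - k) h"
        using edges_ancestor[OF f(1), of k] by auto
      have "p \<in> ideal_arc h \<union> ends h" using descendant_properties(2)[OF h(2)] f(2) by auto
      moreover have "p \<notin> ends h" using edges_disjoint(2)[OF e0(1) h(1)] pa by auto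
      ultimately have "h = e0" using edges_disjoint(1)[OF e0(1) h(1)] pa by auto
      define f' where "f' = (if (B, Y) \<in> edges k then f else prod.swap f)"
      have f': "f' \<in> descendants (i - k) (B, Y)" "ends f' = ends f"
        using h(2) \<open>h = e0\<close> desc ends_swap by (auto simp: f'_def)
      then have "f' = fan_edge (B, Y) (i - k)" using fan_edge_unique[OF c f'(1)] f(2) by auto
      then have "{dir B, p} = {dir B, dir (snd (fan_edge (B, Y) (i - k)))}"
        using f'(2) f(2) by (simp add: ends_def fan_edge_def)
      moreover have "p \<noteq> dir B" using pa edges_disjoint(2)[OF e0(1) e0(1)] ends0 by auto
      ultimately show ?thesis by (auto simp: doubleton_eq_iff)
    qed
  next
    assume "\<exists>n. p = dir (snd (fan_edge (B, Y) n))"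
    then obtain n where n: "p = dir (snd (fan_edge (B, Y) n))" by blast
    define f where "f = (if (B, Y) \<in> edges k then fan_edge (B, Y) n else prod.swap (fan_edge (B, Y) n))"
    have "f \<in> descendants n e0" using desc fan_edge_descendant by (simp add: f_def)
    then have "f \<in> edges (k + n)" using e0(1) edges_add by blast
    moreover have "{dir B, p} = ends f"
      using ends_swap[of "fan_edge (B, Y) n"] by (simp add: f_def n ends_def fan_edge_def)
    ultimately have "joined (dir B) p" by (auto simp: joined_iff)
    moreover have "p \<in> ideal_arc (B, Y) \<or> p = dir Y"
    proof (cases n)
      case 0
      then show ?thesis using n by (simp add: fan_edge_def)
    next
      case (Suc m)
      have "snd (fan_edge (B, Y) n) = of_real (real n * gphi) * B + of_real 1 * Y"
        by (simp add: fan_edge_def algebra_simps)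
      moreover have "0 < real n * gphi" using Suc gphi by simp
      ultimately show ?thesis unfolding n ideal_arc_def prod.case by (metis (mono_tags, lifting) mem_Collect_eq zero_less_one)
    qed
    ultimately show "joined (dir B) p \<and> (p \<in> ideal_arc (B, Y) \<or> p = dir Y)" by blast
  qed
qed

text \<open>On the half plane controlled by \<epsilon>, the neighbours of B are represented by Y and
  -X, and Y has the smaller angle; so the sequence has to start at Y. By \<open>fan_points\<close>
  its range is that of Y + n\<phi>B, whose angles decrease, and a decreasing enumeration is
  determined by its range.\<close>

lemma one_sided_fan_points:
  assumes fan: "one_sided_fan \<Theta> (dir B) R g" and \<Theta>: "oriented_angle \<epsilon> B \<Theta>" and eps: "\<epsilon> = 1 \<or> \<epsilon> = - 1"
    and Y: "(B, Y) \<in> edges k \<or> (Y, B) \<in> edges k" "0 < \<epsilon> * cross B Y"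
    and X: "0 < \<epsilon> * cross X B" "0 < \<epsilon> * cross X Y"
    and R: "\<And>v. {dir B, v} \<in> R \<Longrightarrow> v = dir X \<or> v = dir Y" "dir Y \<in> \<Union> R"
  shows "g n = dir (Y + of_nat n * (\<phi> * B))"
proof -
  have pos: "0 < \<Theta> (dir V)" if "0 < \<epsilon> * cross B V" for V using \<Theta> that by (simp add: oriented_angle_def)
  have less: "\<Theta> (dir V) < \<Theta> (dir W) \<longleftrightarrow> 0 < \<epsilon> * cross V W"
    if "0 < \<epsilon> * cross B V" "0 < \<epsilon> * cross B W" for V W using \<Theta> that by (simp add: oriented_angle_def)
  have f: "{dir B, g 0} \<in> R" "\<And>v. v \<in> \<Union> R \<Longrightarrow> \<not> (0 < \<Theta> v \<and> \<Theta> v < \<Theta> (g 0))"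
    "range g = {p. joined (dir B) p \<and> \<Theta> p \<le> \<Theta> (g 0)}" "\<And>n. \<Theta> (g (Suc n)) < \<Theta> (g n)"
    using fan by (auto simp: one_sided_fan_def)
  have g0: "g 0 = dir Y"
  proof (rule ccontr)
    assume "g 0 \<noteq> dir Y"
    then have "g 0 = dir (- X)" using R(1)[OF f(1)] dir_uminus by simp
    moreover have "0 < \<epsilon> * cross B (- X)" "0 < \<epsilon> * cross Y (- X)"
      using X cross_swap[of B X] cross_swap[of Y X] by (simp_all add: cross_simps)
    ultimately have "\<Theta> (dir Y) < \<Theta> (g 0)" using less[OF Y(2)] by simp
    then show False using f(2)[OF R(2)] pos[OF Y(2)] by simp
  qed
  define h where "h n = dir (Y + of_nat n * (\<phi> * B))" for n :: nat
  have hv: "Y + of_nat n * (\<phi> * B) = Y + of_real (real n * gphi) * B" for n by simp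
  have cB: "cross B (Y + of_nat n * (\<phi> * B)) = cross B Y" for n
    unfolding hv by (simp only: cross_simps; simp)
  have hh: "\<Theta> (h m) < \<Theta> (h n) \<longleftrightarrow> n < m" for m n
  proof -
    have "cross (Y + of_nat m * (\<phi> * B)) (Y + of_nat n * (\<phi> * B)) = (real m * gphi - real n * gphi) * cross B Y"
      unfolding hv using cross_swap[of Y B] by (simp only: cross_simps; simp add: algebra_simps)
    moreover have "\<epsilon> * ((real m * gphi - real n * gphi) * cross B Y) = (real m - real n) * gphi * (\<epsilon> * cross B Y)"
      by (simp add: algebra_simps)
    ultimately have "\<Theta> (h m) < \<Theta> (h n) \<longleftrightarrow> 0 < (real m - real n) * gphi * (\<epsilon> * cross B Y)"
      unfolding h_def using less[of "Y + of_nat m * (\<phi> * B)" "Y + of_nat n * (\<phi> * B)"] Y(2) by (simp only: cB)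
    also have "\<dots> \<longleftrightarrow> n < m" 
    proof -
      have "0 < x * t \<longleftrightarrow> 0 < x" if "0 < t" for x t :: real using that by (simp add: zero_less_mult_iff)
      from this[OF Y(2), of "(real m - real n) * gphi"] this[OF gphi(1), of "real m - real n"] show ?thesis by simp
    qed
    finally show ?thesis .
  qed
  have arcY: "joined (dir B) p \<and> \<Theta> p \<le> \<Theta> (dir Y) \<longleftrightarrow> (\<exists>n. p = h n)" for p
  proof
    assume p: "joined (dir B) p \<and> \<Theta> p \<le> \<Theta> (dir Y)"
    then obtain i e where e: "e \<in> edges i" "{dir B, p} = ends e" by (auto simp: joined_iff)
    obtain P Q where PQ: "e = (P, Q)" by (cases e)
    have nz: "cross P Q \<noteq> 0" using edges_cross_pos[of P Q i] e PQ by simp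
    then have "dir P \<noteq> dir Q" using dir_eq_iff[of P Q] cross_nz[OF nz] by simp
    then obtain V0 where V0: "p = dir V0" "V0 \<noteq> 0" "dir B \<noteq> dir V0"
      using e(2) cross_nz[OF nz] unfolding PQ ends_def prod.case doubleton_eq_iff by auto
    have "B \<noteq> 0" using Y(2) by (auto simp: cross_simps)
    then have "cross B V0 \<noteq> 0" using V0 dir_eq_iff[of B V0] by auto
    \<comment> \<open>The representative on the side where the order of angles is known.\<close>
    define V where "V = (if 0 < \<epsilon> * cross B V0 then V0 else - V0)"
    have V: "p = dir V" "0 < \<epsilon> * cross B V"
      using V0(1) \<open>cross B V0 \<noteq> 0\<close> eps by (auto simp: V_def dir_uminus cross_simps)
    have "\<not> \<Theta> (dir Y) < \<Theta> (dir V)" using p V by simp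
    then have YV: "\<epsilon> * cross Y V \<le> 0" using less[OF Y(2) V(2)] by simp
    \<comment> \<open>The coordinates of V in the basis B, Y, by Cramer's rule. That p is not beyond
      Y makes s nonnegative, and s = 0 only for p = \<open>dir Y\<close>.\<close>
    define t s where "t = (\<epsilon> * cross B V) / (\<epsilon> * cross B Y)" and "s = - (\<epsilon> * cross Y V) / (\<epsilon> * cross B Y)"
    have ts: "0 < t" "0 \<le> s" 
    proof -
      show "0 < t" unfolding t_def using V(2) Y(2) by (rule divide_pos_pos)
      show "0 \<le> s" unfolding s_def by (rule divide_nonneg_pos[OF _ Y(2)]) (use YV in linarith)
    qed
    have ts': "t = cross B V / cross B Y" "s = - cross Y V / cross B Y" using eps by (auto simp: t_def s_def)
    have "of_real (cross B Y) * V = of_real (cross B V) * Y - of_real (cross Y V) * B"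
      by (simp add: cross_def complex_eq_iff algebra_simps)
    moreover have "cross B Y \<noteq> 0" using Y(2) by auto
    ultimately have Vst: "V = of_real s * B + of_real t * Y"
      by (simp add: ts' field_simps)
    have "p \<in> ideal_arc (B, Y) \<or> p = dir Y"
    proof (cases "s = 0")
      case True
      then show ?thesis using Vst ts(1) V(1) dir_scale[of t Y] by simp
    next
      case False
      then have "0 < s" using ts(2) by simp
      then show ?thesis using Vst ts(1) V(1) unfolding ideal_arc_def prod.case by blast
    qed
    then show "\<exists>n. p = h n" using fan_points[OF Y(1), of p] p by (auto simp: fan_edge_def h_def)
  next
    assume "\<exists>n. p = h n"
    then obtain n where n: "p = h n" by blast
    have "joined (dir B) p" using fan_points[OF Y(1), of p] n by (auto simp: fan_edge_def h_def)
    moreover have "\<Theta> p \<le> \<Theta> (dir Y)" using hh[of 0 n] n by (simp add: h_def not_less[symmetric])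
    ultimately show "joined (dir B) p \<and> \<Theta> p \<le> \<Theta> (dir Y)" by simp
  qed
  have "range g = range h" unfolding f(3) g0 arcY by auto
  then have "g n = h n" by (intro decreasing_enumeration_unique[where \<Theta> = \<Theta>]) (use f(4) hh in auto)
  then show ?thesis by (simp add: h_def)
qed

section \<open>Words along a fan\<close>

lemma word_power_0 [simp]: "word_power W 0 = []"
  and word_power_Suc: "word_power W (Suc n) = W @ word_power W n"
  by (simp_all add: word_power_def)

lemma word_power_shift: "word_power (a @ b) n @ a = a @ word_power (b @ a) n"
  by (induction n) (simp_all add: word_power_Suc)

lemma map_word_power: "map f (word_power W n) = word_power (map f W) n"
  by (induction n) (simp_all add: word_power_Suc)

lemma cyclic_append: "cyclic (a @ b) = cyclic (b @ a)"
  using cyclic_rotate[of "length a" "a @ b"] by (simp add: rotate_append)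

context coding
begin

lemma E_sides: "set (E i) \<subseteq> {..<5}"
proof -
  define d where "d = of_real 1 * P + of_real 0 * Q"
  have "run d (\<sigma> i) (cross d (k i) - cross P Q * (- ht i / 2)) (E i)"
    by (rule run_E[OF _ _ d_def]) (use ht_pos[of i] in \<open>simp_all add: in_cell_def\<close>)
  then show ?thesis by (rule run_sides)
qed

lemma F_sides: "set (F i) \<subseteq> {..<5}"
  using coding.E_sides[OF coding_swap, of "mirror i"] by (simp add: mirror_simps)

end

lemma label_sides: "set w \<subseteq> {..<5} \<Longrightarrow> map side_label w \<in> lists {1..5}"
proof -
  have "side_label j \<in> {1..5}" if "j < 5" for j
  proof -
    from that consider "j = 0" | "j = 1" | "j = 2" | "j = 3" | "j = 4" by linarith
    then show ?thesis by cases (simp_all add: side_label_def)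
  qed
  then show "set w \<subseteq> {..<5} \<Longrightarrow> map side_label w \<in> lists {1..5}"
    unfolding in_lists_conv_set by fastforce
qed

text \<open>The upward words after n twists: n times around the row of the cell, then up.\<close>

fun fan_F :: "(cell \<Rightarrow> nat list) \<Rightarrow> (cell \<Rightarrow> nat list) \<Rightarrow> nat \<Rightarrow> cell \<Rightarrow> nat list" where
  "fan_F E F n Corner = word_power (E Corner @ E Arm) n @ F Corner"
| "fan_F E F n Arm = word_power (E Arm @ E Corner) n @ F Arm"
| "fan_F E F n Top = word_power (E Top) n @ F Top"

lemma phi_eq: "of_real (1 + gold) = \<phi>"
  by (simp only: gphi_def)

lemma coding_fan:
  assumes "coding B Y \<sigma> k E F"
  shows "coding B (Y + of_nat n * (\<phi> * B)) \<sigma> k E (fan_F E F n)"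
proof (induction n)
  case 0
  have "fan_F E F 0 = F" by (rule ext) (case_tac x; simp)
  then show ?case using assms by simp
next
  case (Suc n)
  have F: "(\<lambda>i. path_word E (fan_F E F n) i (shear_F i)) = fan_F E F (Suc n)"
  proof
    fix i show "path_word E (fan_F E F n) i (shear_F i) = fan_F E F (Suc n) i"
      by (cases i) (simp_all add: word_power_Suc)
  qed
  have eq: "\<phi> * B + (Y + of_nat n * (\<phi> * B)) = Y + of_nat (Suc n) * (\<phi> * B)" by (simp add: algebra_simps)
  show ?case using coding.coding_shear[OF Suc] unfolding F phi_eq eq .
qed

lemma fan_orbits:
  assumes "coding B Y \<sigma> k E F"
  shows "short_orbit (dir (Y + of_nat n * (\<phi> * B)))
      (cyclic (map side_label (word_power (E Arm @ E Corner) n @ F Arm)))"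
    "long_orbit (dir (Y + of_nat n * (\<phi> * B)))
      (cyclic (map side_label (word_power (E Corner @ E Arm) n @ F Corner @ word_power (E Top) n @ F Top)))"
  using coding_orbits_Q[OF coding_fan[OF assms, of n]] by simp_all

text \<open>The two codings on the two sides of a vertex are chosen so that the words of its strips
  split into those of the first neighbours.\<close>

definition matched :: "(cell \<Rightarrow> nat list) \<Rightarrow> (cell \<Rightarrow> nat list) \<Rightarrow> (cell \<Rightarrow> nat list) \<Rightarrow> (cell \<Rightarrow> nat list) \<Rightarrow> bool" where
  "matched E F E' F' \<longleftrightarrow>
     E Arm @ E Corner = F Arm @ F' Arm \<and> E' Arm @ E' Corner = F' Arm @ F Arm \<and>
     E Corner @ E Arm = F Corner @ F' Corner \<and> E' Corner @ E' Arm = F' Corner @ F Corner \<and>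
     E Top = F Top @ F' Top \<and> E' Top = F' Top @ F Top"

definition matched_codings :: "complex \<Rightarrow> complex \<Rightarrow> complex \<Rightarrow> bool" where
  "matched_codings B X Y \<longleftrightarrow> (\<exists>\<sigma> k E F \<sigma>' k' E' F'. coding B Y \<sigma> k E F \<and> coding B X \<sigma>' k' E' F' \<and> matched E F E' F')"

lemma matched_codings_sym: "matched_codings B X Y \<Longrightarrow> matched_codings B Y X"
  unfolding matched_codings_def matched_def by metis

text \<open>Take n = 0 to see the roles of the six words: x and y are the short orbits of the two
  first neighbours of \<beta>, while z v and u w are their long orbits. The twists insert the
  powers, and \<open>word_power_shift\<close> brings these to the required form.\<close>

lemma matched_conclusion:
  assumes "matched_codings B X Y" and \<beta>: "\<beta> = dir B"
    and neg: "\<And>n. \<gamma> (- 1 - int n) = dir (X + of_nat n * (\<phi> * B))"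
    and pos: "\<And>n. \<gamma> (1 + int n) = dir (Y + of_nat n * (\<phi> * B))"
  shows "\<exists>u v x y z w :: nat list.
    {u, v, x, y, z, w} \<subseteq> lists {1..5} \<and>
    (let a = u @ v; A = x @ y; A' = z @ w in
       short_orbit \<beta> (cyclic a) \<and>
       long_orbit \<beta> (cyclic A) \<and>
       long_orbit \<beta> (cyclic A') \<and>
       cyclic A' = cyclic A \<and>
       (\<forall>n::nat.
          short_orbit (\<gamma> (- 1 - int n)) (cyclic (word_power A n @ x)) \<and>
          long_orbit (\<gamma> (- 1 - int n)) (cyclic (word_power A' n @ z @ v @ word_power a n)) \<and>
          short_orbit (\<gamma> (1 + int n)) (cyclic (y @ word_power A n)) \<and>
          long_orbit (\<gamma> (1 + int n)) (cyclic (word_power a n @ u @ w @ word_power A' n))))"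
proof -
  obtain \<sigma> k E F \<sigma>' k' E' F' where c: "coding B Y \<sigma> k E F" and c': "coding B X \<sigma>' k' E' F'"
    and m: "matched E F E' F'"
    using assms(1) unfolding matched_codings_def by (elim exE conjE) (rule that)
  define L where "L = map side_label"
  define u v x y z w where "u = L (F Top)" and "v = L (F' Top)" and "x = L (F' Arm)" and "y = L (F Arm)"
    and "z = L (F' Corner)" and "w = L (F Corner)"
  note defs = u_def v_def x_def y_def z_def w_def
  have L: "L (p @ q) = L p @ L q" "L (word_power p n) = word_power (L p) n" for p q n
    by (simp_all add: L_def map_word_power)
  note m' = m[unfolded matched_def]
  have E: "L (E Arm @ E Corner) = y @ x" "L (E' Arm @ E' Corner) = x @ y" "L (E Corner @ E Arm) = w @ z"
    "L (E' Corner @ E' Arm) = z @ w" "L (E Top) = u @ v" "L (E' Top) = v @ u"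
    using m' by (simp_all only: L defs)
  note E' = E[unfolded L(1)]
  have 1: "short_orbit \<beta> (cyclic (u @ v))"
    using coding_orbits_P(1)[OF c] E(5) unfolding \<beta> L_def by simp
  have 2: "long_orbit \<beta> (cyclic (z @ w))"
    using coding_orbits_P(2)[OF c'] E(4) unfolding \<beta> L_def by simp
  \<comment> \<open>Both words read the same row of the L, one from \<open>Corner\<close> and the
    other from \<open>Arm\<close>.\<close>
  have 3: "cyclic (z @ w) = cyclic (x @ y)"
  proof -
    have "cyclic (L (E' Corner @ E' Arm)) = cyclic (L (E' Arm @ E' Corner))"
      unfolding L(1) by (rule cyclic_append)
    then show ?thesis unfolding E .
  qed
  have 4: "short_orbit (\<gamma> (- 1 - int n)) (cyclic (word_power (x @ y) n @ x))" for n
    using fan_orbits(1)[OF c', of n] unfolding neg L_def[symmetric] L E' x_def[symmetric] .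
  have 5: "short_orbit (\<gamma> (1 + int n)) (cyclic (y @ word_power (x @ y) n))" for n
    using fan_orbits(1)[OF c, of n] unfolding pos L_def[symmetric] L E' y_def[symmetric] word_power_shift .
  have 6: "long_orbit (\<gamma> (- 1 - int n)) (cyclic (word_power (z @ w) n @ z @ v @ word_power (u @ v) n))" for n
    using fan_orbits(2)[OF c', of n]
    unfolding neg L_def[symmetric] L E' z_def[symmetric] v_def[symmetric] word_power_shift .
  \<comment> \<open>The coding yields the part built from w and z first; a rotation of the cyclic
    word puts the part built from u and v in front.\<close>
  have 7: "long_orbit (\<gamma> (1 + int n)) (cyclic (word_power (u @ v) n @ u @ w @ word_power (z @ w) n))" for n
  proof -
    have "word_power (w @ z) n @ w @ word_power (u @ v) n @ u =
      (w @ word_power (z @ w) n) @ (word_power (u @ v) n @ u)"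
      using word_power_shift[of w z n] by (metis append.assoc)
    moreover have "cyclic ((w @ word_power (z @ w) n) @ (word_power (u @ v) n @ u)) =
      cyclic (word_power (u @ v) n @ u @ w @ word_power (z @ w) n)"
      unfolding cyclic_append[of "w @ word_power (z @ w) n"] by simp
    ultimately have "cyclic (word_power (w @ z) n @ w @ word_power (u @ v) n @ u) =
      cyclic (word_power (u @ v) n @ u @ w @ word_power (z @ w) n)"
      by (simp only:)
    then show ?thesis using fan_orbits(2)[OF c, of n]
      unfolding pos L_def[symmetric] L E' w_def[symmetric] u_def[symmetric] by simp
  qed
  have "{u, v, x, y, z, w} \<subseteq> lists {1..5}"
    using label_sides coding.F_sides[OF c] coding.F_sides[OF c'] unfolding defs L_def by blast
  with 1 2 3 4 5 6 7 show ?thesis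
    by (intro exI[of _ u] exI[of _ v] exI[of _ x] exI[of _ y] exI[of _ z] exI[of _ w]) (simp add: Let_def)
qed

section \<open>Codings at new vertices and the conclusion\<close>

text \<open>One side of \<phi>P + Q is coded by the turn, the other by the twist with its two
  vectors exchanged. All words are concatenations of the words of (P, Q), and they match letter by
  letter.\<close>

lemma matched_r1:
  assumes "coding P Q \<sigma> k E F"
  shows "matched_codings (\<phi> * P + Q) P (\<phi> * P + \<phi> * Q)"
proof -
  have c: "coding (\<phi> * P + Q) (\<phi> * P + \<phi> * Q) (\<lambda>i. \<sigma> (turn i)) (\<lambda>i. k (turn i))
     (\<lambda>i. path_word E F (turn i) (turn_E i)) (\<lambda>i. path_word E F (turn i) (turn_F i))"
    using coding.coding_turn[OF assms] unfolding phi_eq distrib_left .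
  have c': "coding (\<phi> * P + Q) P (\<lambda>i. \<sigma> (mirror i)) (\<lambda>i. k (mirror i))
     (\<lambda>i. path_word E F (mirror i) (shear_F (mirror i))) (\<lambda>i. E (mirror i))"
    using coding.coding_swap[OF coding.coding_shear[OF assms]] unfolding phi_eq .
  have "matched (\<lambda>i. path_word E F (turn i) (turn_E i)) (\<lambda>i. path_word E F (turn i) (turn_F i))
     (\<lambda>i. path_word E F (mirror i) (shear_F (mirror i))) (\<lambda>i. E (mirror i))"
    by (simp add: matched_def)
  with c c' show ?thesis unfolding matched_codings_def by (intro exI conjI)
qed

text \<open>The middle vertex is symmetric: both its sides are coded by the turn, once for (P, Q)
  and once for its mirror image (Q, P).\<close>

lemma matched_r2:
  assumes "coding P Q \<sigma> k E F"
  shows "matched_codings (\<phi> * P + \<phi> * Q) (\<phi> * P + Q) (P + \<phi> * Q)"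
proof -
  let ?E = "\<lambda>i. F (mirror i)" and ?F = "\<lambda>i. E (mirror i)"
  have c: "coding (\<phi> * P + \<phi> * Q) (\<phi> * P + Q) (\<lambda>i. \<sigma> (turn (mirror i))) (\<lambda>i. k (turn (mirror i)))
     (\<lambda>i. path_word E F (turn (mirror i)) (turn_F (mirror i)))
     (\<lambda>i. path_word E F (turn (mirror i)) (turn_E (mirror i)))"
    using coding.coding_swap[OF coding.coding_turn[OF assms]] unfolding phi_eq distrib_left .
  have eq: "\<phi> * Q + P = P + \<phi> * Q" "\<phi> * (Q + P) = \<phi> * P + \<phi> * Q"
    by (simp_all add: algebra_simps)
  have c': "coding (\<phi> * P + \<phi> * Q) (P + \<phi> * Q) (\<lambda>i. \<sigma> (mirror (turn (mirror i)))) (\<lambda>i. k (mirror (turn (mirror i))))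
     (\<lambda>i. path_word ?E ?F (turn (mirror i)) (turn_F (mirror i)))
     (\<lambda>i. path_word ?E ?F (turn (mirror i)) (turn_E (mirror i)))"
    using coding.coding_swap[OF coding.coding_turn[OF coding.coding_swap[OF assms]]] unfolding phi_eq eq .
  have "matched (\<lambda>i. path_word ?E ?F (turn (mirror i)) (turn_F (mirror i)))
     (\<lambda>i. path_word ?E ?F (turn (mirror i)) (turn_E (mirror i)))
     (\<lambda>i. path_word E F (turn (mirror i)) (turn_F (mirror i)))
     (\<lambda>i. path_word E F (turn (mirror i)) (turn_E (mirror i)))"
    by (simp add: matched_def)
  with c c' show ?thesis unfolding matched_codings_def by (intro exI conjI)
qed

text \<open>The four new sides come from the twist, the turn and the mirror images of the
  two.\<close>

lemma coding_children:
  assumes "coding P Q \<sigma> k E F" "(A, B) \<in> children (P, Q)"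
  shows "\<exists>\<sigma> k E F. coding A B \<sigma> k E F"
proof -
  let ?has = "\<lambda>A B. \<exists>\<sigma> k E F. coding A B \<sigma> k E F"
  have "?has P (\<phi> * P + Q)" using coding.coding_shear[OF assms(1)] unfolding phi_eq by (intro exI)
  moreover have "?has (\<phi> * P + Q) (\<phi> * P + \<phi> * Q)" "?has (\<phi> * P + \<phi> * Q) (P + \<phi> * Q)"
    using matched_r1[OF assms(1)] matched_r2[OF assms(1)] unfolding matched_codings_def by metis+
  moreover have "?has (P + \<phi> * Q) Q"
  proof -
    have eq: "\<phi> * Q + P = P + \<phi> * Q" by simp
    show ?thesis using coding.coding_swap[OF coding.coding_shear[OF coding.coding_swap[OF assms(1)]]]
      unfolding phi_eq eq by (intro exI)
  qed
  moreover have "(A, B) = (P, \<phi> * P + Q) \<or> (A, B) = (\<phi> * P + Q, \<phi> * P + \<phi> * Q) \<or>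
     (A, B) = (\<phi> * P + \<phi> * Q, P + \<phi> * Q) \<or> (A, B) = (P + \<phi> * Q, Q)"
    using assms(2) by (simp add: children_def)
  ultimately show ?thesis by (elim disjE) (simp_all only: prod.inject)
qed

lemma coding_edges: "(P, Q) \<in> edges k \<Longrightarrow> \<exists>\<sigma> \<kappa> E F. coding P Q \<sigma> \<kappa> E F"
proof (induction k arbitrary: P Q)
  case 0
  then show ?case using coding_base by (auto simp: edges_0)
next
  case (Suc k)
  then obtain e where e: "e \<in> edges k" "(P, Q) \<in> children e" by (auto simp: edges_Suc)
  obtain P' Q' where "e = (P', Q')" by (cases e)
  moreover from this obtain \<sigma> \<kappa> E F where "coding P' Q' \<sigma> \<kappa> E F" using Suc.IH[of P' Q'] e(1) by metis
  ultimately show ?case using coding_children e(2) by simp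
qed

lemma pentagon_neighbours:
  assumes c: "cross P Q \<noteq> 0"
  defines "R \<equiv> child_pent (P, Q)"
  shows "{dir (\<phi> * P + Q), v} \<in> R \<Longrightarrow> v = dir P \<or> v = dir (\<phi> * P + \<phi> * Q)"
    "{dir (\<phi> * P + \<phi> * Q), v} \<in> R \<Longrightarrow> v = dir (\<phi> * P + Q) \<or> v = dir (P + \<phi> * Q)"
    "{dir (P + \<phi> * Q), v} \<in> R \<Longrightarrow> v = dir (\<phi> * P + \<phi> * Q) \<or> v = dir Q"
proof -
  define p r1 r2 r3 q where "p = dir P" and "r1 = dir (\<phi> * P + Q)" and "r2 = dir (\<phi> * P + \<phi> * Q)"
    and "r3 = dir (P + \<phi> * Q)" and "q = dir Q"
  have g: "gphi \<noteq> 0" "gphi \<noteq> 1" "gphi * gphi \<noteq> 1" "gphi * gphi \<noteq> gphi" using gphi by auto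
  note d = dir_combine_eq_iff[OF c]
  have "p \<noteq> r1" "p \<noteq> r2" "p \<noteq> r3" "p \<noteq> q" "r1 \<noteq> r2" "r1 \<noteq> r3" "r1 \<noteq> q" "r2 \<noteq> r3" "r2 \<noteq> q" "r3 \<noteq> q"
    using d[of 1 0 gphi 1] d[of 1 0 gphi gphi] d[of 1 0 1 gphi] d[of 1 0 0 1] d[of gphi 1 gphi gphi]
      d[of gphi 1 1 gphi] d[of gphi 1 0 1] d[of gphi gphi 1 gphi] d[of gphi gphi 0 1] d[of 1 gphi 0 1] g
    by (simp_all add: p_def r1_def r2_def r3_def q_def)
  moreover have "R = {{p, r1}, {r1, r2}, {r2, r3}, {r3, q}, {p, q}}"
    by (simp add: R_def child_pent_def p_def r1_def r2_def r3_def q_def)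
  ultimately have "({r1, v} \<in> R \<longrightarrow> v = p \<or> v = r2) \<and> ({r2, v} \<in> R \<longrightarrow> v = r1 \<or> v = r3) \<and> ({r3, v} \<in> R \<longrightarrow> v = r2 \<or> v = q)"
    by (simp add: doubleton_eq_iff)
  then show "{dir (\<phi> * P + Q), v} \<in> R \<Longrightarrow> v = dir P \<or> v = dir (\<phi> * P + \<phi> * Q)"
    "{dir (\<phi> * P + \<phi> * Q), v} \<in> R \<Longrightarrow> v = dir (\<phi> * P + Q) \<or> v = dir (P + \<phi> * Q)"
    "{dir (P + \<phi> * Q), v} \<in> R \<Longrightarrow> v = dir (\<phi> * P + \<phi> * Q) \<or> v = dir Q"
    unfolding p_def r1_def r2_def r3_def q_def by blast+
qed

lemma neighbours_of_new_vertex: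
  assumes e: "(P, Q) \<in> edges k" and R: "R = child_pent (P, Q)"
    and \<beta>: "\<beta> = dir (\<phi> * P + Q) \<or> \<beta> = dir (\<phi> * P + \<phi> * Q) \<or> \<beta> = dir (P + \<phi> * Q)"
  obtains B X Y where "\<beta> = dir B" "matched_codings B X Y" "(X, B) \<in> edges (Suc k)" "(B, Y) \<in> edges (Suc k)"
    "0 < cross X Y" "dir X \<in> \<Union> R" "dir Y \<in> \<Union> R" "\<And>v. {dir B, v} \<in> R \<Longrightarrow> v = dir X \<or> v = dir Y"
proof -
  let ?r1 = "\<phi> * P + Q" and ?r2 = "\<phi> * P + \<phi> * Q" and ?r3 = "P + \<phi> * Q"
  obtain \<sigma> \<kappa> E F where c: "coding P Q \<sigma> \<kappa> E F" using coding_edges[OF e] by metis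
  have K: "0 < cross P Q" by (rule edges_cross_pos[OF e])
  then have "cross P Q \<noteq> 0" by simp
  note n = pentagon_neighbours[OF this]
  have ch: "x \<in> children (P, Q) \<Longrightarrow> x \<in> edges (Suc k)" for x using e by (auto simp: edges_Suc)
  have ed: "(P, ?r1) \<in> edges (Suc k)" "(?r1, ?r2) \<in> edges (Suc k)" "(?r2, ?r3) \<in> edges (Suc k)" "(?r3, Q) \<in> edges (Suc k)"
    by (rule ch, simp add: children_def)+
  have v: "dir P \<in> \<Union> R" "dir ?r1 \<in> \<Union> R" "dir ?r2 \<in> \<Union> R" "dir ?r3 \<in> \<Union> R" "dir Q \<in> \<Union> R"
    by (simp_all add: R child_pent_def)
  have x: "0 < cross P ?r2" "0 < cross ?r1 ?r3" "0 < cross ?r2 Q"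
  proof -
    show "0 < cross P ?r2" using cross_combine[of 1 P 0 Q gphi gphi] K gphi by simp
    show "0 < cross ?r1 ?r3" using cross_combine[of gphi P 1 Q 1 gphi] K gphi by simp
    show "0 < cross ?r2 Q" using cross_combine[of gphi P gphi Q 0 1] K gphi by simp
  qed
  from \<beta> show thesis
  proof (elim disjE)
    assume "\<beta> = dir ?r1"
    then show thesis using that[OF _ matched_r1[OF c] ed(1,2) x(1) v(1,3)] n(1) R by blast
  next
    assume "\<beta> = dir ?r2"
    then show thesis using that[OF _ matched_r2[OF c] ed(2,3) x(2) v(2,4)] n(2) R by blast
  next
    assume "\<beta> = dir ?r3"
    \<comment> \<open>The third new vertex is the first one for the pair (Q, P); its neighbours then
      appear in reverse order.\<close>
    have eq: "\<phi> * Q + P = ?r3" "\<phi> * Q + \<phi> * P = ?r2" by simp_all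
    have "matched_codings ?r3 ?r2 Q"
      using matched_codings_sym[OF matched_r1[OF coding.coding_swap[OF c]]] unfolding eq .
    then show thesis using that[OF \<open>\<beta> = dir ?r3\<close> _ ed(3,4) x(3) v(3,5)] n(3) R by blast
  qed
qed

theorem theorem4:
  fixes \<beta> :: complex and \<gamma> :: "int \<Rightarrow> complex"
  assumes "periodic_direction \<beta>"
    and "\<beta> \<notin> \<Union> base_pentagon"
    and "fan \<beta> \<gamma>"
  shows "\<exists>u v x y z w :: nat list.
    {u, v, x, y, z, w} \<subseteq> lists {1..5} \<and>
    (let a = u @ v; A = x @ y; A' = z @ w in
       short_orbit \<beta> (cyclic a) \<and>
       long_orbit \<beta> (cyclic A) \<and>
       long_orbit \<beta> (cyclic A') \<and>
       cyclic A' = cyclic A \<and>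
       (\<forall>n::nat.
          short_orbit (\<gamma> (- 1 - int n)) (cyclic (word_power A n @ x)) \<and>
          long_orbit (\<gamma> (- 1 - int n)) (cyclic (word_power A' n @ z @ v @ word_power a n)) \<and>
          short_orbit (\<gamma> (1 + int n)) (cyclic (y @ word_power A n)) \<and>
          long_orbit (\<gamma> (1 + int n)) (cyclic (word_power a n @ u @ w @ word_power A' n))))"
proof -
  obtain R where R: "first_pentagon \<beta> R" and fans:
    "one_sided_fan (ccw_angle \<beta>) \<beta> R (\<lambda>n. \<gamma> (- 1 - int n)) \<and> one_sided_fan (cw_angle \<beta>) \<beta> R (\<lambda>n. \<gamma> (1 + int n)) \<or>
     one_sided_fan (cw_angle \<beta>) \<beta> R (\<lambda>n. \<gamma> (- 1 - int n)) \<and> one_sided_fan (ccw_angle \<beta>) \<beta> R (\<lambda>n. \<gamma> (1 + int n))"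
    using assms(3) unfolding fan_def Let_def by blast
  obtain k P Q where PQ: "(P, Q) \<in> edges k" "R = child_pent (P, Q)"
    "\<beta> = dir (\<phi> * P + Q) \<or> \<beta> = dir (\<phi> * P + \<phi> * Q) \<or> \<beta> = dir (P + \<phi> * Q)"
    by (rule first_pentagon_cases[OF R assms(2)])
  obtain B X Y where B: "\<beta> = dir B" "matched_codings B X Y" "(X, B) \<in> edges (Suc k)" "(B, Y) \<in> edges (Suc k)"
    "0 < cross X Y" "dir X \<in> \<Union> R" "dir Y \<in> \<Union> R" and nb: "\<And>v. {dir B, v} \<in> R \<Longrightarrow> v = dir X \<or> v = dir Y"
    by (rule neighbours_of_new_vertex[OF PQ]) (rule that)
  have XB: "0 < cross X B" and BY: "0 < cross B Y" using edges_cross_pos B(3,4) by auto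
  have nz: "B \<noteq> 0" using cross_nz[of B Y] BY by simp
  have sw: "cross B X = - cross X B" "cross Y B = - cross B Y" "cross Y X = - cross X Y"
    using cross_swap by blast+
  have ccw: "g n = dir (Y + of_nat n * (\<phi> * B))" if "one_sided_fan (ccw_angle \<beta>) \<beta> R g" for g n
    by (rule one_sided_fan_points[OF that[unfolded B(1)] ccw_oriented[OF nz], of Y "Suc k" X])
       (use B XB BY nb in auto)
  have cw: "g n = dir (X + of_nat n * (\<phi> * B))" if "one_sided_fan (cw_angle \<beta>) \<beta> R g" for g n
    by (rule one_sided_fan_points[OF that[unfolded B(1)] cw_oriented[OF nz], of X "Suc k" Y])
       (use B XB BY nb sw in auto)
  \<comment> \<open>Matching is symmetric in the two neighbours, so either side of \<beta> may carry
    the positive indices.\<close>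
  from fans show ?thesis
  proof (elim disjE conjE)
    assume "one_sided_fan (ccw_angle \<beta>) \<beta> R (\<lambda>n. \<gamma> (- 1 - int n))" "one_sided_fan (cw_angle \<beta>) \<beta> R (\<lambda>n. \<gamma> (1 + int n))"
    from matched_conclusion[OF matched_codings_sym[OF B(2)] B(1) ccw[OF this(1)] cw[OF this(2)]] show ?thesis .
  next
    assume "one_sided_fan (cw_angle \<beta>) \<beta> R (\<lambda>n. \<gamma> (- 1 - int n))" "one_sided_fan (ccw_angle \<beta>) \<beta> R (\<lambda>n. \<gamma> (1 + int n))"
    from matched_conclusion[OF B(2) B(1) cw[OF this(1)] ccw[OF this(2)]] show ?thesis .
  qed
qed

end
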